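(* Let $u_0\in\mathcal D(\mathcal L^\nu)$, $\nu\in[0,1]$. Let $u$ and $u_h$ be the solutions defined by $$u(t)=E(t)u_0+\int_0^t\bar E(t-s)f(u(s))\,ds,\quad t>0,$$ and $$u_h(t)=E_h(t)u_{0h}+\int_0^t\bar E_h(t-s)f(u_h(s))\,ds,\quad t>0,$$ respectively, with $u_{0h}=P_hu_0$. Then there is a constant $c=c(r,L,T_0)$, where $r\ge\|\mathcal L^\nu u_0\|+\|f(0)\|$, such that $$\|u_h(t)-u(t)\|\le c\,h^\gamma\,\ell_h(\nu)\,t^{-\alpha(1-\nu)},\qquad t\in(0,T_0],$$ where $\ell_h(\nu)=|\ln h|$ if $\nu=0$ and $\ell_h(\nu)=1$ otherwise. The constant $c$ is independent of the mesh parameter $h$, $0<h<1$.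
   Context: Setting. $\Omega\subset\mathbb R^d$ ($d\ge2$) is a bounded convex polyhedral domain, $T_0>0$ and $0<\alpha<1$ are fixed. $(\cdot,\cdot)$ and $\|\cdot\|$ are the inner product and norm of $L^2(\Omega)$. $\mathcal L u=-\mathrm{div}[A(x)\nabla u]+\kappa(x)u$ with homogeneous Dirichlet boundary condition and domain $\mathcal D(\mathcal L)=H^2(\Omega)\cap H^1_0(\Omega)$, where $A(x)$ is a symmetric $d\times d$ matrix, uniformly positive definite on $\bar\Omega$, $\kappa\in L^\infty(\Omega)$ is nonnegative, and all coefficients are sufficiently smooth on $\bar\Omega$. $\mathcal L$ is selfadjoint, positive definite with compact inverse; with eigenvalues $\lambda_j$ and $L^2$-orthonormal eigenfunctions $\varphi_j$, $\mathcal L^\nu v=\sum_j\lambda_j^\nu(v,\varphi_j)\varphi_j$ and $\mathcal D(\mathcal L^\nu)=\{v\in L^2(\Omega):\|\mathcal L^\nu v\|<\infty\}$, $\mathcal D(\mathcal L^0)=L^2(\Omega)$. Put $T=\mathcal L^{-1}:L^2(\Omega)\to\mathcal D(\mathcal L)$. Nonlinearity. $f=f(x,t,u)$ is a smooth real function of its arguments with $\sup_{x\in\Omega,\,t\in(0,T_0)}(|\partial_tf(x,t,u)|+|\partial_uf(x,t,u)|)\le L$ for all $u\in\mathbb R$. $f(u(s))$ denotes the function $x\mapsto f(x,s,u(x,s))$, and $f(0)$ denotes $f$ evaluated at $u=0$; since $f$ may depend on $t$, $\|f(0)\|$ is read as $\sup_{t\in[0,T_0]}\|f(\cdot,t,0)\|$.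 Approximation. $V_h\subset L^2(\Omega)$, $0<h<1$, is a family of finite-dimensional spaces and $P_h:L^2(\Omega)\to V_h$ is the $L^2$-orthogonal projection. $T_h:L^2(\Omega)\to V_h$ are linear operators such that: (i) $T_h$ is selfadjoint, positive semidefinite on $L^2(\Omega)$ and positive definite on $V_h$; (ii) $T_hP_h=T_h$; (iii) for some constants $\gamma>0$, $C>0$ independent of $h$, $\|T_hg-Tg\|\le Ch^\gamma\|g\|$ for all $g\in L^2(\Omega)$. Solution operators. Fix $\theta\in(\pi/2,\pi)$ and $\delta>0$; $\Gamma_{\theta,\delta}=\{\rho e^{\pm i\theta}:\rho\ge\delta\}\cup\{\delta e^{i\psi}:|\psi|\le\theta\}$, oriented with increasing imaginary part. With $K_h(z)=(z^{-\alpha}I+T_h)^{-1}T_h$, $$E_h(t)=\frac1{2\pi i}\int_{\Gamma_{\theta,\delta}}e^{zt}z^{-1}K_h(z)\,dz,\qquad \bar E_h(t)=\frac1{2\pi i}\int_{\Gamma_{\theta,\delta}}e^{zt}z^{-\alpha}K_h(z)\,dz,$$ and $E(t),\bar E(t)$ are defined in the same way with $K(z)=(z^{-\alpha}I+T)^{-1}T$ in place of $K_h(z)$. These formulas represent the solutions of $T\,{}^{C}\partial_t^\alpha u+u=Tf(u)$, $u(0)=u_0$ (equivalently ${}^{C}\partial_t^\alpha u+\mathcal Lu=f(u)$ with homogeneous Dirichlet condition) and of $T_h\,{}^{C}\partial_t^\alpha u_h+u_h=T_hf(u_h)$, $u_h(0)=u_{0h}$, where ${}^{C}\partial_t^\alpha\varphi(t)=\frac1{\Gamma(1-\alpha)}\int_0^t(t-s)^{-\alpha}\varphi'(s)\,ds$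 is the Caputo derivative. The dependence of $c$ on the fixed data ($\alpha$, $\nu$, $\Omega$, the coefficients of $\mathcal L$, the constants in (iii)) is not displayed.
   Formalization: For ν = 0 the bound is claimed only for 0 < h ≤ h₀ with an arbitrary fixed h₀ < 1, and c may then depend on h₀, since |ln h| → 0 as h → 1 while the error need not vanish; for ν > 0 it covers all 0 < h < 1. *)

theory Defs
  imports "HOL-Analysis.Analysis"
begin

section \<open>The Hilbert space of square integrable functions\<close>

definition sq_integrable :: "('a::euclidean_space \<Rightarrow> real) \<Rightarrow> bool" where
  "sq_integrable f \<longleftrightarrow> f \<in> borel_measurable lebesgue \<and> integrable lebesgue (\<lambda>x. (f x)\<^sup>2)"

lemma sq_integrable_zero: "sq_integrable (\<lambda>x. 0)"
  by (simp add: sq_integrable_def)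

lemma sq_integrable_mult:
  assumes "sq_integrable f" "sq_integrable g"
  shows "integrable lebesgue (\<lambda>x. f x * g x)"
proof (rule Bochner_Integration.integrable_bound)
  show "integrable lebesgue (\<lambda>x. (f x)\<^sup>2 + (g x)\<^sup>2)"
    using assms by (simp add: sq_integrable_def)
  show "(\<lambda>x. f x * g x) \<in> borel_measurable lebesgue"
    using assms by (auto simp: sq_integrable_def intro: borel_measurable_times)
  have "\<bar>a * b\<bar> \<le> a\<^sup>2 + b\<^sup>2" for a b :: real
  proof -
    have "2 * (\<bar>a\<bar> * \<bar>b\<bar>) \<le> a\<^sup>2 + b\<^sup>2"
      using sum_squares_bound[of "\<bar>a\<bar>" "\<bar>b\<bar>"] by (simp add: mult.assoc)
    moreover have "0 \<le> \<bar>a\<bar> * \<bar>b\<bar>" by (intro mult_nonneg_nonneg abs_ge_zero)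
    ultimately show ?thesis unfolding abs_mult by linarith
  qed
  then show "AE x in lebesgue. norm (f x * g x) \<le> norm ((f x)\<^sup>2 + (g x)\<^sup>2)"
    by auto
qed

lemma sq_integrable_add:
  assumes "sq_integrable f" "sq_integrable g"
  shows "sq_integrable (\<lambda>x. f x + g x)"
proof -
  have "integrable lebesgue (\<lambda>x. (f x)\<^sup>2 + (g x)\<^sup>2 + 2 * (f x * g x))"
    using assms sq_integrable_mult[OF assms] by (simp add: sq_integrable_def)
  then show ?thesis
    using assms borel_measurable_add[of f lebesgue g]
    by (simp add: sq_integrable_def power2_sum mult.assoc)
qed

lemma sq_integrable_scale:
  assumes "sq_integrable f"
  shows "sq_integrable (\<lambda>x. c * f x)"
  using assms borel_measurable_times[of "\<lambda>x. c" lebesgue f]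
  by (simp add: sq_integrable_def power_mult_distrib)

lemma sq_integrable_diff:
  assumes "sq_integrable f" "sq_integrable g"
  shows "sq_integrable (\<lambda>x. f x - g x)"
  using sq_integrable_add[OF assms(1) sq_integrable_scale[OF assms(2), of "-1"]] by simp

quotient_type (overloaded) 'a L2 = "'a::euclidean_space \<Rightarrow> real" / partial:
  "\<lambda>f g. sq_integrable f \<and> sq_integrable g \<and> (AE x in lebesgue. f x = g x)"
proof (rule part_equivpI)
  show "\<exists>f::'a \<Rightarrow> real. sq_integrable f \<and> sq_integrable f \<and> (AE x in lebesgue. f x = f x)"
    using sq_integrable_zero by auto
  show "symp (\<lambda>f g. sq_integrable f \<and> sq_integrable g \<and> (AE x in lebesgue. f x = g x))"
    by (auto intro!: sympI)
  show "transp (\<lambda>f g. sq_integrable f \<and> sq_integrable g \<and> (AE x in lebesgue. f x = g x))"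
    by (auto intro!: transpI elim: AE_mp)
qed

instantiation L2 :: (euclidean_space) real_inner
begin

lift_definition zero_L2 :: "'a L2" is "\<lambda>x. 0"
  by (simp add: sq_integrable_zero)

lift_definition plus_L2 :: "'a L2 \<Rightarrow> 'a L2 \<Rightarrow> 'a L2" is "\<lambda>f g x. f x + g x"
  by (auto simp: sq_integrable_add)

lift_definition minus_L2 :: "'a L2 \<Rightarrow> 'a L2 \<Rightarrow> 'a L2" is "\<lambda>f g x. f x - g x"
  by (auto simp: sq_integrable_diff)

lift_definition uminus_L2 :: "'a L2 \<Rightarrow> 'a L2" is "\<lambda>f x. - f x"
  using sq_integrable_scale[where c = "-1"] by auto

lift_definition scaleR_L2 :: "real \<Rightarrow> 'a L2 \<Rightarrow> 'a L2" is "\<lambda>c f x. c * f x"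
  by (auto simp: sq_integrable_scale)

lift_definition inner_L2 :: "'a L2 \<Rightarrow> 'a L2 \<Rightarrow> real" is "\<lambda>f g. LINT x|lebesgue. f x * g x"
  by (rule integral_cong_AE) (auto simp: sq_integrable_def elim: AE_mp)

definition norm_L2 :: "'a L2 \<Rightarrow> real" where "norm_L2 u = sqrt (inner u u)"
definition dist_L2 :: "'a L2 \<Rightarrow> 'a L2 \<Rightarrow> real" where "dist_L2 u v = norm (u - v)"
definition sgn_L2 :: "'a L2 \<Rightarrow> 'a L2" where "sgn_L2 u = inverse (norm u) *\<^sub>R u"
definition uniformity_L2 :: "('a L2 \<times> 'a L2) filter" where
  "uniformity_L2 = (INF e\<in>{0 <..}. principal {(u, v). dist u v < e})"
definition open_L2 :: "'a L2 set \<Rightarrow> bool" where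
  "open_L2 U \<longleftrightarrow> (\<forall>u\<in>U. eventually (\<lambda>(u', v). u' = u \<longrightarrow> v \<in> U) uniformity)"

instance
proof
  fix u v w :: "'a L2" and a b :: real
  show "u + v + w = u + (v + w)"
    by transfer (auto intro!: sq_integrable_add simp: add.assoc)
  show "u + v = v + u"
    by transfer (auto intro!: sq_integrable_add simp: add.commute)
  show "0 + u = u" by transfer auto
  show "- u + u = 0" by transfer (auto simp: sq_integrable_zero)
  show "u - v = u + - v"
    by transfer (auto intro!: sq_integrable_diff)
  show "a *\<^sub>R (u + v) = a *\<^sub>R u + a *\<^sub>R v"
    by transfer (auto intro!: sq_integrable_scale sq_integrable_add simp: distrib_left)
  show "(a + b) *\<^sub>R u = a *\<^sub>R u + b *\<^sub>R u"
    by transfer (auto intro!: sq_integrable_scale sq_integrable_add simp: distrib_right)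
  show "a *\<^sub>R b *\<^sub>R u = (a * b) *\<^sub>R u"
    by transfer (auto intro!: sq_integrable_scale simp: mult.assoc)
  show "1 *\<^sub>R u = u" by transfer auto
  show "dist u v = norm (u - v)" by (rule dist_L2_def)
  show "sgn u = inverse (norm u) *\<^sub>R u" by (rule sgn_L2_def)
  show "(uniformity :: ('a L2 \<times> 'a L2) filter) = (INF e\<in>{0 <..}. principal {(u, v). dist u v < e})"
    by (rule uniformity_L2_def)
  show "open U = (\<forall>u\<in>U. eventually (\<lambda>(u', v). u' = u \<longrightarrow> v \<in> U) uniformity)" for U :: "'a L2 set"
    by (rule open_L2_def)
  show "inner u v = inner v u" by transfer (simp add: mult.commute)
  show "inner (u + v) w = inner u w + inner v w"
    by transfer (simp add: distrib_right sq_integrable_mult)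
  show "inner (a *\<^sub>R u) v = a * inner u v"
    by transfer (simp add: mult.assoc)
  show "0 \<le> inner u u" by transfer simp
  show "inner u u = 0 \<longleftrightarrow> u = 0"
  proof transfer
    fix f :: "'a \<Rightarrow> real"
    assume f: "sq_integrable f \<and> sq_integrable f \<and> (AE x in lebesgue. f x = f x)"
    then have "integrable lebesgue (\<lambda>x. f x * f x)" by (simp add: sq_integrable_mult)
    then have "(LINT x|lebesgue. f x * f x) = 0 \<longleftrightarrow> (AE x in lebesgue. f x * f x = 0)"
      by (intro integral_nonneg_eq_0_iff_AE) auto
    with f show "(LINT x|lebesgue. f x * f x) = 0 \<longleftrightarrow>
      sq_integrable f \<and> sq_integrable (\<lambda>x. 0) \<and> (AE x in lebesgue. f x = 0)"
      by (simp add: sq_integrable_zero)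
  qed
  show "norm u = sqrt (inner u u)" by (rule norm_L2_def)
qed

end

text \<open>
  \<open>rep_L2 u\<close> is a representative of the class \<open>u\<close>. The space $L^2(\Omega)$ is identified with the
  closed subspace \<open>L2_on \<Omega>\<close> of classes that vanish outside \<open>\<Omega>\<close>, via extension by zero;
  \<open>to_L2 \<Omega> g\<close> is the class of \<open>g\<close> restricted to \<open>\<Omega>\<close> (for square integrable \<open>g\<close>).
\<close>

definition L2_on :: "'a::euclidean_space set \<Rightarrow> 'a L2 set" where
  "L2_on \<Omega> = {u. AE x in lebesgue. x \<notin> \<Omega> \<longrightarrow> rep_L2 u x = 0}"

definition to_L2 :: "'a::euclidean_space set \<Rightarrow> ('a \<Rightarrow> real) \<Rightarrow> 'a L2" where
  "to_L2 \<Omega> g = abs_L2 (\<lambda>x. if x \<in> \<Omega> then g x else 0)"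


section \<open>Smooth functions and Sobolev spaces\<close>

text \<open>Intended for open \<open>U\<close> and finite-dimensional domains.\<close>

primrec Ck_on :: "nat \<Rightarrow> 'a::real_normed_vector set \<Rightarrow> ('a \<Rightarrow> 'b::real_normed_vector) \<Rightarrow> bool" where
  "Ck_on 0 U f \<longleftrightarrow> continuous_on U f"
| "Ck_on (Suc k) U f \<longleftrightarrow> (\<forall>x\<in>U. f differentiable (at x)) \<and>
     (\<forall>v. Ck_on k U (\<lambda>x. frechet_derivative f (at x) v))"

definition Ck_near :: "nat \<Rightarrow> 'a::real_normed_vector set \<Rightarrow> ('a \<Rightarrow> 'b::real_normed_vector) \<Rightarrow> bool" where
  "Ck_near k S f \<longleftrightarrow> (\<exists>U. open U \<and> S \<subseteq> U \<and> Ck_on k U f)"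

definition smooth_near :: "'a::real_normed_vector set \<Rightarrow> ('a \<Rightarrow> 'b::real_normed_vector) \<Rightarrow> bool" where
  "smooth_near S f \<longleftrightarrow> (\<exists>U. open U \<and> S \<subseteq> U \<and> (\<forall>k. Ck_on k U f))"

definition test_functions :: "(real^'n) set \<Rightarrow> (real^'n \<Rightarrow> real) set" where
  "test_functions \<Omega> = {\<phi>. (\<forall>k. Ck_on k UNIV \<phi>) \<and>
     (\<exists>K. compact K \<and> K \<subseteq> \<Omega> \<and> (\<forall>x. x \<notin> K \<longrightarrow> \<phi> x = 0))}"

definition classical_partial :: "'n \<Rightarrow> (real^'n \<Rightarrow> real) \<Rightarrow> real^'n \<Rightarrow> real" where
  "classical_partial i \<phi> x = frechet_derivative \<phi> (at x) (axis i 1)"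

definition is_weak_partial :: "(real^'n) set \<Rightarrow> 'n \<Rightarrow> (real^'n) L2 \<Rightarrow> (real^'n) L2 \<Rightarrow> bool" where
  "is_weak_partial \<Omega> i u w \<longleftrightarrow> w \<in> L2_on \<Omega> \<and>
     (\<forall>\<phi>\<in>test_functions \<Omega>.
        (LINT x:\<Omega>|lebesgue. rep_L2 u x * classical_partial i \<phi> x) = - (LINT x:\<Omega>|lebesgue. rep_L2 w x * \<phi> x))"

definition weak_partial :: "(real^'n) set \<Rightarrow> 'n \<Rightarrow> (real^'n) L2 \<Rightarrow> (real^'n) L2" where
  "weak_partial \<Omega> i u = (THE w. is_weak_partial \<Omega> i u w)"

definition H1 :: "(real^'n) set \<Rightarrow> (real^'n) L2 set" where
  "H1 \<Omega> = {u \<in> L2_on \<Omega>. \<forall>i. \<exists>w. is_weak_partial \<Omega> i u w}"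

definition H1_norm :: "(real^'n) set \<Rightarrow> (real^'n) L2 \<Rightarrow> real" where
  "H1_norm \<Omega> u = sqrt ((norm u)\<^sup>2 + (\<Sum>i\<in>UNIV. (norm (weak_partial \<Omega> i u))\<^sup>2))"

definition H1_0 :: "(real^'n) set \<Rightarrow> (real^'n) L2 set" where
  "H1_0 \<Omega> = {u \<in> H1 \<Omega>. \<exists>\<phi>. (\<forall>n::nat. \<phi> n \<in> test_functions \<Omega>) \<and>
     (\<lambda>n. H1_norm \<Omega> (u - to_L2 \<Omega> (\<phi> n))) \<longlonglongrightarrow> 0}"

definition H2 :: "(real^'n) set \<Rightarrow> (real^'n) L2 set" where
  "H2 \<Omega> = {u \<in> H1 \<Omega>. \<forall>i. weak_partial \<Omega> i u \<in> H1 \<Omega>}"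


section \<open>The elliptic operator\<close>

definition convex_polyhedral_domain :: "(real^'n) set \<Rightarrow> bool" where
  "convex_polyhedral_domain \<Omega> \<longleftrightarrow>
     open \<Omega> \<and> \<Omega> \<noteq> {} \<and> bounded \<Omega> \<and> convex \<Omega> \<and> polyhedron (closure \<Omega>)"

text \<open>
  ``Sufficiently smooth'' coefficients: $A \in C^1(\overline\Omega)$ and $\kappa \in L^\infty(\Omega)$
  is all that is required, so every stronger smoothness assumption is covered.
\<close>

definition elliptic_coefficients ::
    "(real^'n) set \<Rightarrow> (real^'n \<Rightarrow> real^'n^'n) \<Rightarrow> (real^'n \<Rightarrow> real) \<Rightarrow> bool" where
  "elliptic_coefficients \<Omega> A \<kappa> \<longleftrightarrow>
     Ck_near 1 (closure \<Omega>) A \<and>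
     (\<forall>x\<in>closure \<Omega>. transpose (A x) = A x) \<and>
     (\<exists>a>0. \<forall>x\<in>closure \<Omega>. \<forall>\<xi>. a * (norm \<xi>)\<^sup>2 \<le> inner \<xi> (A x *v \<xi>)) \<and>
     \<kappa> \<in> borel_measurable (lebesgue_on \<Omega>) \<and>
     (\<exists>M. AE x in lebesgue_on \<Omega>. 0 \<le> \<kappa> x \<and> \<kappa> x \<le> M)"

definition flux :: "(real^'n) set \<Rightarrow> (real^'n \<Rightarrow> real^'n^'n) \<Rightarrow> (real^'n) L2 \<Rightarrow> 'n \<Rightarrow> (real^'n) L2" where
  "flux \<Omega> A u i = to_L2 \<Omega> (\<lambda>x. \<Sum>j\<in>UNIV. A x $ i $ j * rep_L2 (weak_partial \<Omega> j u) x)"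

definition elliptic_op ::
    "(real^'n) set \<Rightarrow> (real^'n \<Rightarrow> real^'n^'n) \<Rightarrow> (real^'n \<Rightarrow> real) \<Rightarrow> (real^'n) L2 \<Rightarrow> (real^'n) L2" where
  "elliptic_op \<Omega> A \<kappa> u =
     - (\<Sum>i\<in>UNIV. weak_partial \<Omega> i (flux \<Omega> A u i)) + to_L2 \<Omega> (\<lambda>x. \<kappa> x * rep_L2 u x)"

definition elliptic_domain :: "(real^'n) set \<Rightarrow> (real^'n) L2 set" where
  "elliptic_domain \<Omega> = H2 \<Omega> \<inter> H1_0 \<Omega>"

definition elliptic_inverse ::
    "(real^'n) set \<Rightarrow> (real^'n \<Rightarrow> real^'n^'n) \<Rightarrow> (real^'n \<Rightarrow> real) \<Rightarrow> (real^'n) L2 \<Rightarrow> (real^'n) L2" where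
  "elliptic_inverse \<Omega> A \<kappa> = inv_into (elliptic_domain \<Omega>) (elliptic_op \<Omega> A \<kappa>)"


section \<open>Operators on a Hilbert space\<close>

text \<open>
  In this section \<open>H\<close> is a closed subspace of the ambient type and plays the role of the Hilbert
  space. Linearity and selfadjointness are relative to \<open>H\<close>; values of operators outside their
  domain are irrelevant.
\<close>

definition linear_op_on :: "'h::real_vector set \<Rightarrow> ('h \<Rightarrow> 'h) \<Rightarrow> bool" where
  "linear_op_on H S \<longleftrightarrow>
     (\<forall>u\<in>H. \<forall>v\<in>H. S (u + v) = S u + S v) \<and> (\<forall>c. \<forall>u\<in>H. S (c *\<^sub>R u) = c *\<^sub>R S u)"

text \<open>The last conjunct says that the adjoint has no larger domain.\<close>

definition selfadjoint_on :: "'h::real_inner set \<Rightarrow> 'h set \<Rightarrow> ('h \<Rightarrow> 'h) \<Rightarrow> bool" where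
  "selfadjoint_on H D S \<longleftrightarrow>
     subspace D \<and> closure D = H \<and> S ` D \<subseteq> H \<and> linear_op_on D S \<and>
     (\<forall>u\<in>D. \<forall>v\<in>D. inner (S u) v = inner u (S v)) \<and>
     (\<forall>v\<in>H. \<forall>w\<in>H. (\<forall>u\<in>D. inner (S u) v = inner u w) \<longrightarrow> v \<in> D)"

definition positive_definite_on :: "'h::real_inner set \<Rightarrow> ('h \<Rightarrow> 'h) \<Rightarrow> bool" where
  "positive_definite_on D S \<longleftrightarrow> (\<forall>u\<in>D. u \<noteq> 0 \<longrightarrow> 0 < inner (S u) u)"

definition has_compact_inverse :: "'h::real_inner set \<Rightarrow> 'h set \<Rightarrow> ('h \<Rightarrow> 'h) \<Rightarrow> bool" where
  "has_compact_inverse H D S \<longleftrightarrow>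
     bij_betw S D H \<and> compact (closure (inv_into D S ` (H \<inter> cball 0 1)))"

definition eigensystem ::
    "'h::real_inner set \<Rightarrow> 'h set \<Rightarrow> ('h \<Rightarrow> 'h) \<Rightarrow> (nat \<Rightarrow> real) \<Rightarrow> (nat \<Rightarrow> 'h) \<Rightarrow> bool" where
  "eigensystem H D S lam \<phi> \<longleftrightarrow>
     (\<forall>j. \<phi> j \<in> D \<and> S (\<phi> j) = lam j *\<^sub>R \<phi> j) \<and>
     (\<forall>i j. inner (\<phi> i) (\<phi> j) = (if i = j then 1 else 0)) \<and>
     closure (span (range \<phi>)) = H"

definition frac_power :: "(nat \<Rightarrow> real) \<Rightarrow> (nat \<Rightarrow> 'h::real_inner) \<Rightarrow> real \<Rightarrow> 'h \<Rightarrow> 'h" where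
  "frac_power lam \<phi> \<nu> v = (\<Sum>j. (lam j powr \<nu> * inner v (\<phi> j)) *\<^sub>R \<phi> j)"

text \<open>
  For an orthonormal system, convergence of the series in \<open>H\<close> is finiteness of its norm.
\<close>

definition frac_domain ::
    "'h::real_inner set \<Rightarrow> (nat \<Rightarrow> real) \<Rightarrow> (nat \<Rightarrow> 'h) \<Rightarrow> real \<Rightarrow> 'h set" where
  "frac_domain H lam \<phi> \<nu> = {v \<in> H. summable (\<lambda>j. (lam j powr \<nu> * inner v (\<phi> j)) *\<^sub>R \<phi> j)}"

definition orth_proj :: "'h::real_inner set \<Rightarrow> 'h \<Rightarrow> 'h" where
  "orth_proj V g = (THE p. p \<in> V \<and> (\<forall>v\<in>V. inner (g - p) v = 0))"


section \<open>Solution operators\<close>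

text \<open>
  The complexification of \<open>H\<close> is \<open>H \<times> H\<close>, with \<open>(x, y)\<close> standing for $x + iy$. Real
  operators act on it componentwise.
\<close>

definition cscale :: "complex \<Rightarrow> 'h::real_vector \<times> 'h \<Rightarrow> 'h \<times> 'h" where
  "cscale c v = (Re c *\<^sub>R fst v - Im c *\<^sub>R snd v, Re c *\<^sub>R snd v + Im c *\<^sub>R fst v)"

text \<open>$K(z) = (z^{-\alpha} I + S)^{-1} S$ on the complexification; \<open>powr\<close> is the principal branch.\<close>

definition K_op ::
    "'h::real_vector set \<Rightarrow> ('h \<Rightarrow> 'h) \<Rightarrow> real \<Rightarrow> complex \<Rightarrow> 'h \<times> 'h \<Rightarrow> 'h \<times> 'h" where
  "K_op H S \<alpha> z v =
     inv_into (H \<times> H) (\<lambda>w. cscale (z powr (- of_real \<alpha>)) w + map_prod S S w) (map_prod S S v)"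

text \<open>
  $\int_{\Gamma_{\theta,\delta}} F(z)\,dz$, with the parametrizations $z = \delta e^{i\psi}$ of the arc
  and $z = \rho e^{\pm i\theta}$ of the two rays; the lower ray is run through from infinity.
\<close>

definition Gamma_integral ::
    "real \<Rightarrow> real \<Rightarrow> (complex \<Rightarrow> 'h::real_normed_vector \<times> 'h) \<Rightarrow> 'h \<times> 'h" where
  "Gamma_integral \<theta> \<delta> F =
     - integral {\<delta>..} (\<lambda>\<rho>. cscale (cis (-\<theta>)) (F (of_real \<rho> * cis (-\<theta>))))
     + integral {-\<theta>..\<theta>} (\<lambda>\<psi>. cscale (\<i> * of_real \<delta> * cis \<psi>) (F (of_real \<delta> * cis \<psi>)))
     + integral {\<delta>..} (\<lambda>\<rho>. cscale (cis \<theta>) (F (of_real \<rho> * cis \<theta>)))"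

definition E_op ::
    "'h::real_normed_vector set \<Rightarrow> ('h \<Rightarrow> 'h) \<Rightarrow> real \<Rightarrow> real \<Rightarrow> real \<Rightarrow> real \<Rightarrow> 'h \<times> 'h \<Rightarrow> 'h \<times> 'h" where
  "E_op H S \<alpha> \<theta> \<delta> t v = cscale (1 / (2 * of_real pi * \<i>))
     (Gamma_integral \<theta> \<delta> (\<lambda>z. cscale (exp (z * of_real t) * inverse z) (K_op H S \<alpha> z v)))"

definition E_bar_op ::
    "'h::real_normed_vector set \<Rightarrow> ('h \<Rightarrow> 'h) \<Rightarrow> real \<Rightarrow> real \<Rightarrow> real \<Rightarrow> real \<Rightarrow> 'h \<times> 'h \<Rightarrow> 'h \<times> 'h" where
  "E_bar_op H S \<alpha> \<theta> \<delta> t v = cscale (1 / (2 * of_real pi * \<i>))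
     (Gamma_integral \<theta> \<delta> (\<lambda>z. cscale (exp (z * of_real t) * z powr (- of_real \<alpha>)) (K_op H S \<alpha> z v)))"

text \<open>
  A solution is a continuous curve in \<open>H\<close>; the equation is stated in the complexification, so it
  also says that the right-hand side is real. \<open>F s v\<close> is the nonlinearity at time \<open>s\<close> applied
  to \<open>v\<close>.
\<close>

definition is_solution ::
    "'h::real_normed_vector set \<Rightarrow> ('h \<Rightarrow> 'h) \<Rightarrow> real \<Rightarrow> real \<Rightarrow> real \<Rightarrow> (real \<Rightarrow> 'h \<Rightarrow> 'h) \<Rightarrow>
     real \<Rightarrow> 'h \<Rightarrow> (real \<Rightarrow> 'h) \<Rightarrow> bool" where
  "is_solution H S \<alpha> \<theta> \<delta> F T0 v u \<longleftrightarrow>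
     continuous_on {0..T0} u \<and> u ` {0..T0} \<subseteq> H \<and>
     (\<forall>t\<in>{0<..T0}. (u t, 0) =
        E_op H S \<alpha> \<theta> \<delta> t (v, 0) + integral {0..t} (\<lambda>s. E_bar_op H S \<alpha> \<theta> \<delta> (t - s) (F s (u s), 0)))"


section \<open>Nonlinearity and approximation\<close>

definition admissible_nonlinearity ::
    "(real^'n) set \<Rightarrow> real \<Rightarrow> real \<Rightarrow> (real^'n \<Rightarrow> real \<Rightarrow> real \<Rightarrow> real) \<Rightarrow> bool" where
  "admissible_nonlinearity \<Omega> T0 L f \<longleftrightarrow>
     smooth_near (closure \<Omega> \<times> {0..T0} \<times> UNIV) (\<lambda>(x, t, u). f x t u) \<and>
     (\<forall>x\<in>\<Omega>. \<forall>t\<in>{0<..<T0}. \<forall>u. \<bar>deriv (\<lambda>s. f x s u) t\<bar> + \<bar>deriv (f x t) u\<bar> \<le> L)"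

definition superpose ::
    "(real^'n) set \<Rightarrow> (real^'n \<Rightarrow> real \<Rightarrow> real \<Rightarrow> real) \<Rightarrow> real \<Rightarrow> (real^'n) L2 \<Rightarrow> (real^'n) L2" where
  "superpose \<Omega> f s v = to_L2 \<Omega> (\<lambda>x. f x s (rep_L2 v x))"

definition f0_norm :: "(real^'n) set \<Rightarrow> real \<Rightarrow> (real^'n \<Rightarrow> real \<Rightarrow> real \<Rightarrow> real) \<Rightarrow> real" where
  "f0_norm \<Omega> T0 f = (SUP t\<in>{0..T0}. norm (to_L2 \<Omega> (\<lambda>x. f x t 0)))"

definition approximation_family ::
    "'h::real_inner set \<Rightarrow> ('h \<Rightarrow> 'h) \<Rightarrow> real \<Rightarrow> real \<Rightarrow> (real \<Rightarrow> 'h set) \<Rightarrow> (real \<Rightarrow> 'h \<Rightarrow> 'h) \<Rightarrow> bool" where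
  "approximation_family H T \<gamma> C V T\<^sub>h \<longleftrightarrow> (\<forall>h\<in>{0<..<1}.
     V h \<subseteq> H \<and> (\<exists>B. finite B \<and> V h = span B) \<and>
     T\<^sub>h h ` H \<subseteq> V h \<and> linear_op_on H (T\<^sub>h h) \<and>
     (\<forall>u\<in>H. \<forall>v\<in>H. inner (T\<^sub>h h u) v = inner u (T\<^sub>h h v)) \<and>
     (\<forall>u\<in>H. 0 \<le> inner (T\<^sub>h h u) u) \<and>
     positive_definite_on (V h) (T\<^sub>h h) \<and>
     (\<forall>g\<in>H. T\<^sub>h h (orth_proj (V h) g) = T\<^sub>h h g) \<and>
     (\<forall>g\<in>H. norm (T\<^sub>h h g - T g) \<le> C * h powr \<gamma> * norm g))"

text \<open>
  As $|\ln h| \to 0$ for $h \to 1$ while the error does not, a bound with this factor for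
  \<open>\<nu> = 0\<close> can only be uniform over \<open>0 < h \<le> h\<^sub>0\<close> with a fixed \<open>h\<^sub>0 < 1\<close>.
\<close>

definition ell :: "real \<Rightarrow> real \<Rightarrow> real" where
  "ell h \<nu> = (if \<nu> = 0 then \<bar>ln h\<bar> else 1)"

end

theory Submission
  imports Defs "HOL-Complex_Analysis.Cauchy_Integral_Theorem" "HOL-Real_Asymp.Real_Asymp"
begin

text \<open>
  Put $\zeta = z^{-\alpha}$ and $R(z) = (\zeta + T)^{-1}$, so that $K(z) = I - \zeta R(z)$ and
  $K_h(z) - K(z) = \zeta R_h(z) (T_h - T) R(z)$. Since $|\arg \zeta| \le \alpha\pi < \pi$,
  all resolvents are bounded by $c |\zeta|^{-1}$, uniformly in $h$. Moving the contour to radius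
  $1/t$ turns such bounds into powers of $t$: $E_h(t) P_h u_0 - E(t) u_0$ is bounded by
  $c h^\gamma t^{-\alpha(1-\nu)}$ and $\bar E_h(t) - \bar E(t)$ by $c h^\gamma t^{-1}$, and the time integral
  of the latter by $c h^\gamma$. In the Volterra equation for the error, the consistency term
  $\int_0^t (\bar E_h - \bar E)(t-s) f(u(s)) ds$ is therefore of order $h^\gamma$ if $\nu > 0$, because $u$
  is Hoelder continuous with exponent $\alpha\nu$ and $f(u(t))$ can be subtracted from the integrand,
  and of order $h^\gamma |\ln h|$ in general. A Gronwall inequality with weakly singular kernel
  concludes.
\<close>

text \<open>All constants must be fixed before \<open>h\<close>, so no bound may use the norm of
  \<open>T\<^sub>h\<close>: the resolvent bounds come from coercivity, with constants depending on
  \<alpha> alone. The integrals in the definitions are gauge integrals with values in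
  \<open>H \<times> H\<close>, and \<open>integral\<close> has a default value without
  integrability; hence the domination criteria below and the completeness of \<open>L2\<close> on
  which they rest. The complex structure of \<open>H \<times> H\<close> exists only through
  \<open>cscale\<close>, so Cauchy's theorem is applied to the scalar functions obtained from
  complex functionals. The projected initial value disappears: the solution operator sees its
  argument only after \<open>T\<^sub>h\<close> has been applied, and \<open>T\<^sub>h\<close>
  absorbs the projection, so both equations may start from \<open>u\<^sub>0\<close>. Smoothness of
  the data enters as \<open>|R(z) u\<^sub>0| \<le> M |z|^(\<alpha> (1 - \<nu>))\<close>, known for
  the exact resolvent only; this is why \<open>R\<close> stands on the right in the formula for the
  kernel difference. For \<nu> = 0 the logarithm first appears as that of
  \<open>C h^\<gamma>\<close>, and \<open>h \<le> h\<^sub>0 < 1\<close> turns it into a multiple of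
  \<open>|ln h|\<close>.\<close>

hide_const (open) Polynomial.content

section \<open>Gauge integrals of dominated Banach-valued functions\<close>

lemma norm_diff_triangle3:
  fixes x :: "'a::real_normed_vector"
  shows "norm (x - y) \<le> norm (x - x') + norm (x' - y') + norm (y - y')"
  using norm_triangle_ineq[of "x - x'" "x' - y"] norm_triangle_ineq[of "x' - y'" "y' - y"]
  by (simp add: norm_minus_commute)

text \<open>Riemann sums of \<open>f\<close> and \<open>f1\<close> over a fine tagged division
  differ by at most the Riemann sum of \<open>g\<close>, which is close to its small integral. Only
  norms and the Cauchy criterion are used, so no measurability of \<open>f\<close> has to be
  discussed.\<close>

lemma integrable_on_cbox_approx:
  fixes f :: "'n::euclidean_space \<Rightarrow> 'a::banach"
  assumes "\<And>e. e > 0 \<Longrightarrow> \<exists>f1 g. f1 integrable_on cbox a b \<and> g integrable_on cbox a b \<and>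
    (\<forall>x\<in>cbox a b. norm (f x - f1 x) \<le> g x) \<and> integral (cbox a b) g < e"
  shows "f integrable_on cbox a b"
  unfolding integrable_Cauchy
proof (intro allI impI)
  fix e :: real assume "e > 0"
  then have e5: "e / 5 > 0" by simp
  obtain f1 g where f1: "f1 integrable_on cbox a b" and g: "g integrable_on cbox a b"
    and le: "\<And>x. x \<in> cbox a b \<Longrightarrow> norm (f x - f1 x) \<le> g x" and ig: "integral (cbox a b) g < e / 5"
    using assms[OF e5] by blast
  obtain d1 where D1: "gauge d1 \<and> (\<forall>p q. p tagged_division_of cbox a b \<and> d1 fine p \<and>
      q tagged_division_of cbox a b \<and> d1 fine q \<longrightarrow>
      norm ((\<Sum>(x,K)\<in>p. content K *\<^sub>R f1 x) - (\<Sum>(x,K)\<in>q. content K *\<^sub>R f1 x)) < e / 5)"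
    using f1[unfolded integrable_Cauchy, rule_format, OF e5] by (rule exE)
  note d1 = D1[THEN conjunct1] and d1' = D1[THEN conjunct2, rule_format, OF conjI, OF _ conjI, OF _ _ conjI]
  obtain d2 where D2: "gauge d2 \<and> (\<forall>p. p tagged_division_of cbox a b \<and> d2 fine p \<longrightarrow>
      norm ((\<Sum>(x,K)\<in>p. content K *\<^sub>R g x) - integral (cbox a b) g) < e / 5)"
    using integrable_integral[OF g, unfolded has_integral, rule_format, OF e5] by (rule exE)
  note d2 = D2[THEN conjunct1] and d2' = D2[THEN conjunct2, rule_format, OF conjI]
  \<comment> \<open>This error occurs twice in the final estimate; with the Cauchy bound for
    \<open>f1\<close> it adds up to \<open>5 * (e / 5)\<close>.\<close>
  have err: "norm ((\<Sum>(x,K)\<in>p. content K *\<^sub>R f x) - (\<Sum>(x,K)\<in>p. content K *\<^sub>R f1 x)) < 2 * (e / 5)"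
    if p: "p tagged_division_of cbox a b" and "d2 fine p" for p
  proof -
    have "(\<Sum>(x,K)\<in>p. content K *\<^sub>R f x) - (\<Sum>(x,K)\<in>p. content K *\<^sub>R f1 x)
        = (\<Sum>(x,K)\<in>p. content K *\<^sub>R (f x - f1 x))"
      by (simp add: sum_subtractf scaleR_diff_right case_prod_unfold)
    also have "norm \<dots> \<le> (\<Sum>(x,K)\<in>p. content K *\<^sub>R g x)"
    proof (rule sum_norm_le)
      fix y assume y: "y \<in> p"
      obtain x K where xK: "y = (x, K)" by (cases y)
      have "x \<in> cbox a b"
        using tagged_division_ofD(2,3)[OF p y[unfolded xK]] by auto
      from mult_left_mono[OF le[OF this] content_pos_le[of K]]
      show "norm (case y of (x, K) \<Rightarrow> content K *\<^sub>R (f x - f1 x)) \<le> (case y of (x, K) \<Rightarrow> content K *\<^sub>R g x)"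
        by (simp add: xK)
    qed
    also have "\<dots> < 2 * (e / 5)" using d2'[OF that] ig by (simp only: real_norm_def)
    finally show ?thesis .
  qed
  show "\<exists>d. gauge d \<and> (\<forall>p q. p tagged_division_of cbox a b \<and> d fine p \<and>
      q tagged_division_of cbox a b \<and> d fine q \<longrightarrow>
      norm ((\<Sum>(x,K)\<in>p. content K *\<^sub>R f x) - (\<Sum>(x,K)\<in>q. content K *\<^sub>R f x)) < e)"
  proof (intro exI conjI allI impI)
    show "gauge (\<lambda>x. d1 x \<inter> d2 x)" using d1 d2 by (rule gauge_Int)
    fix p q assume pq: "p tagged_division_of cbox a b \<and> (\<lambda>x. d1 x \<inter> d2 x) fine p \<and>
      q tagged_division_of cbox a b \<and> (\<lambda>x. d1 x \<inter> d2 x) fine q"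
    then have fin: "d1 fine p" "d2 fine p" "d1 fine q" "d2 fine q" by (auto simp: fine_Int)
    note b = err[of p] err[of q] d1'[of p q]
    let ?F = "\<lambda>p. (\<Sum>(x,K)\<in>p. content K *\<^sub>R f x)" and ?G = "\<lambda>p. (\<Sum>(x,K)\<in>p. content K *\<^sub>R f1 x)"
    have "norm (?F p - ?F q) \<le> norm (?F p - ?G p) + norm (?G p - ?G q) + norm (?F q - ?G q)"
      by (rule norm_diff_triangle3)
    also have "\<dots> < e" using b pq fin by linarith
    finally show "norm (?F p - ?F q) < e" .
  qed
qed

text \<open>The majorant \<open>g\<close> is nonnegative on \<open>S\<close>, so its integral over
  any box is at most the one over \<open>S\<close>. The error between \<open>f\<close> and
  \<open>f1\<close> is therefore uniform in the box, and the Cauchy condition at infinity passes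
  from \<open>f1\<close> to \<open>f\<close>.\<close>

lemma integrable_on_approx:
  fixes f :: "'n::euclidean_space \<Rightarrow> 'a::banach"
  assumes "\<And>e. e > 0 \<Longrightarrow> \<exists>f1 g. f1 integrable_on S \<and> g integrable_on S \<and>
    (\<forall>x\<in>S. norm (f x - f1 x) \<le> g x) \<and> integral S g < e"
  shows "f integrable_on S"
  unfolding integrable_alt[of f S]
proof (intro conjI allI impI)
  let ?ex = "\<lambda>f x. if x \<in> S then f x else 0"
  have nn: "0 \<le> ?ex g x" if "\<forall>x\<in>S. norm (f x - f1 x) \<le> g x" for f1 g x
  proof (cases "x \<in> S")
    case True
    have "0 \<le> norm (f x - f1 x)" by simp
    also have "\<dots> \<le> g x" using that True by blast
    finally show ?thesis using True by simp
  qed simp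
  have sub: "integral (cbox a b) (?ex g) \<le> integral S g"
    if "g integrable_on S" "\<forall>x\<in>S. norm (f x - f1 x) \<le> g x" for f1 g a b
  proof -
    have gi: "?ex g integrable_on cbox a b" using that(1)[unfolded integrable_alt[of g S]] by blast
    have gu: "?ex g integrable_on UNIV" using that(1) by (simp add: integrable_restrict_UNIV)
    have "integral (cbox a b) (?ex g) \<le> integral UNIV (?ex g)"
      using gi gu nn[OF that(2)] by (intro integral_subset_le) auto
    then show ?thesis by (simp add: integral_restrict_UNIV)
  qed
  have box: "?ex f integrable_on cbox a b" for a b
  proof (rule integrable_on_cbox_approx)
    fix e :: real assume "e > 0"
    obtain f1 g where *: "f1 integrable_on S" "g integrable_on S"
       "\<forall>x\<in>S. norm (f x - f1 x) \<le> g x" "integral S g < e"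
      using assms[OF \<open>e > 0\<close>] by blast
    show "\<exists>f1 g. f1 integrable_on cbox a b \<and> g integrable_on cbox a b \<and>
      (\<forall>x\<in>cbox a b. norm (?ex f x - f1 x) \<le> g x) \<and> integral (cbox a b) g < e"
    proof (intro exI[of _ "?ex f1"] exI[of _ "?ex g"] conjI)
      show "?ex f1 integrable_on cbox a b" using *(1)[unfolded integrable_alt[of f1 S]] by blast
      show "?ex g integrable_on cbox a b" using *(2)[unfolded integrable_alt[of g S]] by blast
      show "integral (cbox a b) (?ex g) < e" using sub[OF *(2,3)] *(4) by (rule le_less_trans)
    qed (use *(3) in auto)
  qed
  show "?ex f integrable_on cbox a b" for a b by (rule box)
  fix e :: real assume "e > 0"
  then have e3: "e / 3 > 0" by simp
  obtain f1 g where *: "f1 integrable_on S" "g integrable_on S"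
       "\<forall>x\<in>S. norm (f x - f1 x) \<le> g x" "integral S g < e / 3"
    using assms[OF e3] by blast
  have f1b: "?ex f1 integrable_on cbox a b" for a b using *(1)[unfolded integrable_alt[of f1 S]] by blast
  have gb: "?ex g integrable_on cbox a b" for a b using *(2)[unfolded integrable_alt[of g S]] by blast
  obtain B where B: "B > 0" "\<And>a b c d. ball 0 B \<subseteq> cbox a b \<Longrightarrow> ball 0 B \<subseteq> cbox c d \<Longrightarrow>
      norm (integral (cbox a b) (?ex f1) - integral (cbox c d) (?ex f1)) < e / 3"
    using *(1)[unfolded integrable_alt[of f1 S], THEN conjunct2, rule_format, OF e3] by blast
  have err: "norm (integral (cbox a b) (?ex f) - integral (cbox a b) (?ex f1)) < e / 3" for a b
  proof -
    have "norm (integral (cbox a b) (?ex f) - integral (cbox a b) (?ex f1))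
        = norm (integral (cbox a b) (\<lambda>x. ?ex f x - ?ex f1 x))"
      by (simp add: integral_diff[OF box f1b])
    also have "\<dots> \<le> integral (cbox a b) (?ex g)"
      by (rule integral_norm_bound_integral[OF integrable_diff[OF box f1b] gb]) (use *(3) in auto)
    also have "\<dots> < e / 3" using sub[OF *(2,3)] *(4) by (rule le_less_trans)
    finally show ?thesis .
  qed
  show "\<exists>B>0. \<forall>a b c d. ball 0 B \<subseteq> cbox a b \<and> ball 0 B \<subseteq> cbox c d \<longrightarrow>
    norm (integral (cbox a b) (?ex f) - integral (cbox c d) (?ex f)) < e"
  proof (intro exI[of _ B] conjI allI impI B(1))
    fix a b c d :: 'n assume "ball 0 B \<subseteq> cbox a b \<and> ball 0 B \<subseteq> cbox c d"
    then have "norm (integral (cbox a b) (?ex f1) - integral (cbox c d) (?ex f1)) < e / 3"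
      using B(2) by blast
    then show "norm (integral (cbox a b) (?ex f) - integral (cbox c d) (?ex f)) < e"
      using err[of a b] err[of c d]
        norm_diff_triangle3[of "integral (cbox a b) (?ex f)" "integral (cbox c d) (?ex f)"
          "integral (cbox a b) (?ex f1)" "integral (cbox c d) (?ex f1)"] by linarith
  qed
qed

text \<open>Takes the place of dominated convergence: cut \<open>f\<close> off outside
  \<open>K n\<close>; the error is dominated by \<open>g\<close> off \<open>K n\<close>, whose
  integral tends to zero.\<close>

lemma integrable_on_exhaustion:
  fixes f :: "'n::euclidean_space \<Rightarrow> 'a::banach"
  assumes f: "\<And>n. f integrable_on K n" and K: "\<And>n::nat. K n \<subseteq> S"
    and g: "g integrable_on S" "\<And>n. g integrable_on K n" and le: "\<And>x. x \<in> S \<Longrightarrow> norm (f x) \<le> g x"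
    and lim: "(\<lambda>n. integral (K n) g) \<longlonglongrightarrow> integral S g"
  shows "f integrable_on S"
proof (rule integrable_on_approx)
  fix e :: real assume "e > 0"
  have "eventually (\<lambda>n. dist (integral (K n) g) (integral S g) < e) sequentially"
    using lim \<open>e > 0\<close> by (rule tendstoD)
  then obtain n where n: "dist (integral (K n) g) (integral S g) < e"
    using eventually_happens'[OF sequentially_bot] by blast
  let ?r = "\<lambda>h x. if x \<in> K n then h x else 0"
  have gr: "?r g integrable_on S"
    using g(2)[of n] K[of n] by (simp add: integrable_restrict_Int Int_absorb2)
  show "\<exists>f1 g. f1 integrable_on S \<and> g integrable_on S \<and>
    (\<forall>x\<in>S. norm (f x - f1 x) \<le> g x) \<and> integral S g < e"
  proof (intro exI[of _ "?r f"] exI[of _ "\<lambda>x. g x - ?r g x"] conjI ballI)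
    show "?r f integrable_on S"
      using f[of n] K[of n] by (simp add: integrable_restrict_Int Int_absorb2)
    show "(\<lambda>x. g x - ?r g x) integrable_on S" using g(1) gr by (rule integrable_diff)
    have "integral S (\<lambda>x. g x - ?r g x) = integral S g - integral (K n) g"
      using K[of n] by (simp add: integral_diff[OF g(1) gr] integral_restrict_Int Int_absorb2)
    then show "integral S (\<lambda>x. g x - ?r g x) < e" using n by (simp add: dist_real_def)
  qed (use le in auto)
qed

lemma ray_integral:
  fixes f :: "real \<Rightarrow> 'a::banach"
  assumes a: "a > 0" and c: "continuous_on {d..} f"
    and le: "\<And>x. x \<ge> d \<Longrightarrow> norm (f x) \<le> M * exp (- a * x)"
  shows "f integrable_on {d..}" and "norm (integral {d..} f) \<le> M * exp (- a * d) / a"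
proof -
  have hi: "((\<lambda>x. M * exp (- a * x)) has_integral M * (exp (- a * d) / a)) {d..}"
    using has_integral_mult_right[OF has_integral_exp_minus_to_infinity[OF a, of d], of M] .
  have FT: "((\<lambda>x. M * exp (- a * x)) has_integral (M * (exp (- a * d) / a) - M * (exp (- a * (d
      + real n)) / a)))
      {d..d + real n}" for n
  proof -
    have "((\<lambda>x. - (M * exp (- a * x) / a)) has_vector_derivative M * exp (- a * x)) (at x within {d..d
        + real n})" for x
      unfolding has_real_derivative_iff_has_vector_derivative[symmetric]
      using a by (auto intro!: derivative_eq_intros)
    from fundamental_theorem_of_calculus[of d "d + real n", OF _ this] show ?thesis by simp
  qed
  show i: "f integrable_on {d..}"
  proof (rule integrable_on_exhaustion[where K="\<lambda>n. {d..d + real n}"])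
    show "f integrable_on {d..d + real n}" for n
      by (rule integrable_continuous_real[OF continuous_on_subset[OF c]]) auto
    show "{d..d + real n} \<subseteq> {d..}" for n by auto
    show "(\<lambda>x. M * exp (- a * x)) integrable_on {d..}" using hi by blast
    show "(\<lambda>x. M * exp (- a * x)) integrable_on {d..d + real n}" for n using FT by blast
    have "(\<lambda>n. M * (exp (- a * d) / a) - M * (exp (- a * (d + real n)) / a)) \<longlonglongrightarrow> M * (exp (- a * d) / a) - M *
        (0 / a)"
    proof (intro tendsto_intros)
      have "(\<lambda>n. exp (- a * d) * exp (- a) ^ n) \<longlonglongrightarrow> exp (- a * d) * 0"
        using a by (intro tendsto_intros LIMSEQ_power_zero) auto
      moreover have "exp (- a * d) * exp (- a) ^ n = exp (- a * (d + real n))" for n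
        unfolding exp_of_nat_mult[symmetric] exp_add[symmetric] by (simp add: algebra_simps)
      ultimately show "(\<lambda>n. exp (- a * (d + real n))) \<longlonglongrightarrow> 0" by (simp only: mult_zero_right)
    qed (use a in auto)
    then show "(\<lambda>n. integral {d..d + real n} (\<lambda>x. M * exp (- a * x))) \<longlonglongrightarrow> integral {d..} (\<lambda>x. M * exp (- a * x))"
      using integral_unique[OF FT] integral_unique[OF hi] by simp
  qed (use le in auto)
  have "norm (integral {d..} f) \<le> integral {d..} (\<lambda>x. M * exp (- a * x))"
    using hi le by (intro integral_norm_bound_integral[OF i]) auto
  then show "norm (integral {d..} f) \<le> M * exp (- a * d) / a" using integral_unique[OF hi] by simp
qed

section \<open>Weakly singular kernels\<close>

text \<open>For \<open>a < 1\<close> the integrand is singular at \<open>s = t\<close>, but its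
  primitive is continuous up to there, so the fundamental theorem in its interior form applies even
  when \<open>d = t\<close>.\<close>

lemma has_integral_powr_diff:
  fixes t :: real
  assumes "a > 0" "c \<le> d" "d \<le> t"
  shows "((\<lambda>s. (t - s) powr (a - 1)) has_integral ((t - c) powr a - (t - d) powr a) / a) {c..d}"
proof -
  have "((\<lambda>s. (t - s) powr (a - 1)) has_integral (- ((t - d) powr a) / a) - (- ((t - c) powr a) / a)) {c..d}"
  proof (rule fundamental_theorem_of_calculus_interior[OF assms(2)])
    show "continuous_on {c..d} (\<lambda>s. - ((t - s) powr a) / a)"
      using assms by (intro continuous_intros continuous_on_powr') auto
    fix x assume "x \<in> {c<..<d}"
    then show "((\<lambda>s. - ((t - s) powr a) / a) has_vector_derivative (t - x) powr (a - 1)) (at x)"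
      unfolding has_real_derivative_iff_has_vector_derivative[symmetric]
      using assms by (auto intro!: derivative_eq_intros)
  qed
  then show ?thesis by (simp add: diff_divide_distrib)
qed

lemma convolution_integral:
  fixes f :: "real \<Rightarrow> 'a::banach"
  assumes a: "a > 0" and t: "0 \<le> t" and c: "continuous_on {0..<t} f"
    and le: "\<And>s. 0 \<le> s \<Longrightarrow> s < t \<Longrightarrow> norm (f s) \<le> M * (t - s) powr (a - 1)"
  shows "f integrable_on {0..t}" and "norm (integral {0..t} f) \<le> M * (t powr a / a)"
proof -
  \<comment> \<open>Nothing is assumed about \<open>f t\<close>. As \<open>0 powr x = 0\<close>, the
    majorant vanishes at \<open>s = t\<close>, so the value 0 is the one that keeps the domination
    valid on the closed interval.\<close>
  define f' where "f' s = (if s = t then 0 else f s)" for s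
  define g where "g s = M * (t - s) powr (a - 1)" for s
  have g: "(g has_integral M * (((t - c) powr a - (t - d) powr a) / a)) {c..d}" if "c \<le> d" "d \<le> t" for c d
    unfolding g_def using has_integral_powr_diff[OF a that] by (rule has_integral_mult_right)
  note g0 = g[OF t order_refl]
  have le': "norm (f' s) \<le> g s" if "s \<in> {0..t}" for s
    using le[of s] that by (auto simp: f'_def g_def)
  have i': "f' integrable_on {0..t}"
  proof (rule integrable_on_exhaustion[where K="\<lambda>n. {0..t - t / (real n + 2)}"])
    show K: "{0..t - t / (real n + 2)} \<subseteq> {0..t}" for n using t by auto
    have nn: "0 \<le> t - t / (real n + 2)" for n
      using t by (simp add: field_simps)
    show "f' integrable_on {0..t - t / (real n + 2)}" for n
    proof (cases "t = 0")
      case True then show ?thesis using integrable_on_refl[of f' 0] by simp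
    next
      case False
      then have "t / (real n + 2) > 0" using t by simp
      then have "f integrable_on {0..t - t / (real n + 2)}"
        by (intro integrable_continuous_real continuous_on_subset[OF c]) auto
      then show ?thesis
        by (rule integrable_spike_finite[of "{}", rotated 2]) (use \<open>t / (real n + 2) > 0\<close> in \<open>auto simp:
            f'_def\<close>)
    qed
    show "g integrable_on {0..t}" using g0 by blast
    have "t - t / (real n + 2) \<le> t" for n using t by simp
    note gn = g[OF nn this]
    show "g integrable_on {0..t - t / (real n + 2)}" for n using gn by blast
    have "(\<lambda>n. M * ((t powr a - (t / (real n + 2)) powr a) / a)) \<longlonglongrightarrow> M * ((t powr a - 0 powr a) / a)"
    proof (intro tendsto_intros tendsto_powr')
      show "(\<lambda>n. t / (real n + 2)) \<longlonglongrightarrow> 0" by real_asymp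
    qed (use a t in auto)
    then show "(\<lambda>n. integral {0..t - t / (real n + 2)} g) \<longlonglongrightarrow> integral {0..t} g"
      using integral_unique[OF gn] integral_unique[OF g0] a by simp
  qed (use le' in auto)
  show i: "f integrable_on {0..t}"
    by (rule integrable_spike_finite[of "{t}", OF _ _ i']) (auto simp: f'_def)
  have "integral {0..t} f = integral {0..t} f'"
    by (rule integral_spike[of "{t}"]) (auto simp: f'_def)
  moreover have "norm (integral {0..t} f') \<le> integral {0..t} g"
    using g0 le' by (intro integral_norm_bound_integral[OF i']) auto
  ultimately show "norm (integral {0..t} f) \<le> M * (t powr a / a)"
    using integral_unique[OF g0] a by simp
qed

text \<open>The substitution \<open>s = t x\<close> in the Beta integral. With
  \<open>b = 1 - \<beta>\<close> it evaluates the weakly singular kernel on the weight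
  \<open>s powr - \<beta>\<close>.\<close>

lemma has_integral_Beta_scaled:
  fixes t :: real
  assumes "a > 0" "b > 0" "t > 0"
  shows "((\<lambda>s. (t - s) powr (a - 1) * s powr (b - 1)) has_integral t powr (a + b - 1) * Beta b a) {0..t}"
proof -
  have "((\<lambda>s. (1 / t * s) powr (b - 1) * (1 - 1 / t * s) powr (a - 1)) has_integral (1 / \<bar>1 / t\<bar>) * Beta b a)
      ((\<lambda>s. s / (1 / t)) ` {0..1})"
    using has_integral_stretch_real[OF has_integral_Beta_real[OF assms(2,1)], of "1 / t"] assms by simp
  moreover have "(\<lambda>s. s / (1 / t)) ` {0..1} = {0..t}"
    using assms image_mult_atLeastAtMost[of t 0 1] by (simp add: mult.commute)
  ultimately have A: "((\<lambda>s. t powr (a + b - 2) * ((1 / t * s) powr (b - 1) * (1 - 1 / t * s) powr (a - 1)))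
      has_integral t powr (a + b - 2) * ((1 / \<bar>1 / t\<bar>) * Beta b a)) {0..t}"
    by (simp only: has_integral_mult_right)
  have B: "t powr (a + b - 2) * ((1 / \<bar>1 / t\<bar>) * Beta b a) = t powr (a + b - 1) * Beta b a"
    using assms powr_mult_base[of t "a + b - 2"] by (simp add: algebra_simps)
  have C: "t powr (a + b - 2) * ((1 / t * s) powr (b - 1) * (1 - 1 / t * s) powr (a - 1))
      = (t - s) powr (a - 1) * s powr (b - 1)" if s: "s \<in> {0..t}" for s
  proof -
    have "1 - 1 / t * s = (t - s) / t" using assms by (simp add: field_simps)
    moreover have "t powr (a + b - 2) = t powr (b - 1) * t powr (a - 1)"
      by (simp add: powr_add[symmetric] add.commute)
    ultimately show ?thesis using s assms by (simp add: powr_divide field_simps)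
  qed
  show ?thesis using has_integral_eq[OF C A] unfolding B .
qed

text \<open>Follows from \<open>x^\<eta> \<le> (1 + x)^\<eta> \<le> 1 + x \<le> e^x\<close>. It
  trades exponential decay for a negative power, at the price of a stronger singularity.\<close>

lemma exp_minus_le_powr:
  fixes x \<eta> :: real
  assumes "0 < x" "0 \<le> \<eta>" "\<eta> \<le> 1"
  shows "exp (- x) \<le> x powr (- \<eta>)"
proof -
  have "x powr \<eta> \<le> (1 + x) powr \<eta>" using assms by (intro powr_mono2) auto
  also have "\<dots> \<le> (1 + x) powr 1" using assms by (intro powr_mono) auto
  also have "\<dots> \<le> exp x" using assms exp_ge_add_one_self[of x] by simp
  finally show ?thesis using assms by (simp add: powr_minus exp_minus le_imp_inverse_le)
qed

text \<open>Making the constant a predicate fixes the order of quantifiers: \<open>c\<close> is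
  chosen from \<alpha>, \<beta>, \<open>T\<close> and \<open>b\<close>, before the function and the
  datum \<open>a\<close>. The theorem needs this to choose \<open>c\<close> before \<open>h\<close>
  and the solutions.\<close>

definition gronwall_constant :: "real \<Rightarrow> real \<Rightarrow> real \<Rightarrow> real \<Rightarrow> real \<Rightarrow> bool" where
  "gronwall_constant \<alpha> \<beta> T b c \<longleftrightarrow> c \<ge> 0 \<and> (\<forall>a \<phi>. 0 \<le> a \<longrightarrow> continuous_on {0..T} \<phi> \<longrightarrow> (\<forall>t\<in>{0..T}. 0 \<le> \<phi> t) \<longrightarrow>
    (\<forall>t\<in>{0<..T}. \<phi> t \<le> a * t powr (- \<beta>) + b * integral {0..t} (\<lambda>s. (t - s) powr (\<alpha> - 1) * \<phi> s)) \<longrightarrow>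
    (\<forall>t\<in>{0<..T}. \<phi> t \<le> c * a * t powr (- \<beta>)))"

text \<open>With the weight \<open>t^\<beta> e^(-\<omega> t)\<close> and \<omega> large, the
  Volterra term contributes at most half of the supremum of the weighted function and can be
  absorbed.\<close>

lemma singular_gronwall:
  fixes \<alpha> \<beta> T b :: real
  assumes \<alpha>: "0 < \<alpha>" "\<alpha> < 1" and \<beta>: "0 \<le> \<beta>" "\<beta> < 1" and T: "0 < T" and b: "0 \<le> b"
  shows "\<exists>c. gronwall_constant \<alpha> \<beta> T b c"
proof -
  \<comment> \<open>Half of the exponent \<alpha> is spent on a factor
    \<open>\<omega> powr - \<eta>\<close> that can be made small; the other half keeps the kernel
    integrable, since \<open>\<alpha> - 1 - \<eta> = \<eta> - 1\<close>.\<close>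
  define \<eta> where "\<eta> = \<alpha> / 2"
  have \<eta>: "0 < \<eta>" "\<eta> \<le> 1" using \<alpha> by (auto simp: \<eta>_def)
  define B where "B = Beta (1 - \<beta>) \<eta>"
  have bi: "((\<lambda>s. (t - s) powr (\<eta> - 1) * s powr (- \<beta>)) has_integral t powr (\<eta> - \<beta>) * B) {0..t}" if "t > 0" for t
    using has_integral_Beta_scaled[of \<eta> "1 - \<beta>" t] that \<eta> \<beta> by (simp add: B_def)
  have "0 \<le> 1 powr (\<eta> - \<beta>) * B"
    using bi[of 1] by (rule has_integral_nonneg) auto
  then have B: "B \<ge> 0" by simp
  \<comment> \<open>Chosen so that the absorbed factor becomes
    \<open>(Q - 1) / (2 Q) \<le> 1 / 2\<close>; the summand 1 keeps \<open>Q\<close> away from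
    zero.\<close>
  define Q where "Q = 2 * b * B * T powr \<eta> + 1"
  have Q: "Q \<ge> 1" using b B by (simp add: Q_def)
  define \<omega> where "\<omega> = Q powr (1 / \<eta>)"
  have \<omega>: "\<omega> > 0" using Q by (simp add: \<omega>_def)
  have \<omega>\<eta>: "\<omega> powr (- \<eta>) = 1 / Q"
    using Q \<eta> by (simp add: \<omega>_def powr_powr powr_minus divide_inverse)
  have half: "b * \<omega> powr (- \<eta>) * B * T powr \<eta> \<le> 1 / 2"
    unfolding \<omega>\<eta> using Q by (simp add: Q_def field_simps)
  show ?thesis
    unfolding gronwall_constant_def
  proof (intro exI[of _ "2 * exp (\<omega> * T)"] conjI allI impI ballI)
    fix a \<phi> t
    assume a: "(0::real) \<le> a" and c\<phi>: "continuous_on {0..T} \<phi>" and nn: "\<forall>t\<in>{0..T}. 0 \<le> \<phi> t"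
      and ineq: "\<forall>t\<in>{0<..T}. \<phi> t \<le> a * t powr (- \<beta>) + b * integral {0..t} (\<lambda>s. (t - s) powr (\<alpha> - 1) * \<phi> s)"
      and t: "t \<in> {0<..T}"
    obtain \<Phi> where \<Phi>: "\<And>s. s \<in> {0..T} \<Longrightarrow> \<phi> s \<le> \<Phi>"
      using continuous_attains_sup[OF compact_Icc _ c\<phi>] T by (metis atLeastAtMost_iff empty_iff less_imp_le
          order_refl)
    define \<psi> where "\<psi> t = t powr \<beta> * exp (- \<omega> * t) * \<phi> t" for t
    \<comment> \<open>Continuity of \<phi> keeps \<psi> bounded. That this supremum is finite is
      what permits to conclude \<open>M \<le> 2 a\<close> from
      \<open>M \<le> a + M / 2\<close>.\<close>
    define M where "M = (SUP t\<in>{0<..T}. \<psi> t)"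
    have "\<psi> s \<le> T powr \<beta> * 1 * \<Phi>" if "s \<in> {0<..T}" for s
      unfolding \<psi>_def using that \<beta> \<omega> \<Phi>[of s] nn by (intro mult_mono powr_mono2) auto
    then have bdd: "bdd_above (\<psi> ` {0<..T})" by (intro bdd_aboveI2)
    have \<psi>M: "\<psi> s \<le> M" if "s \<in> {0<..T}" for s
      unfolding M_def using that bdd by (intro cSUP_upper)
    have M0: "0 \<le> M"
      using \<psi>M[of T] nn T by (intro order_trans[OF _ \<psi>M[of T]]) (auto simp: \<psi>_def)
    have \<phi>M: "\<phi> s \<le> M * s powr (- \<beta>) * exp (\<omega> * s)" if "s \<in> {0<..T}" for s
      using \<psi>M[OF that] that by (simp add: \<psi>_def powr_minus exp_minus field_simps)
    have "\<psi> s \<le> a + M / 2" if s: "s \<in> {0<..T}" for s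
    proof -
      let ?k = "\<lambda>x. (s - x) powr (\<alpha> - 1) * \<phi> x"
      let ?m = "\<lambda>x. M * exp (\<omega> * s) * \<omega> powr (- \<eta>) * ((s - x) powr (\<eta> - 1) * x powr (- \<beta>))"
      have s0: "s > 0" "s \<le> T" using s by auto
      have mi: "(?m has_integral M * exp (\<omega> * s) * \<omega> powr (- \<eta>) * (s powr (\<eta> - \<beta>) * B)) {0..s}"
        by (rule has_integral_mult_right[OF bi[OF s0(1)]])
      have ki: "?k integrable_on {0..s}"
      proof (rule convolution_integral(1)[OF \<alpha>(1), where M=\<Phi>])
        show "continuous_on {0..<s} ?k"
          using s0 by (intro continuous_intros continuous_on_subset[OF c\<phi>]) auto
        fix x assume "0 \<le> x" "x < s"
        then show "norm (?k x) \<le> \<Phi> * (s - x) powr (\<alpha> - 1)"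
          using \<Phi>[of x] nn s0 by (auto simp: abs_mult mult.commute intro!: mult_left_mono)
      qed (use s0 in auto)
      \<comment> \<open>The open interval is essential: the bound of \<phi> by \<open>M\<close> is
        available for positive arguments only.\<close>
      have "integral {0<..<s} ?k \<le> integral {0<..<s} ?m"
      proof (rule integral_le)
        show "?k integrable_on {0<..<s}" "?m integrable_on {0<..<s}"
          using ki mi by (auto simp: integrable_on_Icc_iff_Ioo[symmetric])
        fix x assume x: "x \<in> {0<..<s}"
        have "?k x \<le> (s - x) powr (\<alpha> - 1) * (M * x powr (- \<beta>) * exp (\<omega> * x))"
          using \<phi>M[of x] x s0 by (intro mult_left_mono) auto
        also have "\<dots> = (s - x) powr (\<alpha> - 1) * M * x powr (- \<beta>) * (exp (\<omega> * s) * exp (- (\<omega> * (s - x))))"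
          by (simp add: exp_add[symmetric] algebra_simps)
        also have "\<dots> \<le> (s - x) powr (\<alpha> - 1) * M * x powr (- \<beta>) * (exp (\<omega> * s) * (\<omega> * (s - x)) powr (- \<eta>))"
          using x \<omega> \<eta> M0 by (intro mult_left_mono exp_minus_le_powr) auto
        also have "(\<omega> * (s - x)) powr (- \<eta>) = \<omega> powr (- \<eta>) * (s - x) powr (- \<eta>)"
          using x \<omega> by (simp add: powr_mult)
        also have "(s - x) powr (\<alpha> - 1) * M * x powr (- \<beta>) * (exp (\<omega> * s) * (\<omega> powr (- \<eta>) * (s - x) powr (- \<eta>)))
            = M * exp (\<omega> * s) * \<omega> powr (- \<eta>) * (((s - x) powr (\<alpha> - 1) * (s - x) powr (- \<eta>)) * x powr (- \<beta>))"
          by (simp add: mult_ac)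
        also have "(s - x) powr (\<alpha> - 1) * (s - x) powr (- \<eta>) = (s - x) powr (\<eta> - 1)"
          by (simp add: powr_add[symmetric] \<eta>_def)
        finally show "?k x \<le> ?m x" .
      qed
      then have "integral {0..s} ?k \<le> M * exp (\<omega> * s) * \<omega> powr (- \<eta>) * (s powr (\<eta> - \<beta>) * B)"
        by (simp only: integral_open_interval_real[symmetric] integral_unique[OF mi])
      then have "\<phi> s \<le> a * s powr (- \<beta>) + b * (M * exp (\<omega> * s) * \<omega> powr (- \<eta>) * (s powr (\<eta> - \<beta>) * B))"
        by (intro order_trans[OF ineq[rule_format, OF s]] add_left_mono mult_left_mono[OF _ b])
      then have "\<psi> s \<le> s powr \<beta> * exp (- \<omega> * s) *
          (a * s powr (- \<beta>) + b * (M * exp (\<omega> * s) * \<omega> powr (- \<eta>) * (s powr (\<eta> - \<beta>) * B)))"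
        unfolding \<psi>_def by (intro mult_left_mono) auto
      also have "\<dots> = a * exp (- \<omega> * s) + M * (b * \<omega> powr (- \<eta>) * B * s powr \<eta>)"
        using s0 by (simp add: powr_diff powr_minus exp_minus field_simps)
      also have "\<dots> \<le> a * 1 + M * (b * \<omega> powr (- \<eta>) * B * T powr \<eta>)"
        using s0 \<omega> a M0 b B \<eta> by (intro add_mono mult_left_mono powr_mono2 mult_nonneg_nonneg) auto
      also have "\<dots> \<le> a + M * (1 / 2)" using half M0 by (intro add_mono mult_left_mono) auto
      finally show ?thesis by simp
    qed
    then have "M \<le> a + M / 2" unfolding M_def using T by (intro cSUP_least) auto
    then have "M \<le> 2 * a" by simp
    have "\<phi> t \<le> M * t powr (- \<beta>) * exp (\<omega> * t)" using \<phi>M[OF t] .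
    also have "\<dots> \<le> 2 * a * t powr (- \<beta>) * exp (\<omega> * T)"
      using t \<omega> \<open>M \<le> 2 * a\<close> M0 a by (intro mult_mono) auto
    finally show "\<phi> t \<le> 2 * exp (\<omega> * T) * a * t powr (- \<beta>)" by (simp add: mult_ac)
  qed simp
qed

section \<open>Contour integrals of weakly holomorphic functions\<close>

lemma cscale_ii: "cscale \<i> v = (- snd v, fst v)"
  by (simp add: cscale_def)

lemma cscale_alt: "cscale c v = Re c *\<^sub>R v + Im c *\<^sub>R cscale \<i> v"
  by (simp add: cscale_def prod_eq_iff)

lemma cscale_cscale: "cscale a (cscale b v) = cscale (a * b) v"
  by (simp add: cscale_def prod_eq_iff algebra_simps)

lemma cscale_one [simp]: "cscale 1 v = v"
  by (simp add: cscale_def)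

lemma norm_cscale: "norm (cscale c v) = cmod c * norm (v :: 'h::real_inner \<times> 'h)"
proof -
  have "(norm (cscale c v))\<^sup>2 = (cmod c)\<^sup>2 * (norm v)\<^sup>2"
    by (simp add: cscale_def power2_norm_eq_inner inner_prod_def cmod_def inner_diff inner_add
      inner_commute[of "snd v" "fst v"] algebra_simps power2_eq_square[symmetric])
      (simp add: power2_eq_square algebra_simps)
  then show ?thesis
    by (metis norm_ge_zero power2_eq_imp_eq power_mult_distrib mult_nonneg_nonneg)
qed

lemma bounded_bilinear_cscale: "bounded_bilinear (cscale :: complex \<Rightarrow> 'h::real_inner \<times> 'h \<Rightarrow> _)"
proof
  show "\<exists>K. \<forall>a (b :: 'h \<times> 'h). norm (cscale a b) \<le> norm a * norm b * K"
    by (intro exI[of _ 1]) (simp add: norm_cscale)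
qed (auto simp: cscale_def prod_eq_iff algebra_simps)

interpretation cscale: bounded_bilinear "cscale :: complex \<Rightarrow> 'h::real_inner \<times> 'h \<Rightarrow> _"
  by (rule bounded_bilinear_cscale)

lemma cscale_of_real: "cscale (of_real c) v = c *\<^sub>R v"
  by (simp add: cscale_def prod_eq_iff)

text \<open>\<open>cfun w\<close> is the complex linear functional with real part \<open>\<lambda>v. v \<bullet> w\<close>.\<close>

definition cfun :: "'h::real_inner \<times> 'h \<Rightarrow> 'h \<times> 'h \<Rightarrow> complex" where
  "cfun w v = Complex (inner v w) (- inner (cscale \<i> v) w)"

lemma Re_cfun [simp]: "Re (cfun w v) = inner v w"
  by (simp add: cfun_def)

lemma cfun_cscale: "cfun w (cscale c v) = c * cfun w v"
proof -
  have "cscale \<i> (cscale \<i> v) = - v" by (simp add: cscale_ii prod_eq_iff)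
  then show ?thesis
    unfolding cscale_alt[of c v]
    by (simp add: cfun_def complex_eq_iff cscale.add_right cscale.scaleR_right inner_add_left algebra_simps)
qed

lemma bounded_linear_cfun: "bounded_linear (cfun w)"
proof (rule bounded_linear_intro)
  show "cfun w (x + y) = cfun w x + cfun w y" for x y
    by (simp add: cfun_def complex_eq_iff cscale.add_right inner_add_left)
  show "cfun w (r *\<^sub>R x) = r *\<^sub>R cfun w x" for r x
    by (simp add: cfun_def complex_eq_iff cscale.scaleR_right)
  show "norm (cfun w x) \<le> norm x * (2 * norm w)" for x
  proof -
    have "norm (cfun w x) \<le> \<bar>inner x w\<bar> + \<bar>inner (cscale \<i> x) w\<bar>"
      using cmod_le[of "cfun w x"] by (simp add: cfun_def)
    also have "\<dots> \<le> norm x * norm w + norm (cscale \<i> x) * norm w"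
      by (intro add_mono Cauchy_Schwarz_ineq2)
    finally show ?thesis by (simp add: norm_cscale mult_ac)
  qed
qed

text \<open>The domain of the principal branch of \<open>z powr - \<alpha>\<close>. It contains
  every contour with \<open>\<theta> < pi\<close>, for any radius of the arc, and is starlike, so
  holomorphic functions on it have primitives.\<close>

abbreviation slit :: "complex set" where "slit \<equiv> - \<real>\<^sub>\<le>\<^sub>0"

lemma open_slit: "open slit" by (simp add: open_Compl)

lemma starlike_slit: "starlike slit"
proof -
  have "slit = - (complex_of_real ` {..0})" by (simp add: complex_slot_left_eq complex_nonpos_Reals_iff
      set_eq_iff)
  then show ?thesis using starlike_slotted_complex_plane_left[of 0] by simp
qed

lemma polar_in_slit: "\<rho> > 0 \<Longrightarrow> \<bar>\<psi>\<bar> < pi \<Longrightarrow> of_real \<rho> * cis \<psi> \<in> slit"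
proof
  assume a: "\<rho> > 0" "\<bar>\<psi>\<bar> < pi" "of_real \<rho> * cis \<psi> \<in> \<real>\<^sub>\<le>\<^sub>0"
  then have "\<rho> * cos \<psi> \<le> 0" "\<rho> * sin \<psi> = 0" by (auto simp: complex_nonpos_Reals_iff)
  then have "cos \<psi> \<le> 0" "sin \<psi> = 0" using a by (auto simp: mult_le_0_iff)
  then have "\<psi> = 0" using a sin_eq_0_pi by (metis abs_less_iff minus_less_iff)
  then show False using \<open>cos \<psi> \<le> 0\<close> by simp
qed

text \<open>Norm continuity yields integrability along the contour, holomorphy of the scalar
  functions yields primitives. As \<open>cfun w\<close> has real part \<open>inner v w\<close>,
  testing with all \<open>w\<close> determines a vector-valued integral.\<close>

definition weakly_holomorphic :: "(complex \<Rightarrow> 'h::real_inner \<times> 'h) \<Rightarrow> bool" where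
  "weakly_holomorphic k \<longleftrightarrow> continuous_on slit k \<and> (\<forall>w. (\<lambda>z. cfun w (k z)) holomorphic_on slit)"

lemma weakly_holomorphic_cscale:
  assumes "f holomorphic_on slit" "weakly_holomorphic k"
  shows "weakly_holomorphic (\<lambda>z. cscale (f z) (k z))"
  using assms unfolding weakly_holomorphic_def cfun_cscale
  by (auto intro!: cscale.continuous_on holomorphic_on_mult holomorphic_on_imp_continuous_on)

lemma weakly_holomorphic_diff:
  assumes "weakly_holomorphic k" "weakly_holomorphic l"
  shows "weakly_holomorphic (\<lambda>z. k z - l z)"
  using assms unfolding weakly_holomorphic_def
  by (auto intro!: continuous_intros holomorphic_intros simp: linear_diff[OF bounded_linear.linear[OF
      bounded_linear_cfun]])

lemma weakly_holomorphic_const: "weakly_holomorphic (\<lambda>z. v)"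
  by (simp add: weakly_holomorphic_def)

text \<open>\<open>integral\<close> is total, so linearity of \<open>Gamma_integral\<close> requires
  that each of its three pieces exists.\<close>

definition Gamma_integrable :: "real \<Rightarrow> real \<Rightarrow> (complex \<Rightarrow> 'h::real_inner \<times> 'h) \<Rightarrow> bool" where
  "Gamma_integrable \<theta> \<delta> F \<longleftrightarrow>
     (\<lambda>\<rho>. cscale (cis (-\<theta>)) (F (of_real \<rho> * cis (-\<theta>)))) integrable_on {\<delta>..} \<and>
     (\<lambda>\<psi>. cscale (\<i> * of_real \<delta> * cis \<psi>) (F (of_real \<delta> * cis \<psi>))) integrable_on {-\<theta>..\<theta>} \<and>
     (\<lambda>\<rho>. cscale (cis \<theta>) (F (of_real \<rho> * cis \<theta>))) integrable_on {\<delta>..}"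

lemma Gamma_integral_diff:
  assumes "Gamma_integrable \<theta> \<delta> F" "Gamma_integrable \<theta> \<delta> G"
  shows "Gamma_integrable \<theta> \<delta> (\<lambda>z. F z - G z)"
    and "Gamma_integral \<theta> \<delta> (\<lambda>z. F z - G z) = Gamma_integral \<theta> \<delta> F - Gamma_integral \<theta> \<delta> G"
  using assms unfolding Gamma_integrable_def Gamma_integral_def
  by (auto simp: cscale.diff_right integral_diff intro!: integrable_diff)

lemma Gamma_integral_scaleR:
  assumes "Gamma_integrable \<theta> \<delta> F"
  shows "Gamma_integrable \<theta> \<delta> (\<lambda>z. c *\<^sub>R F z)"
    and "Gamma_integral \<theta> \<delta> (\<lambda>z. c *\<^sub>R F z) = c *\<^sub>R Gamma_integral \<theta> \<delta> F"
  using assms unfolding Gamma_integrable_def Gamma_integral_def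
  by (auto simp: cscale.scaleR_right algebra_simps intro!: integrable_cmul)

definition decaying :: "real \<Rightarrow> real \<Rightarrow> real \<Rightarrow> real \<Rightarrow> (complex \<Rightarrow> 'h::real_inner \<times> 'h) \<Rightarrow> bool" where
  "decaying \<theta> \<delta> a M F \<longleftrightarrow> (\<forall>\<rho>\<ge>\<delta>. norm (F (of_real \<rho> * cis \<theta>)) \<le> M * exp (- a * \<rho>) \<and>
     norm (F (of_real \<rho> * cis (-\<theta>))) \<le> M * exp (- a * \<rho>))"

lemma continuous_on_ray:
  fixes F :: "complex \<Rightarrow> 'h::real_inner \<times> 'h"
  assumes "continuous_on slit F" "\<bar>\<psi>\<bar> < pi" "0 < \<delta>" "S \<subseteq> {\<delta>..}"
  shows "continuous_on S (\<lambda>\<rho>. cscale (cis \<psi>) (F (of_real \<rho> * cis \<psi>)))"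
  by (intro cscale.continuous_on continuous_intros continuous_on_compose2[OF assms(1)])
     (use assms polar_in_slit in \<open>auto intro!: polar_in_slit\<close>)

lemma continuous_on_arc:
  fixes F :: "complex \<Rightarrow> 'h::real_inner \<times> 'h"
  assumes "continuous_on slit F" "\<theta> < pi" "0 < \<delta>"
  shows "continuous_on {-\<theta>..\<theta>} (\<lambda>\<psi>. cscale (\<i> * of_real \<delta> * cis \<psi>) (F (of_real \<delta> * cis \<psi>)))"
proof -
  have "of_real \<delta> * cis \<psi> \<in> slit" if "\<psi> \<in> {-\<theta>..\<theta>}" for \<psi>
    using that assms(2,3) by (intro polar_in_slit) auto
  then show ?thesis
    by (intro cscale.continuous_on continuous_intros continuous_on_compose2[OF assms(1)]) auto
qed

text \<open>Each ray contributes the integral of its exponential majorant, and the arc has length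
  \<open>2 \<theta> \<delta>\<close>.\<close>

lemma Gamma_integral_bound:
  fixes F :: "complex \<Rightarrow> 'h::{real_inner, banach} \<times> 'h"
  assumes F: "continuous_on slit F" and \<theta>: "0 < \<theta>" "\<theta> < pi" and \<delta>: "0 < \<delta>" and a: "a > 0"
    and d: "decaying \<theta> \<delta> a M F"
  shows "Gamma_integrable \<theta> \<delta> F"
    and "(\<And>\<psi>. \<bar>\<psi>\<bar> \<le> \<theta> \<Longrightarrow> norm (F (of_real \<delta> * cis \<psi>)) \<le> N) \<Longrightarrow>
      norm (Gamma_integral \<theta> \<delta> F) \<le> 2 * (M * exp (- a * \<delta>) / a) + 2 * \<theta> * (\<delta> * N)"
proof -
  let ?r = "\<lambda>\<psi> \<rho>. cscale (cis \<psi>) (F (of_real \<rho> * cis \<psi>))"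
  let ?a = "\<lambda>\<psi>. cscale (\<i> * of_real \<delta> * cis \<psi>) (F (of_real \<delta> * cis \<psi>))"
  have "continuous_on {\<delta>..} (?r \<psi>)" if "\<psi> = \<theta> \<or> \<psi> = - \<theta>" for \<psi>
    using that \<theta> by (intro continuous_on_ray[OF F _ \<delta>]) auto
  moreover have "norm (?r \<psi> \<rho>) \<le> M * exp (- a * \<rho>)" if "\<psi> = \<theta> \<or> \<psi> = - \<theta>" "\<rho> \<ge> \<delta>" for \<psi> \<rho>
    using d that unfolding decaying_def by (auto simp: norm_cscale)
  ultimately have r: "?r \<psi> integrable_on {\<delta>..}" "norm (integral {\<delta>..} (?r \<psi>)) \<le> M * exp (- a * \<delta>) / a"
    if "\<psi> = \<theta> \<or> \<psi> = - \<theta>" for \<psi> using ray_integral[OF a, of \<delta> "?r \<psi>" M] that by auto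
  have arc: "?a integrable_on {-\<theta>..\<theta>}"
    by (intro integrable_continuous_real continuous_on_arc F \<theta> \<delta>)
  show "Gamma_integrable \<theta> \<delta> F"
    using r(1)[of \<theta>] r(1)[of "- \<theta>"] arc by (simp add: Gamma_integrable_def)
  assume N: "\<And>\<psi>. \<bar>\<psi>\<bar> \<le> \<theta> \<Longrightarrow> norm (F (of_real \<delta> * cis \<psi>)) \<le> N"
  have "norm (integral {-\<theta>..\<theta>} ?a) \<le> (\<delta> * N) * (\<theta> - (- \<theta>))"
  proof (rule integral_bound)
    show "continuous_on {-\<theta>..\<theta>} ?a" by (intro continuous_on_arc F \<theta> \<delta>)
    fix \<psi> assume "\<psi> \<in> {-\<theta>..\<theta>}"
    then show "norm (?a \<psi>) \<le> \<delta> * N"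
      using N[of \<psi>] \<delta> by (auto simp: norm_cscale norm_mult intro!: mult_left_mono)
  qed (use \<theta> in auto)
  moreover have "norm (Gamma_integral \<theta> \<delta> F) \<le> norm (integral {\<delta>..} (?r (- \<theta>))) +
      norm (integral {-\<theta>..\<theta>} ?a) + norm (integral {\<delta>..} (?r \<theta>))"
    unfolding Gamma_integral_def
    using norm_triangle_ineq[of "- integral {\<delta>..} (?r (- \<theta>)) + integral {-\<theta>..\<theta>} ?a" "integral {\<delta>..} (?r \<theta>)"]
      norm_triangle_ineq[of "- integral {\<delta>..} (?r (- \<theta>))" "integral {-\<theta>..\<theta>} ?a"] by simp
  ultimately show "norm (Gamma_integral \<theta> \<delta> F) \<le> 2 * (M * exp (- a * \<delta>) / a) + 2 * \<theta> * (\<delta> * N)"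
    using r(2)[of \<theta>] r(2)[of "- \<theta>"] by (simp add: mult.commute[of "\<delta> * N"])
qed

lemma has_vector_derivative_cis: "(cis has_vector_derivative \<i> * cis \<psi>) (at \<psi> within S)"
proof -
  have "((\<lambda>x. exp (\<i> * of_real x)) has_vector_derivative \<i> * exp (\<i> * of_real \<psi>)) (at \<psi> within S)"
    by (rule has_vector_derivative_real_field) (auto intro!: derivative_eq_intros)
  then show ?thesis by (simp add: cis_conv_exp[abs_def])
qed

text \<open>A primitive of the integrand turns the contour integral into its boundary values at infinity,
  which do not depend on the radius of the arc.\<close>

lemma Gamma_integral_inner_limit:
  fixes F :: "complex \<Rightarrow> 'h::{real_inner, banach} \<times> 'h"
  assumes F: "continuous_on slit F" and \<theta>: "0 < \<theta>" "\<theta> < pi" and \<delta>: "0 < \<delta>" and a: "a > 0"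
    and d: "decaying \<theta> \<delta> a M F"
    and P: "\<And>z. z \<in> slit \<Longrightarrow> (P has_field_derivative cfun w (F z)) (at z)"
  shows "((\<lambda>R. Re (P (of_real R * cis \<theta>)) - Re (P (of_real R * cis (-\<theta>))))
    \<longlongrightarrow> inner (Gamma_integral \<theta> \<delta> F) w) at_top"
proof -
  let ?r = "\<lambda>\<psi> \<rho>. cscale (cis \<psi>) (F (of_real \<rho> * cis \<psi>))"
  let ?a = "\<lambda>\<psi>. cscale (\<i> * of_real \<delta> * cis \<psi>) (F (of_real \<delta> * cis \<psi>))"
  have bl: "bounded_linear (\<lambda>v :: 'h \<times> 'h. inner v w)" by (rule bounded_linear_inner_left)
  have ray: "((\<lambda>R. Re (P (of_real R * cis \<psi>)) - Re (P (of_real \<delta> * cis \<psi>)))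
      \<longlongrightarrow> inner (integral {\<delta>..} (?r \<psi>)) w) at_top" if \<psi>: "\<psi> = \<theta> \<or> \<psi> = - \<theta>" for \<psi>
  proof -
    have \<psi>': "\<bar>\<psi>\<bar> < pi" using \<psi> \<theta> by auto
    have le: "norm (?r \<psi> \<rho>) \<le> M * exp (- a * \<rho>)" if "\<rho> \<ge> \<delta>" for \<rho>
      using d that \<psi> unfolding decaying_def by (auto simp: norm_cscale)
    have ri: "?r \<psi> integrable_on {R..}" "norm (integral {R..} (?r \<psi>)) \<le> M * exp (- a * R) / a" if "R \<ge> \<delta>" for R
      using ray_integral[OF a continuous_on_ray[OF F \<psi>' \<delta>, of "{R..}"] le] that by auto
    have "eventually (\<lambda>R. inner (integral {\<delta>..} (?r \<psi>) - integral {R..} (?r \<psi>)) w =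
        Re (P (of_real R * cis \<psi>)) - Re (P (of_real \<delta> * cis \<psi>))) at_top"
      using eventually_ge_at_top[of \<delta>]
    proof eventually_elim
      case (elim R)
      have fi: "?r \<psi> integrable_on {\<delta>..R}"
        by (intro integrable_continuous_real continuous_on_ray[OF F \<psi>' \<delta>]) auto
      have "(?r \<psi> has_integral (integral {\<delta>..R} (?r \<psi>) + integral {R..} (?r \<psi>))) ({\<delta>..R} \<union> {R..})"
        using fi ri(1)[OF elim] elim
        by (intro has_integral_Un) (auto simp: has_integral_integral[symmetric] max_def intro:
            negligible_subset[of "{R}"])
      moreover have "{\<delta>..R} \<union> {R..} = {\<delta>..}" using elim by auto
      ultimately have "integral {\<delta>..} (?r \<psi>) - integral {R..} (?r \<psi>) = integral {\<delta>..R} (?r \<psi>)"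
        by (simp add: integral_unique)
      then have "inner (integral {\<delta>..} (?r \<psi>) - integral {R..} (?r \<psi>)) w
          = integral {\<delta>..R} (\<lambda>\<rho>. inner (?r \<psi> \<rho>) w)"
        using integral_linear[OF fi bl] by (simp add: o_def)
      also have "((\<lambda>\<rho>. inner (?r \<psi> \<rho>) w) has_integral
          Re (P (of_real R * cis \<psi>)) - Re (P (of_real \<delta> * cis \<psi>))) {\<delta>..R}"
      proof (rule fundamental_theorem_of_calculus[OF elim])
        fix \<rho> assume \<rho>: "\<rho> \<in> {\<delta>..R}"
        have "((P \<circ> (\<lambda>\<rho>. of_real \<rho> * cis \<psi>)) has_vector_derivative cis \<psi> * cfun w (F (of_real \<rho> * cis \<psi>)))
            (at \<rho>)"
        proof (rule field_vector_diff_chain_at)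
          show "((\<lambda>\<rho>. of_real \<rho> * cis \<psi>) has_vector_derivative cis \<psi>) (at \<rho>)"
            by (rule has_vector_derivative_real_field) (auto intro!: derivative_eq_intros)
          show "(P has_field_derivative cfun w (F (of_real \<rho> * cis \<psi>))) (at (of_real \<rho> * cis \<psi>))"
            using \<rho> \<delta> \<psi>' by (intro P polar_in_slit) auto
        qed
        from bounded_linear.has_vector_derivative[OF bounded_linear_Re this]
        show "((\<lambda>\<rho>. Re (P (of_real \<rho> * cis \<psi>))) has_vector_derivative inner (?r \<psi> \<rho>) w) (at \<rho> within {\<delta>..R})"
          using Re_cfun[of w "?r \<psi> \<rho>"] by (simp add: o_def cfun_cscale has_vector_derivative_at_within)
      qed
      then have "integral {\<delta>..R} (\<lambda>\<rho>. inner (?r \<psi> \<rho>) w) = Re (P (of_real R * cis \<psi>)) - Re (P (of_real \<delta> *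
          cis \<psi>))"
        by (rule integral_unique)
      finally show ?case .
    qed
    moreover have "((\<lambda>R. inner (integral {\<delta>..} (?r \<psi>) - integral {R..} (?r \<psi>)) w)
        \<longlongrightarrow> inner (integral {\<delta>..} (?r \<psi>) - 0) w) at_top"
    proof (intro tendsto_intros)
      show "((\<lambda>R. integral {R..} (?r \<psi>)) \<longlongrightarrow> 0) at_top"
      proof (rule Lim_null_comparison)
        show "eventually (\<lambda>R. norm (integral {R..} (?r \<psi>)) \<le> M * exp (- a * R) / a) at_top"
          using eventually_ge_at_top[of \<delta>] by eventually_elim (rule ri(2))
        show "((\<lambda>R. M * exp (- a * R) / a) \<longlongrightarrow> 0) at_top" using a by real_asymp
      qed
    qed
    ultimately show ?thesis using tendsto_cong by fastforce
  qed
  have arc: "inner (integral {-\<theta>..\<theta>} ?a) w = Re (P (of_real \<delta> * cis \<theta>)) - Re (P (of_real \<delta> * cis (-\<theta>)))"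
  proof -
    have "?a integrable_on {-\<theta>..\<theta>}"
      by (intro integrable_continuous_real continuous_on_arc F \<theta> \<delta>)
    then have "inner (integral {-\<theta>..\<theta>} ?a) w = integral {-\<theta>..\<theta>} (\<lambda>\<psi>. inner (?a \<psi>) w)"
      using integral_linear[OF _ bl, of ?a] by (simp add: o_def)
    also have "((\<lambda>\<psi>. inner (?a \<psi>) w) has_integral
        Re (P (of_real \<delta> * cis \<theta>)) - Re (P (of_real \<delta> * cis (-\<theta>)))) {-\<theta>..\<theta>}"
    proof (rule fundamental_theorem_of_calculus)
      fix \<psi> assume \<psi>: "\<psi> \<in> {-\<theta>..\<theta>}"
      have "((P \<circ> (\<lambda>\<psi>. of_real \<delta> * cis \<psi>)) has_vector_derivative
          (of_real \<delta> * (\<i> * cis \<psi>)) * cfun w (F (of_real \<delta> * cis \<psi>))) (at \<psi>)"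
      proof (rule field_vector_diff_chain_at)
        show "((\<lambda>\<psi>. of_real \<delta> * cis \<psi>) has_vector_derivative of_real \<delta> * (\<i> * cis \<psi>)) (at \<psi>)"
          by (rule has_vector_derivative_mult_right[OF has_vector_derivative_cis])
        show "(P has_field_derivative cfun w (F (of_real \<delta> * cis \<psi>))) (at (of_real \<delta> * cis \<psi>))"
          using \<psi> \<delta> \<theta> by (intro P polar_in_slit) auto
      qed
      from bounded_linear.has_vector_derivative[OF bounded_linear_Re this]
      show "((\<lambda>\<psi>. Re (P (of_real \<delta> * cis \<psi>))) has_vector_derivative inner (?a \<psi>) w) (at \<psi> within {-\<theta>..\<theta>})"
        using Re_cfun[of w "?a \<psi>"] by (simp add: o_def cfun_cscale has_vector_derivative_at_within mult_ac)
    qed (use \<theta> in auto)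
    then have "integral {-\<theta>..\<theta>} (\<lambda>\<psi>. inner (?a \<psi>) w) = Re (P (of_real \<delta> * cis \<theta>)) - Re (P (of_real \<delta> * cis
        (-\<theta>)))"
      by (rule integral_unique)
    finally show ?thesis .
  qed
  \<comment> \<open>Gluing the rays to the arc: the values of the primitive at radius \<delta>
    cancel.\<close>
  have "((\<lambda>R. (Re (P (of_real R * cis \<theta>)) - Re (P (of_real \<delta> * cis \<theta>)))
      - (Re (P (of_real R * cis (-\<theta>))) - Re (P (of_real \<delta> * cis (-\<theta>))))
      + (Re (P (of_real \<delta> * cis \<theta>)) - Re (P (of_real \<delta> * cis (-\<theta>)))))
      \<longlongrightarrow> inner (integral {\<delta>..} (?r \<theta>)) w - inner (integral {\<delta>..} (?r (-\<theta>))) w + inner (integral {-\<theta>..\<theta>} ?a)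
          w) at_top"
    unfolding arc by (intro tendsto_intros ray) auto
  then show ?thesis by (simp add: Gamma_integral_def inner_add_left inner_minus_left algebra_simps)
qed

text \<open>No closed contour is needed. With one primitive on the starlike set \<open>slit\<close>,
  both integrals tested with \<open>w\<close> are the limit of the same expression at infinity, and
  limits are unique.\<close>

lemma Gamma_integral_radius:
  fixes F :: "complex \<Rightarrow> 'h::{real_inner, banach} \<times> 'h"
  assumes F: "weakly_holomorphic F" and \<theta>: "0 < \<theta>" "\<theta> < pi" and \<delta>: "0 < \<delta>" "0 < \<delta>'"
    and d: "a > 0" "decaying \<theta> \<delta> a M F" "a' > 0" "decaying \<theta> \<delta>' a' M' F"
  shows "Gamma_integral \<theta> \<delta> F = Gamma_integral \<theta> \<delta>' F"
proof -
  have c: "continuous_on slit F" using F by (simp add: weakly_holomorphic_def)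
  have "inner (Gamma_integral \<theta> \<delta> F) w = inner (Gamma_integral \<theta> \<delta>' F) w" for w
  proof -
    have h: "(\<lambda>z. cfun w (F z)) holomorphic_on slit" using F unfolding weakly_holomorphic_def by blast
    obtain P where P: "\<And>z. z \<in> slit \<Longrightarrow> (P has_field_derivative cfun w (F z)) (at z)"
      using holomorphic_starlike_primitive[OF holomorphic_on_imp_continuous_on[OF h] starlike_slit
          open_slit, of "{}"]
        holomorphic_on_imp_differentiable_at[OF h open_slit] by auto
    show ?thesis
      using tendsto_unique[OF _ Gamma_integral_inner_limit[OF c \<theta> \<delta>(1) d(1,2) P]
          Gamma_integral_inner_limit[OF c \<theta> \<delta>(2) d(3,4) P]] by simp
  qed
  then show ?thesis using vector_eq_rdot by blast
qed

section \<open>Bounds and time derivatives of contour integrals\<close>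

text \<open>For \<open>0 \<le> u \<le> 1\<close> one has \<open>u \<le> u^q\<close>; apply this to
  the two fractions of \<open>x + y\<close>, which sum to 1.\<close>

lemma powr_subadditive:
  fixes x y q :: real
  assumes "0 \<le> x" "0 \<le> y" "0 < q" "q \<le> 1"
  shows "(x + y) powr q \<le> x powr q + y powr q"
proof (cases "x + y = 0")
  case False
  then have s: "x + y > 0" using assms by linarith
  have le: "u / (x + y) \<le> u powr q / (x + y) powr q" if "0 \<le> u" "u \<le> x + y" for u
  proof (cases "u = 0")
    case False
    then have "(u / (x + y)) powr 1 \<le> (u / (x + y)) powr q"
      using that s assms by (intro powr_mono') auto
    then show ?thesis using that s by (simp add: powr_divide)
  qed simp
  have "1 = x / (x + y) + y / (x + y)" using s by (simp add: add_divide_distrib[symmetric])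
  also have "\<dots> \<le> (x powr q + y powr q) / (x + y) powr q"
    using le[of x] le[of y] assms by (simp add: add_divide_distrib)
  finally show ?thesis using s by (simp add: field_simps)
qed (use assms in simp)

lemma powr_diff_le:
  fixes s t q :: real
  assumes "0 \<le> s" "s \<le> t" "0 < q" "q \<le> 1"
  shows "t powr q - s powr q \<le> (t - s) powr q"
  using powr_subadditive[of s "t - s" q] assms by simp

text \<open>The mean value inequality with the majorant \<open>C \<tau>^q / q\<close>. Both signs of
  \<open>q\<close> occur: negative for the increments of the kernel of the time convolution,
  positive for those of the homogeneous solution.\<close>

lemma norm_increment_powr:
  fixes f :: "real \<Rightarrow> 'a::real_normed_vector"
  assumes st: "0 < s" "s \<le> t" and q: "q \<noteq> 0"
    and f: "\<And>\<tau>. s \<le> \<tau> \<Longrightarrow> \<tau> \<le> t \<Longrightarrow> (f has_vector_derivative f' \<tau>) (at \<tau>)"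
    and le: "\<And>\<tau>. s \<le> \<tau> \<Longrightarrow> \<tau> \<le> t \<Longrightarrow> norm (f' \<tau>) \<le> C * \<tau> powr (q - 1)"
  shows "norm (f t - f s) \<le> C * ((t powr q - s powr q) / q)"
proof (cases "s = t")
  case False
  then have "s < t" using st by simp
  have d: "((\<lambda>\<tau>. C * (\<tau> powr q / q)) has_vector_derivative C * \<tau> powr (q - 1)) (at \<tau>)" if "s \<le> \<tau>" for \<tau>
    unfolding has_real_derivative_iff_has_vector_derivative[symmetric]
    using that st q by (auto intro!: derivative_eq_intros)
  have "norm (f t - f s) \<le> C * (t powr q / q) - C * (s powr q / q)"
  proof (rule differentiable_bound_general[OF \<open>s < t\<close>, where f'=f' and \<phi>'="\<lambda>\<tau>. C * \<tau> powr (q - 1)"])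
    show "continuous_on {s..t} f"
      using has_vector_derivative_continuous[OF f] by (intro continuous_at_imp_continuous_on) auto
    show "continuous_on {s..t} (\<lambda>\<tau>. C * (\<tau> powr q / q))"
      using has_vector_derivative_continuous[OF d] by (intro continuous_at_imp_continuous_on) auto
  qed (use f d le in auto)
  then show ?thesis by (simp add: algebra_simps diff_divide_distrib)
qed simp

text \<open>A bound for \<open>x^b e^(-c x)\<close> on \<open>x \<ge> d\<close>. For
  \<open>b < 0\<close> the power is largest at \<open>d\<close>. Otherwise the value is
  \<open>((b + 1) / c)^b\<close>, which comes from \<open>ln y \<le> y - 1\<close> at
  \<open>y = c x / (b + 1)\<close>; taking \<open>b + 1\<close> instead of \<open>b\<close> avoids
  dividing by zero at \<open>b = 0\<close>.\<close>

definition powr_exp_const :: "real \<Rightarrow> real \<Rightarrow> real \<Rightarrow> real" where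
  "powr_exp_const b c d = (if b < 0 then d powr b else exp (b * ln ((b + 1) / c)))"

lemma powr_exp_const_nonneg: "0 \<le> powr_exp_const b c d"
  by (simp add: powr_exp_const_def)

lemma powr_le_exp:
  fixes b c d x :: real
  assumes "c > 0" "d > 0" "x \<ge> d"
  shows "x powr b \<le> powr_exp_const b c d * exp (c * x)"
proof (cases "b < 0")
  case True
  have "x powr b \<le> d powr b" using assms True by (intro powr_mono2') auto
  also have "\<dots> \<le> d powr b * exp (c * x)" using assms by simp
  finally show ?thesis using True by (simp add: powr_exp_const_def)
next
  case False
  have "ln (c * x / (b + 1)) \<le> c * x / (b + 1) - 1"
    using assms False by (intro ln_le_minus_one) auto
  moreover have "ln x = ln (c * x / (b + 1)) + ln ((b + 1) / c)"
    using assms False by (simp add: ln_mult ln_div)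
  ultimately have "b * ln x \<le> b * (c * x / (b + 1) + ln ((b + 1) / c))"
    using False by (intro mult_left_mono) auto
  also have "\<dots> = c * x * (b / (b + 1)) + b * ln ((b + 1) / c)" by (simp add: algebra_simps)
  also have "c * x * (b / (b + 1)) \<le> c * x * 1" using assms False by (intro mult_left_mono) auto
  finally have "exp (b * ln x) \<le> exp (c * x + b * ln ((b + 1) / c))" by simp
  then show ?thesis using assms False by (simp add: powr_def powr_exp_const_def exp_add mult.commute)
qed

text \<open>The exponent is shifted by one so that the contour integral of
  \<open>e^(z t) k(z)\<close> is of order \<open>t^(-\<beta>)\<close>.\<close>

definition growth :: "real \<Rightarrow> real \<Rightarrow> (complex \<Rightarrow> 'h::real_normed_vector) \<Rightarrow> bool" where
  "growth \<beta> B k \<longleftrightarrow> (\<forall>z\<in>slit. norm (k z) \<le> B * cmod z powr (\<beta> - 1))"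

lemma growthD: "growth \<beta> B k \<Longrightarrow> z \<in> slit \<Longrightarrow> norm (k z) \<le> B * cmod z powr (\<beta> - 1)"
  by (simp add: growth_def)

lemma growth_nonneg: "growth \<beta> B k \<Longrightarrow> 0 \<le> B"
  using growthD[of \<beta> B k 1] order_trans[OF norm_ge_zero] by fastforce

text \<open>Under the contour integral, multiplication by \<open>z\<close> is differentiation in
  time and costs one power of \<open>t\<close>.\<close>

lemma growth_mult: "growth \<beta> B k \<Longrightarrow> growth (\<beta> + 1) B (\<lambda>z. cscale z (k z :: 'h::real_inner \<times> 'h))"
proof -
  assume g: "growth \<beta> B k"
  have "cmod z * norm (k z) \<le> B * cmod z powr \<beta>" if "z \<in> slit" for z
  proof -
    have "cmod z > 0" using that by auto
    have "cmod z * norm (k z) \<le> cmod z * (B * cmod z powr (\<beta> - 1))"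
      using growthD[OF g that] by (rule mult_left_mono) simp
    then show ?thesis using \<open>cmod z > 0\<close> powr_mult_base[of "cmod z" "\<beta> - 1"] by (simp add: mult_ac)
  qed
  then show ?thesis by (simp add: growth_def norm_cscale)
qed

section \<open>Inverse Laplace integrals along the contour\<close>

locale hankel =
  fixes \<theta> \<delta> :: real
  assumes \<theta>: "pi / 2 < \<theta>" "\<theta> < pi" and \<delta>: "0 < \<delta>"
begin

text \<open>The decay rate on the rays, where \<open>|e^(z t)| = e^(-a \<rho> t)\<close>; it is
  positive because \<theta> exceeds \<open>pi / 2\<close>.\<close>

definition a where "a = - cos \<theta>"

lemma a: "0 < a" "a \<le> 1"
  using \<theta> cos_gt_zero_pi[of "pi - \<theta>"] by (auto simp: a_def) 

lemma \<theta>0: "0 < \<theta>" using \<theta> pi_gt_zero by linarith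

definition J :: "(complex \<Rightarrow> 'h::real_normed_vector \<times> 'h) \<Rightarrow> real \<Rightarrow> 'h \<times> 'h" where
  "J k t = Gamma_integral \<theta> \<delta> (\<lambda>z. cscale (exp (z * of_real t)) (k z))"

text \<open>What remains independent of \<open>t\<close> after rescaling to radius
  \<open>1 / t\<close>: the first term comes from the two rays, half of whose decay absorbs the
  power of \<open>z\<close>, the second from the arc, where
  \<open>|e^(z t)| \<le> e\<close>.\<close>

definition J_const :: "real \<Rightarrow> real" where
  "J_const \<beta> = 2 * (powr_exp_const (\<beta> - 1) (a / 2) 1 * (2 / a)) + 2 * \<theta> * exp 1"

lemma J_const_nonneg: "0 \<le> J_const \<beta>"
  using a \<theta>0 by (simp add: J_const_def powr_exp_const_nonneg)

lemma norm_exp_polar: "cmod (exp (of_real \<rho> * cis \<psi> * of_real t)) = exp (\<rho> * t * cos \<psi>)"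
  by (simp add: mult_ac)

lemma ray_in_slit: "\<rho> > 0 \<Longrightarrow> of_real \<rho> * cis \<theta> \<in> slit" "\<rho> > 0 \<Longrightarrow> of_real \<rho> * cis (- \<theta>) \<in> slit"
  using \<theta> \<theta>0 by (intro polar_in_slit; simp)+

text \<open>Half of the decay rate \<open>a t\<close> absorbs the power
  \<open>|z|^(\<beta> - 1)\<close>, whatever the sign of its exponent.\<close>

lemma decaying_exp:
  fixes k :: "complex \<Rightarrow> 'h::real_inner \<times> 'h"
  assumes g: "growth \<beta> B k" and t: "t > 0" and d: "d > 0"
  shows "decaying \<theta> d (a * t / 2) (B * powr_exp_const (\<beta> - 1) (a * t / 2) d) (\<lambda>z. cscale (exp (z * of_real
      t)) (k z))"
proof -
  have B: "0 \<le> B" using growth_nonneg[OF g] .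
  have "norm (cscale (exp (of_real \<rho> * cis \<psi> * of_real t)) (k (of_real \<rho> * cis \<psi>)))
      \<le> B * powr_exp_const (\<beta> - 1) (a * t / 2) d * exp (- (a * t / 2) * \<rho>)"
    if \<rho>: "\<rho> \<ge> d" and \<psi>: "\<psi> = \<theta> \<or> \<psi> = - \<theta>" for \<rho> \<psi>
  proof -
    have z: "of_real \<rho> * cis \<psi> \<in> slit" using ray_in_slit[of \<rho>] \<rho> d \<psi> by auto
    have "cos \<psi> = - a" using \<psi> by (auto simp: a_def)
    then have "norm (cscale (exp (of_real \<rho> * cis \<psi> * of_real t)) (k (of_real \<rho> * cis \<psi>)))
        = exp (- (\<rho> * t * a)) * norm (k (of_real \<rho> * cis \<psi>))"
      unfolding norm_cscale norm_exp_polar by simp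
    also have "\<dots> \<le> exp (- (\<rho> * t * a)) * (B * \<rho> powr (\<beta> - 1))"
      using growthD[OF g z] \<rho> d by (intro mult_left_mono) (auto simp: norm_mult)
    also have "\<dots> \<le> exp (- (\<rho> * t * a)) * (B * (powr_exp_const (\<beta> - 1) (a * t / 2) d * exp (a * t / 2 * \<rho>)))"
      using a t d \<rho> B by (intro mult_left_mono powr_le_exp) auto
    also have "\<dots> = B * powr_exp_const (\<beta> - 1) (a * t / 2) d * (exp (- (\<rho> * t * a)) * exp (a * t / 2 * \<rho>))"
      by (simp add: mult_ac)
    also have "exp (- (\<rho> * t * a)) * exp (a * t / 2 * \<rho>) = exp (- (a * t / 2) * \<rho>)"
      by (simp add: exp_add[symmetric] algebra_simps)
    finally show ?thesis .
  qed
  then show ?thesis unfolding decaying_def by blast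
qed

lemma weakly_holomorphic_exp:
  assumes "weakly_holomorphic k"
  shows "weakly_holomorphic (\<lambda>z. cscale (exp (z * of_real t)) (k z))"
  by (intro weakly_holomorphic_cscale assms holomorphic_intros)

lemma continuous_exp:
  assumes "weakly_holomorphic k"
  shows "continuous_on slit (\<lambda>z. cscale (exp (z * of_real t)) (k z))"
  using weakly_holomorphic_exp[OF assms] by (simp add: weakly_holomorphic_def)

lemma J_integrable:
  fixes k :: "complex \<Rightarrow> 'h::{real_inner, banach} \<times> 'h"
  assumes k: "weakly_holomorphic k" and g: "growth \<beta> B k" and t: "t > 0"
  shows "Gamma_integrable \<theta> \<delta> (\<lambda>z. cscale (exp (z * of_real t)) (k z))"
  using Gamma_integral_bound(1)[OF continuous_exp[OF k] \<theta>0 \<theta>(2) \<delta> _ decaying_exp[OF g t \<delta>]] a t by simp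

lemma J_diff:
  fixes k l :: "complex \<Rightarrow> 'h::{real_inner, banach} \<times> 'h"
  assumes "weakly_holomorphic k" "growth \<beta> B k" "weakly_holomorphic l" "growth \<beta>' B' l" "t > 0"
  shows "J (\<lambda>z. k z - l z) t = J k t - J l t"
  unfolding J_def cscale.diff_right
  by (intro Gamma_integral_diff J_integrable[OF assms(1,2)] J_integrable[OF assms(3,4)] assms(5))

text \<open>On the contour with radius \<open>1 / t\<close> the integral scales like a power of \<open>t\<close>.\<close>

lemma J_bound:
  fixes k :: "complex \<Rightarrow> 'h::{real_inner, banach} \<times> 'h"
  assumes k: "weakly_holomorphic k" and g: "growth \<beta> B k" and t: "t > 0"
  shows "norm (J k t) \<le> J_const \<beta> * B * t powr (- \<beta>)"
proof -
  let ?F = "\<lambda>z. cscale (exp (z * of_real t)) (k z)"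
  let ?C = "powr_exp_const (\<beta> - 1) (a / 2) 1"
  have B: "0 \<le> B" using growth_nonneg[OF g] .
  have t1: "0 < 1 / t" using t by simp
  have at: "0 < a * t / 2" using a t by simp
  have "J k t = Gamma_integral \<theta> (1 / t) ?F"
    unfolding J_def
    by (rule Gamma_integral_radius[OF weakly_holomorphic_exp[OF k] \<theta>0 \<theta>(2) \<delta> t1 at
          decaying_exp[OF g t \<delta>] at decaying_exp[OF g t t1]])
  also have "norm \<dots> \<le> 2 * (B * t powr (1 - \<beta>) * ?C * exp (- (a * t / 2) * (1 / t)) / (a * t / 2))
      + 2 * \<theta> * (1 / t * (exp 1 * (B * t powr (1 - \<beta>))))"
  proof (rule Gamma_integral_bound(2)[OF continuous_exp[OF k] \<theta>0 \<theta>(2) t1 at])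
    have "norm (?F (of_real \<rho> * cis \<psi>)) \<le> B * t powr (1 - \<beta>) * ?C * exp (- (a * t / 2) * \<rho>)"
      if \<rho>: "\<rho> \<ge> 1 / t" and \<psi>: "\<psi> = \<theta> \<or> \<psi> = - \<theta>" for \<rho> \<psi>
    proof -
      have \<rho>0: "\<rho> > 0" "t * \<rho> \<ge> 1"
        using less_le_trans[OF t1 \<rho>] \<rho> t by (auto simp: field_simps)
      have z: "of_real \<rho> * cis \<psi> \<in> slit" using ray_in_slit[of \<rho>] \<rho>0 \<psi> by auto
      have "cos \<psi> = - a" using \<psi> by (auto simp: a_def)
      then have "norm (?F (of_real \<rho> * cis \<psi>)) = exp (- (\<rho> * t * a)) * norm (k (of_real \<rho> * cis \<psi>))"
        unfolding norm_cscale norm_exp_polar by simp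
      also have "\<dots> \<le> exp (- (\<rho> * t * a)) * (B * \<rho> powr (\<beta> - 1))"
        using growthD[OF g z] \<rho>0 by (intro mult_left_mono) (auto simp: norm_mult)
      \<comment> \<open>In the scaled variable \<open>t * \<rho> \<ge> 1\<close> the constant
        \<open>?C\<close> no longer depends on \<open>t\<close>.\<close>
      also have "\<rho> powr (\<beta> - 1) = t powr (1 - \<beta>) * (t * \<rho>) powr (\<beta> - 1)"
        using t \<rho>0 by (simp add: powr_mult powr_add[symmetric])
      also have "exp (- (\<rho> * t * a)) * (B * (t powr (1 - \<beta>) * (t * \<rho>) powr (\<beta> - 1)))
          \<le> exp (- (\<rho> * t * a)) * (B * (t powr (1 - \<beta>) * (?C * exp (a / 2 * (t * \<rho>)))))"
        using a B \<rho>0 by (intro mult_left_mono powr_le_exp) auto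
      also have "\<dots> = B * t powr (1 - \<beta>) * ?C * (exp (- (\<rho> * t * a)) * exp (a / 2 * (t * \<rho>)))"
        by (simp add: mult_ac)
      also have "exp (- (\<rho> * t * a)) * exp (a / 2 * (t * \<rho>)) = exp (- (a * t / 2) * \<rho>)"
        by (simp add: exp_add[symmetric] algebra_simps)
      finally show ?thesis .
    qed
    then show "decaying \<theta> (1 / t) (a * t / 2) (B * t powr (1 - \<beta>) * ?C) ?F"
      unfolding decaying_def by blast
    fix \<psi> assume \<psi>: "\<bar>\<psi>\<bar> \<le> \<theta>"
    have z: "of_real (1 / t) * cis \<psi> \<in> slit" using \<psi> \<theta> t1 by (intro polar_in_slit) auto
    have "norm (?F (of_real (1 / t) * cis \<psi>)) = exp (cos \<psi>) * norm (k (of_real (1 / t) * cis \<psi>))"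
      unfolding norm_cscale norm_exp_polar using t by simp
    also have "\<dots> \<le> exp 1 * (B * (1 / t) powr (\<beta> - 1))"
      using growthD[OF g z] t by (intro mult_mono) (auto simp: norm_mult norm_divide)
    also have "(1 / t) powr (\<beta> - 1) = t powr (1 - \<beta>)"
      using t by (simp add: powr_divide powr_diff field_simps)
    finally show "norm (?F (of_real (1 / t) * cis \<psi>)) \<le> exp 1 * (B * t powr (1 - \<beta>))" .
  qed
  also have "\<dots> \<le> 2 * (B * t powr (1 - \<beta>) * ?C * 1 / (a * t / 2))
      + 2 * \<theta> * (1 / t * (exp 1 * (B * t powr (1 - \<beta>))))"
    using a t B at \<theta>0 by (intro add_mono mult_left_mono divide_right_mono) (auto simp: powr_exp_const_nonneg)
  also have "\<dots> = J_const \<beta> * B * (t powr (1 - \<beta>) / t)"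
    using a t by (simp add: J_const_def field_simps)
  also have "t powr (1 - \<beta>) / t = t powr (- \<beta>)"
    using t by (simp add: powr_diff powr_minus field_simps)
  finally show ?thesis .
qed

text \<open>The error of the difference quotient is itself a contour integral, with the second order
  Taylor remainder of \<open>e^(z h)\<close> in the integrand. It is bounded by \<open>h^2\<close>
  times an integrand that still decays, provided that \<open>|h| \<le> a t / 2\<close>.\<close>

lemma J_has_vector_derivative:
  fixes k :: "complex \<Rightarrow> 'h::{real_inner, banach} \<times> 'h"
  assumes k: "weakly_holomorphic k" and g: "growth \<beta> B k" and t: "t > 0"
  shows "(J k has_vector_derivative J (\<lambda>z. cscale z (k z)) t) (at t)"
proof -
  have B: "0 \<le> B" using growth_nonneg[OF g] .
  have zk: "weakly_holomorphic (\<lambda>z. cscale z (k z))"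
    by (intro weakly_holomorphic_cscale k holomorphic_intros)
  note zg = growth_mult[OF g]
  \<comment> \<open>Budget of the decay rate \<open>a t\<close>: one half is lost to
    \<open>e^(\<rho> |h|)\<close>, one quarter to the power, and one quarter is left. The exponent
    \<open>\<beta> + 1\<close> is \<open>\<beta> - 1\<close> plus the square from the Taylor
    remainder.\<close>
  define M where "M = B * powr_exp_const (\<beta> + 1) (a * t / 4) \<delta>"
  define N where "N = \<delta>\<^sup>2 * (exp (\<delta> * t) * exp (\<delta> * t) * (B * \<delta> powr (\<beta> - 1)))"
  define Q where "Q = 2 * (M * exp (- (a * t / 4) * \<delta>) / (a * t / 4)) + 2 * \<theta> * (\<delta> * N)"
  have at: "0 < a * t / 4" using a t by simp
  have key: "norm (J k (t + h) - J k t - h *\<^sub>R J (\<lambda>z. cscale z (k z)) t) \<le> h\<^sup>2 * Q"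
    if h: "\<bar>h\<bar> \<le> a * t / 2" for h
  proof -
    have "a * t \<le> t" using a t by simp
    then have th: "t + h > 0" "\<bar>h\<bar> \<le> t" using h t by linarith+
    define R where "R z = exp (z * of_real t) * (exp (z * of_real h) - 1 - z * of_real h)" for z :: complex
    have Rk: "cscale (R z) (k z) = cscale (exp (z * of_real (t + h))) (k z) - cscale (exp (z * of_real t)) (k z)
        - h *\<^sub>R cscale (exp (z * of_real t)) (cscale z (k z))" for z
      unfolding cscale_of_real[symmetric] cscale_cscale cscale.diff_left[symmetric] R_def
      by (simp add: exp_add algebra_simps)
    note i1 = J_integrable[OF k g th(1)] and i2 = J_integrable[OF k g t]
      and i3 = Gamma_integral_scaleR(1)[OF J_integrable[OF zk zg t], of h]
    note i12 = Gamma_integral_diff(1)[OF i1 i2]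
    have eq: "Gamma_integral \<theta> \<delta> (\<lambda>z. cscale (R z) (k z)) = J k (t + h) - J k t - h *\<^sub>R J (\<lambda>z. cscale z (k
        z)) t"
      unfolding Rk J_def
      by (simp only: Gamma_integral_diff(2)[OF i12 i3] Gamma_integral_diff(2)[OF i1 i2]
          Gamma_integral_scaleR(2)[OF J_integrable[OF zk zg t]])
    have Rle: "cmod (R z) \<le> exp (Re z * t) * (exp (cmod z * \<bar>h\<bar>) * (cmod z * \<bar>h\<bar>)\<^sup>2)" for z
    proof -
      have "cmod (exp (z * of_real h) - (\<Sum>i\<le>1. (z * of_real h) ^ i / fact i))
          \<le> exp \<bar>Re (z * of_real h)\<bar> * cmod (z * of_real h) ^ Suc 1 / fact 1"
        by (rule Taylor_exp)
      then have "cmod (exp (z * of_real h) - 1 - z * of_real h) \<le> exp \<bar>Re z * h\<bar> * (cmod z * \<bar>h\<bar>)\<^sup>2"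
        by (simp add: norm_mult power2_eq_square algebra_simps)
      also have "\<dots> \<le> exp (cmod z * \<bar>h\<bar>) * (cmod z * \<bar>h\<bar>)\<^sup>2"
        by (intro mult_right_mono) (auto simp: abs_mult intro!: mult_right_mono abs_Re_le_cmod)
      finally show ?thesis
        unfolding R_def norm_mult by (intro mult_mono) auto
    qed
    have "norm (Gamma_integral \<theta> \<delta> (\<lambda>z. cscale (R z) (k z)))
        \<le> 2 * (h\<^sup>2 * M * exp (- (a * t / 4) * \<delta>) / (a * t / 4)) + 2 * \<theta> * (\<delta> * (h\<^sup>2 * N))"
    proof (rule Gamma_integral_bound(2)[OF _ \<theta>0 \<theta>(2) \<delta> at])
      show "continuous_on slit (\<lambda>z. cscale (R z) (k z))"
        using k unfolding R_def weakly_holomorphic_def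
        by (intro cscale.continuous_on continuous_intros) auto
      have "norm (cscale (R (of_real \<rho> * cis \<psi>)) (k (of_real \<rho> * cis \<psi>))) \<le> h\<^sup>2 * M * exp (- (a * t / 4) * \<rho>)"
        if \<rho>: "\<rho> \<ge> \<delta>" and \<psi>: "\<psi> = \<theta> \<or> \<psi> = - \<theta>" for \<rho> \<psi>
      proof -
        have \<rho>0: "\<rho> > 0" using \<rho> \<delta> by simp
        have z: "of_real \<rho> * cis \<psi> \<in> slit" using ray_in_slit[of \<rho>] \<rho>0 \<psi> by auto
        have [simp]: "cos \<psi> = - a" using \<psi> by (auto simp: a_def)
        have "norm (cscale (R (of_real \<rho> * cis \<psi>)) (k (of_real \<rho> * cis \<psi>)))
            \<le> (exp (- (\<rho> * a * t)) * (exp (\<rho> * \<bar>h\<bar>) * (\<rho> * \<bar>h\<bar>)\<^sup>2)) * (B * \<rho> powr (\<beta> - 1))"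
          unfolding norm_cscale
          using Rle[of "of_real \<rho> * cis \<psi>"] growthD[OF g z] \<rho>0 by (intro mult_mono) (auto simp: norm_mult)
        also have "\<dots> \<le> (exp (- (\<rho> * a * t)) * (exp (\<rho> * (a * t / 2)) * (\<rho> * \<bar>h\<bar>)\<^sup>2)) * (B * \<rho> powr (\<beta> - 1))"
          using h \<rho>0 B by (intro mult_right_mono mult_left_mono) auto
        also have "\<dots> = h\<^sup>2 * B * (\<rho>\<^sup>2 * \<rho> powr (\<beta> - 1)) * (exp (- (\<rho> * a * t)) * exp (\<rho> * (a * t / 2)))"
          by (simp add: power_mult_distrib)
        also have "\<rho>\<^sup>2 * \<rho> powr (\<beta> - 1) = \<rho> powr (\<beta> + 1)"
          using \<rho>0 by (simp add: powr_add[symmetric] add.commute flip: powr_numeral)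
        also have "h\<^sup>2 * B * \<rho> powr (\<beta> + 1) * (exp (- (\<rho> * a * t)) * exp (\<rho> * (a * t / 2)))
            \<le> h\<^sup>2 * B * (powr_exp_const (\<beta> + 1) (a * t / 4) \<delta> * exp (a * t / 4 * \<rho>)) * (exp (- (\<rho> * a * t))
                * exp (\<rho> * (a * t / 2)))"
          using B at \<delta> \<rho> by (intro mult_right_mono mult_left_mono powr_le_exp) auto
        also have "\<dots> = h\<^sup>2 * M * (exp (a * t / 4 * \<rho>) * exp (- (\<rho> * a * t)) * exp (\<rho> * (a * t / 2)))"
          by (simp add: M_def)
        also have "exp (a * t / 4 * \<rho>) * exp (- (\<rho> * a * t)) * exp (\<rho> * (a * t / 2)) = exp (- (a * t / 4) * \<rho>)"
          unfolding exp_add[symmetric] by (simp add: field_simps)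
        finally show ?thesis .
      qed
      then show "decaying \<theta> \<delta> (a * t / 4) (h\<^sup>2 * M) (\<lambda>z. cscale (R z) (k z))"
        unfolding decaying_def by blast
      fix \<psi> assume \<psi>: "\<bar>\<psi>\<bar> \<le> \<theta>"
      have z: "of_real \<delta> * cis \<psi> \<in> slit" using \<psi> \<theta> \<delta> by (intro polar_in_slit) auto
      have "norm (cscale (R (of_real \<delta> * cis \<psi>)) (k (of_real \<delta> * cis \<psi>)))
          \<le> (exp (\<delta> * cos \<psi> * t) * (exp (\<delta> * \<bar>h\<bar>) * (\<delta> * \<bar>h\<bar>)\<^sup>2)) * (B * \<delta> powr (\<beta> - 1))"
        unfolding norm_cscale
        using Rle[of "of_real \<delta> * cis \<psi>"] growthD[OF g z] \<delta> by (intro mult_mono) (auto simp: norm_mult)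
      also have "\<dots> \<le> (exp (\<delta> * 1 * t) * (exp (\<delta> * t) * (\<delta> * \<bar>h\<bar>)\<^sup>2)) * (B * \<delta> powr (\<beta> - 1))"
        using th t \<delta> B by (intro mult_right_mono mult_mono) auto
      also have "\<dots> = h\<^sup>2 * N" by (simp add: N_def power_mult_distrib)
      finally show "norm (cscale (R (of_real \<delta> * cis \<psi>)) (k (of_real \<delta> * cis \<psi>))) \<le> h\<^sup>2 * N" .
    qed
    also have "2 * (h\<^sup>2 * M * exp (- (a * t / 4) * \<delta>) / (a * t / 4)) + 2 * \<theta> * (\<delta> * (h\<^sup>2 * N)) = h\<^sup>2 * Q"
      by (simp add: Q_def distrib_left mult_ac)
    finally show ?thesis unfolding eq .
  qed
  show ?thesis
    unfolding has_vector_derivative_def has_derivative_at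
  proof
    show "bounded_linear (\<lambda>h. h *\<^sub>R J (\<lambda>z. cscale z (k z)) t)" by (rule bounded_linear_scaleR_left)
    show "(\<lambda>h. norm (J k (t + h) - J k t - h *\<^sub>R J (\<lambda>z. cscale z (k z)) t) / norm h) \<midarrow>0\<rightarrow> 0"
    proof (rule Lim_null_comparison)
      have "eventually (\<lambda>h. \<bar>h\<bar> < a * t / 2) (at 0)"
        using a t by (auto simp: eventually_at dist_real_def intro!: exI[of _ "a * t / 2"])
      moreover have "eventually (\<lambda>h. h \<noteq> (0::real)) (at 0)" by (simp add: eventually_at_filter)
      ultimately show "eventually (\<lambda>h. norm (norm (J k (t + h) - J k t - h *\<^sub>R J (\<lambda>z. cscale z (k z)) t) /
          norm h)
          \<le> \<bar>h\<bar> * Q) (at 0)"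
      proof eventually_elim
        case (elim h)
        have "norm (J k (t + h) - J k t - h *\<^sub>R J (\<lambda>z. cscale z (k z)) t) / norm h \<le> h\<^sup>2 * Q / \<bar>h\<bar>"
          using key[of h] elim by (simp add: divide_right_mono)
        also have "h\<^sup>2 * Q / \<bar>h\<bar> = \<bar>h\<bar> * Q"
          using elim by (simp add: power2_eq_square field_simps)
        finally show ?case by simp
      qed
      show "((\<lambda>h. \<bar>h\<bar> * Q) \<longlongrightarrow> 0) (at 0)" by (auto intro!: tendsto_eq_intros)
    qed
  qed
qed

text \<open>The primitive \<open>e^(z t) v / t\<close> vanishes at both ends of the contour. This
  allows \<open>K(z) v\<close> to be replaced by \<open>K(z) v - v\<close> under the integral, which
  decays better in \<open>z\<close> for smooth data.\<close>

lemma J_const_function: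
  fixes v :: "'h::{real_inner, banach} \<times> 'h"
  assumes t: "t > 0"
  shows "J (\<lambda>z. v) t = 0"
proof -
  have g: "growth 1 (norm v) (\<lambda>z. v)" by (auto simp: growth_def)
  have at: "0 < a * t / 2" using a t by simp
  have "inner (J (\<lambda>z. v) t) w = 0" for w
  proof -
    define P where "P z = exp (z * of_real t) / of_real t * cfun w v" for z :: complex
    have P: "(P has_field_derivative cfun w (cscale (exp (z * of_real t)) v)) (at z)" for z
      unfolding P_def cfun_cscale using t by (auto intro!: derivative_eq_intros)
    have lim: "((\<lambda>R. Re (P (of_real R * cis \<psi>))) \<longlongrightarrow> 0) at_top" if "\<psi> = \<theta> \<or> \<psi> = - \<theta>" for \<psi>
    proof (rule Lim_null_comparison[OF always_eventually, rule_format])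
      fix R
      have "norm (Re (P (of_real R * cis \<psi>))) \<le> cmod (P (of_real R * cis \<psi>))"
        by (simp add: abs_Re_le_cmod)
      also have "\<dots> = exp (R * t * cos \<psi>) / t * cmod (cfun w v)"
        using t unfolding P_def norm_mult norm_divide norm_exp_polar by simp
      finally show "norm (Re (P (of_real R * cis \<psi>))) \<le> exp (- (a * t) * R) / t * cmod (cfun w v)"
        using that by (auto simp: a_def mult_ac)
      have "((\<lambda>R. exp (- c * R)) \<longlongrightarrow> 0) at_top" if "c > 0" for c :: real
        using that by real_asymp
      from this[of "a * t"] have "((\<lambda>R. exp (- (a * t) * R)) \<longlongrightarrow> 0) at_top" using at by simp
      then show "((\<lambda>R. exp (- (a * t) * R) / t * cmod (cfun w v)) \<longlongrightarrow> 0) at_top"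
        by (intro tendsto_mult_left_zero tendsto_divide_zero)
    qed
    have "((\<lambda>R. Re (P (of_real R * cis \<theta>)) - Re (P (of_real R * cis (- \<theta>)))) \<longlongrightarrow> inner (J (\<lambda>z. v) t) w) at_top"
      unfolding J_def
      by (rule Gamma_integral_inner_limit[OF continuous_exp[OF weakly_holomorphic_const] \<theta>0 \<theta>(2) \<delta> at
          decaying_exp[OF g t \<delta>] P])
    moreover have "((\<lambda>R. Re (P (of_real R * cis \<theta>)) - Re (P (of_real R * cis (- \<theta>)))) \<longlongrightarrow> 0 - 0) at_top"
      by (intro tendsto_diff lim) auto
    ultimately show ?thesis using tendsto_unique[OF trivial_limit_at_top_linorder] by fastforce
  qed
  then show ?thesis by (metis inner_eq_zero_iff)
qed

end

section \<open>Resolvents of positive semidefinite operators\<close>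

lemma norm_Pair_le:
  assumes "norm a \<le> N * norm x" "norm b \<le> N * norm y" "0 \<le> N"
  shows "norm (a, b) \<le> N * norm (x, y)"
proof -
  have "(norm a)\<^sup>2 + (norm b)\<^sup>2 \<le> (N * norm x)\<^sup>2 + (N * norm y)\<^sup>2"
    using assms by (intro add_mono power_mono) auto
  also have "\<dots> = N\<^sup>2 * ((norm x)\<^sup>2 + (norm y)\<^sup>2)" by (simp add: power_mult_distrib algebra_simps)
  finally have "sqrt ((norm a)\<^sup>2 + (norm b)\<^sup>2) \<le> sqrt (N\<^sup>2 * ((norm x)\<^sup>2 + (norm y)\<^sup>2))"
    by (rule real_sqrt_le_mono)
  then show ?thesis using assms by (simp add: norm_Pair real_sqrt_mult)
qed

lemma inner_cscale_self: "inner (cscale c w) w = Re c * (norm w)\<^sup>2"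
  by (simp add: cscale_def inner_prod_def power2_norm_eq_inner inner_diff inner_add
      inner_commute[of "snd w" "fst w"] algebra_simps)

lemma norm_diff_scaleR_squared:
  fixes u v :: "'a::real_inner"
  shows "(norm (u - e *\<^sub>R v))\<^sup>2 = (norm u)\<^sup>2 - 2 * e * inner v u + e\<^sup>2 * (norm v)\<^sup>2"
  unfolding power2_norm_eq_inner
  by (simp add: inner_diff_left inner_diff_right inner_commute[of u v] power2_eq_square algebra_simps)

lemma powr_neg_polar:
  assumes "z \<noteq> 0"
  shows "z powr (- of_real \<alpha>) = of_real (cmod z powr (- \<alpha>)) * cis (- \<alpha> * Arg z)"
proof -
  have "- of_real \<alpha> * Ln z = of_real (- \<alpha> * ln (cmod z)) + \<i> * of_real (- \<alpha> * Arg z)"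
    by (simp add: Ln_Arg[OF assms] algebra_simps)
  then have "z powr (- of_real \<alpha>) = exp (of_real (- \<alpha> * ln (cmod z))) * exp (\<i> * of_real (- \<alpha> * Arg z))"
    using assms by (simp only: powr_def exp_add if_False)
  then show ?thesis
    using assms by (simp only: exp_of_real cis_conv_exp powr_def norm_eq_zero if_False)
qed

text \<open>\<open>N\<close> serves solvability of the resolvent equation and the embedding
  \<open>frac_domain_norm\<close>, but enters no resolvent bound; those bounds are therefore uniform
  over a family of operators.\<close>

locale psd_operator =
  fixes H :: "'h::{real_inner, banach} set" and S :: "'h \<Rightarrow> 'h" and N \<alpha> :: real
  assumes H: "subspace H" "closed H"
    and S_in: "\<And>u. u \<in> H \<Longrightarrow> S u \<in> H"
    and S_linear: "linear_op_on H S"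
    and S_sym: "\<And>u v. u \<in> H \<Longrightarrow> v \<in> H \<Longrightarrow> inner (S u) v = inner u (S v)"
    and S_nonneg: "\<And>u. u \<in> H \<Longrightarrow> 0 \<le> inner (S u) u"
    and S_bounded: "\<And>u. u \<in> H \<Longrightarrow> norm (S u) \<le> N * norm u"
    and N: "0 \<le> N" and \<alpha>: "0 < \<alpha>" "\<alpha> < 1"
begin

text \<open>The argument of \<open>z powr - \<alpha>\<close> is at most \<open>\<alpha> pi\<close>
  in absolute value; this is the cosine of half that angle.\<close>

definition c0 where "c0 = cos (\<alpha> * pi / 2)"

lemma c0: "0 < c0" "c0 \<le> 1"
  using \<alpha> by (auto simp: c0_def intro!: cos_gt_zero_pi) (smt (verit) mult_pos_pos pi_gt_zero)+

definition A :: "complex \<Rightarrow> 'h \<times> 'h \<Rightarrow> 'h \<times> 'h" where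
  "A z w = cscale (z powr (- of_real \<alpha>)) w + map_prod S S w"

definition R :: "complex \<Rightarrow> 'h \<times> 'h \<Rightarrow> 'h \<times> 'h" where
  "R z = inv_into (H \<times> H) (A z)"

abbreviation K :: "complex \<Rightarrow> 'h \<times> 'h \<Rightarrow> 'h \<times> 'h" where
  "K \<equiv> K_op H S \<alpha>"

lemma K_eq: "K z v = R z (map_prod S S v)"
  by (simp add: K_op_def R_def A_def[abs_def])

lemma S_zero: "S 0 = 0" and S_add: "u \<in> H \<Longrightarrow> v \<in> H \<Longrightarrow> S (u + v) = S u + S v"
  and S_scale: "u \<in> H \<Longrightarrow> S (c *\<^sub>R u) = c *\<^sub>R S u"
  using S_linear subspace_0[OF H(1)] unfolding linear_op_on_def by (metis scaleR_zero_left, auto)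

lemma S_diff: "u \<in> H \<Longrightarrow> v \<in> H \<Longrightarrow> S (u - v) = S u - S v"
  using S_add[of u "(- 1) *\<^sub>R v"] S_scale[of v "- 1"] subspace_scale[OF H(1), of v "- 1"] by simp

lemma HH: "subspace (H \<times> H)" using H(1) by (simp add: subspace_Times)

lemma closed_HH: "closed (H \<times> H)" using H(2) by (simp add: closed_Times)

lemma cscale_in: "w \<in> H \<times> H \<Longrightarrow> cscale c w \<in> H \<times> H"
  using H(1) by (auto simp: cscale_def subspace_diff subspace_add subspace_scale)

lemma Sc_in: "w \<in> H \<times> H \<Longrightarrow> map_prod S S w \<in> H \<times> H"
  using S_in by auto

lemma A_in: "w \<in> H \<times> H \<Longrightarrow> A z w \<in> H \<times> H"
  unfolding A_def by (intro subspace_add[OF HH] cscale_in Sc_in)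

lemma Sc_bounded: "w \<in> H \<times> H \<Longrightarrow> norm (map_prod S S w) \<le> N * norm w"
  using norm_Pair_le[OF S_bounded S_bounded N] by auto

lemma Sc_add: "v \<in> H \<times> H \<Longrightarrow> w \<in> H \<times> H \<Longrightarrow> map_prod S S (v + w) = map_prod S S v + map_prod S S w"
  by (auto simp: S_add)

lemma Sc_diff: "v \<in> H \<times> H \<Longrightarrow> w \<in> H \<times> H \<Longrightarrow> map_prod S S (v - w) = map_prod S S v - map_prod S S w"
  by (auto simp: S_diff)

lemma Sc_cscale: "w \<in> H \<times> H \<Longrightarrow> map_prod S S (cscale c w) = cscale c (map_prod S S w)"
  using H(1) by (auto simp: cscale_def S_diff S_add S_scale subspace_scale)

lemma A_diff: "v \<in> H \<times> H \<Longrightarrow> w \<in> H \<times> H \<Longrightarrow> A z (v - w) = A z v - A z w"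
  unfolding A_def by (simp only: Sc_diff cscale.diff_right) simp

lemma A_cscale: "w \<in> H \<times> H \<Longrightarrow> A z (cscale c w) = cscale c (A z w)"
  unfolding A_def by (simp add: Sc_cscale cscale.add_right cscale_cscale mult.commute)

lemma cmod_zeta: "z \<noteq> 0 \<Longrightarrow> cmod (z powr (- of_real \<alpha>)) = cmod z powr (- \<alpha>)"
  by (simp add: powr_neg_polar norm_mult)

lemma c0_le_cos: "c0 \<le> cos (\<alpha> * Arg z / 2)"
proof -
  have "\<bar>\<alpha> * Arg z / 2\<bar> \<le> \<alpha> * pi / 2"
    using Arg_bounded[of z] \<alpha> by (auto simp: abs_mult intro!: mult_left_mono)
  then have "cos (\<alpha> * pi / 2) \<le> cos \<bar>\<alpha> * Arg z / 2\<bar>"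
    using \<alpha> by (intro cos_monotone_0_pi_le) (auto simp: field_simps)
  then show ?thesis by (simp only: c0_def cos_abs_real)
qed

lemma rotated_zeta:
  assumes z: "z \<noteq> 0"
  shows "cis (\<alpha> * Arg z / 2) * z powr (- of_real \<alpha>) =
    of_real (cmod z powr (- \<alpha>)) * cis (- (\<alpha> * Arg z / 2))"
proof -
  have "cis (\<alpha> * Arg z / 2) * z powr (- of_real \<alpha>) =
      of_real (cmod z powr (- \<alpha>)) * (cis (\<alpha> * Arg z / 2) * cis (- \<alpha> * Arg z))"
    by (simp add: powr_neg_polar[OF z] mult_ac)
  also have "cis (\<alpha> * Arg z / 2) * cis (- \<alpha> * Arg z) = cis (- (\<alpha> * Arg z / 2))"
    by (simp add: cis_mult)
  finally show ?thesis .
qed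

text \<open>The argument of \<open>z powr - \<alpha>\<close> stays away from \<open>\<plusminus> \<pi>\<close>, so half of the rotation that would make it
  real moves both \<open>z powr - \<alpha>\<close> and the spectrum of \<open>S\<close> into a sector around the positive axis.\<close>

lemma A_coercive:
  assumes w: "w \<in> H \<times> H" and z: "z \<noteq> 0"
  shows "c0 * cmod z powr (- \<alpha>) * (norm w)\<^sup>2 \<le> inner (cscale (cis (\<alpha> * Arg z / 2)) (A z w)) w"
proof -
  let ?r = "cis (\<alpha> * Arg z / 2)"
  note c = c0_le_cos[of z]
  have Rz: "Re (?r * z powr (- of_real \<alpha>)) = cmod z powr (- \<alpha>) * cos (\<alpha> * Arg z / 2)"
    by (simp add: rotated_zeta[OF z])
  obtain x y where xy: "w = (x, y)" "x \<in> H" "y \<in> H" using w by auto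
  \<comment> \<open>Symmetry cancels the mixed terms, so the quadratic form of \<open>S\<close> on
    the complexification is real and nonnegative.\<close>
  have e: "inner (S x) y = inner (S y) x" using S_sym[of x y] xy inner_commute by metis
  have "inner (cscale ?r (map_prod S S w)) w = cos (\<alpha> * Arg z / 2) * (inner (S x) x + inner (S y) y)"
    using e xy(1) by (simp add: cscale_def inner_diff_left inner_add_left algebra_simps)
  also have "\<dots> \<ge> 0" using c c0 S_nonneg xy by (intro mult_nonneg_nonneg add_nonneg_nonneg) auto
  finally have "inner (cscale ?r (map_prod S S w)) w \<ge> 0" .
  moreover have "c0 * cmod z powr (- \<alpha>) * (norm w)\<^sup>2 \<le> inner (cscale (?r * z powr (- of_real \<alpha>)) w) w"
    unfolding inner_cscale_self Rz mult.commute[of c0] using c by (intro mult_right_mono mult_left_mono) auto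
  ultimately show ?thesis
    unfolding A_def cscale.add_right cscale_cscale inner_add_left by linarith
qed

lemma A_lower:
  assumes w: "w \<in> H \<times> H" and z: "z \<noteq> 0"
  shows "c0 * cmod z powr (- \<alpha>) * norm w \<le> norm (A z w)"
proof (cases "w = 0")
  case False
  have "c0 * cmod z powr (- \<alpha>) * (norm w)\<^sup>2 \<le> norm (cscale (cis (\<alpha> * Arg z / 2)) (A z w)) * norm w"
    using A_coercive[OF w z] norm_cauchy_schwarz order_trans by blast
  then show ?thesis using False by (simp add: norm_cscale power2_eq_square)
qed simp

text \<open>The Lax-Milgram argument: for a coercive and bounded operator, a damped residual step is
  a contraction of the complete set \<open>H \<times> H\<close>.\<close>

lemma A_surj:
  assumes g: "g \<in> H \<times> H" and z: "z \<noteq> 0"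
  shows "\<exists>w\<in>H \<times> H. A z w = g"
proof -
  let ?r = "cis (\<alpha> * Arg z / 2)"
  define m where "m = c0 * cmod z powr (- \<alpha>)"
  define M where "M = cmod z powr (- \<alpha>) + N"
  have m: "m > 0" using c0 z by (simp add: m_def)
  have "m \<le> 1 * cmod z powr (- \<alpha>)" unfolding m_def using c0 by (intro mult_right_mono) auto
  then have mM: "m \<le> M" using N by (simp add: M_def)
  \<comment> \<open>The minimizer of the contraction factor \<open>1 - 2 e m + e^2 M^2\<close>; the
    minimum is \<open>q\<close>, nonnegative because \<open>m \<le> M\<close>.\<close>
  define e where "e = m / M\<^sup>2"
  have A_upper: "norm (A z w) \<le> M * norm w" if "w \<in> H \<times> H" for w
    using norm_triangle_ineq[of "cscale (z powr (- of_real \<alpha>)) w" "map_prod S S w"] Sc_bounded[OF that]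
    by (simp add: A_def M_def norm_cscale cmod_zeta[OF z] algebra_simps)
  define f where "f w = w - e *\<^sub>R cscale ?r (A z w - g)" for w
  define q where "q = 1 - (m / M)\<^sup>2"
  have M: "M > 0" using m mM by simp
  have "m / M \<le> 1" "0 < m / M" using m mM M by auto
  then have q: "0 \<le> q" "q < 1" by (auto simp: q_def power_le_one)
  have contr: "norm (u - e *\<^sub>R cscale ?r (A z u)) \<le> sqrt q * norm u" if u: "u \<in> H \<times> H" for u
  proof -
    have "(norm (u - e *\<^sub>R cscale ?r (A z u)))\<^sup>2
        = (norm u)\<^sup>2 - 2 * e * inner (cscale ?r (A z u)) u + e\<^sup>2 * (norm (A z u))\<^sup>2"
      unfolding norm_diff_scaleR_squared by (simp add: norm_cscale)
    also have "\<dots> \<le> (norm u)\<^sup>2 - 2 * e * (m * (norm u)\<^sup>2) + e\<^sup>2 * (M * norm u)\<^sup>2"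
      using A_coercive[OF u z] A_upper[OF u] m M
      by (intro add_mono diff_mono mult_left_mono power_mono) (auto simp: m_def e_def)
    also have "\<dots> = q * (norm u)\<^sup>2"
      using M by (simp add: e_def q_def field_simps power2_eq_square)
    finally have "norm (u - e *\<^sub>R cscale ?r (A z u)) \<le> sqrt (q * (norm u)\<^sup>2)"
      by (rule real_le_rsqrt)
    then show ?thesis using q by (simp add: real_sqrt_mult)
  qed
  have "\<exists>!w\<in>H \<times> H. f w = w"
  proof (rule Banach_fix)
    show "complete (H \<times> H)" using closed_HH by (simp add: complete_eq_closed)
    show "H \<times> H \<noteq> {}" using g by auto
    show "0 \<le> sqrt q" "sqrt q < 1" using q by auto
    show "f ` (H \<times> H) \<subseteq> H \<times> H"
      unfolding f_def using g by (intro image_subsetI subspace_diff[OF HH] subspace_scale[OF HH] cscale_in A_in)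
    fix x y assume x: "x \<in> H \<times> H" and y: "y \<in> H \<times> H"
    have "f x - f y = (x - y) - e *\<^sub>R cscale ?r (A z (x - y))"
      unfolding f_def A_diff[OF x y] by (simp add: cscale.diff_right algebra_simps)
    then show "dist (f x) (f y) \<le> sqrt q * dist x y"
      using contr[OF subspace_diff[OF HH x y]] by (simp add: dist_norm)
  qed
  then obtain w where w: "w \<in> H \<times> H" "f w = w" by blast
  have "e \<noteq> 0" using m M by (simp add: e_def)
  with w(2) have "cscale ?r (A z w - g) = 0" by (simp add: f_def)
  then have "norm (A z w - g) = 0" using norm_cscale[of ?r "A z w - g"] by simp
  then show ?thesis using w(1) by auto
qed

lemma A_inj: "z \<noteq> 0 \<Longrightarrow> inj_on (A z) (H \<times> H)"
proof (rule inj_onI)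
  fix x y assume z: "z \<noteq> 0" and x: "x \<in> H \<times> H" and y: "y \<in> H \<times> H" and "A z x = A z y"
  then have "A z (x - y) = 0" using A_diff by simp
  then have "c0 * cmod z powr (- \<alpha>) * norm (x - y) \<le> 0"
    using A_lower[OF subspace_diff[OF HH x y] z] by simp
  then show "x = y" using c0 z by (simp add: mult_le_0_iff)
qed

lemma in_A_image: "g \<in> H \<times> H \<Longrightarrow> z \<noteq> 0 \<Longrightarrow> g \<in> A z ` (H \<times> H)"
  using A_surj by (metis image_eqI)

lemma R_in: "g \<in> H \<times> H \<Longrightarrow> z \<noteq> 0 \<Longrightarrow> R z g \<in> H \<times> H"
  unfolding R_def by (rule inv_into_into[OF in_A_image])

lemma A_R: "g \<in> H \<times> H \<Longrightarrow> z \<noteq> 0 \<Longrightarrow> A z (R z g) = g"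
  unfolding R_def by (rule f_inv_into_f[OF in_A_image])

lemma R_unique: "w \<in> H \<times> H \<Longrightarrow> z \<noteq> 0 \<Longrightarrow> A z w = g \<Longrightarrow> R z g = w"
  unfolding R_def using inv_into_f_f[OF A_inj] by blast

lemma R_bound:
  assumes "g \<in> H \<times> H" "z \<noteq> 0"
  shows "norm (R z g) \<le> cmod z powr \<alpha> / c0 * norm g"
  using A_lower[OF R_in[OF assms] assms(2)] A_R[OF assms] c0 assms
  by (simp add: powr_minus field_simps)

lemma R_diff: "g \<in> H \<times> H \<Longrightarrow> g' \<in> H \<times> H \<Longrightarrow> z \<noteq> 0 \<Longrightarrow> R z (g - g') = R z g - R z g'"
  by (intro R_unique subspace_diff[OF HH] R_in) (simp_all add: A_diff R_in A_R)

lemma R_cscale: "g \<in> H \<times> H \<Longrightarrow> z \<noteq> 0 \<Longrightarrow> R z (cscale c g) = cscale c (R z g)"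
  by (intro R_unique cscale_in R_in) (simp_all add: A_cscale R_in A_R)

text \<open>Reduces the dependence of \<open>R z g\<close> on \<open>z\<close> to that of the scalar
  \<open>z powr - \<alpha>\<close>; continuity and holomorphy both come from here.\<close>

lemma resolvent_identity:
  assumes "g \<in> H \<times> H" "z \<noteq> 0" "y \<noteq> 0"
  shows "R z g - R y g = cscale (y powr (- of_real \<alpha>) - z powr (- of_real \<alpha>)) (R z (R y g))"
proof -
  note i = R_in[OF assms(1,3)]
  have "A y (R y g) - A z (R y g) = cscale (y powr (- of_real \<alpha>) - z powr (- of_real \<alpha>)) (R y g)"
    unfolding A_def cscale.diff_left by simp
  then have "cscale (y powr (- of_real \<alpha>) - z powr (- of_real \<alpha>)) (R y g) = g - A z (R y g)"
    using A_R[OF assms(1,3)] by simp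
  then have "cscale (y powr (- of_real \<alpha>) - z powr (- of_real \<alpha>)) (R z (R y g)) = R z (g - A z (R y g))"
    using R_cscale[OF i assms(2), symmetric] by (simp only:)
  also have "\<dots> = R z g - R z (A z (R y g))" by (intro R_diff A_in i assms)
  also have "R z (A z (R y g)) = R y g" by (intro R_unique i assms refl)
  finally show ?thesis ..
qed

section \<open>Holomorphic dependence of the resolvent on \<open>z\<close>\<close>

lemma zeta_holomorphic: "(\<lambda>z. z powr (- of_real \<alpha>)) holomorphic_on slit"
  by (intro holomorphic_intros) auto

lemma zeta_continuous: "continuous_on slit (\<lambda>z. z powr (- of_real \<alpha>))"
  by (rule holomorphic_on_imp_continuous_on[OF zeta_holomorphic])

lemma slit_nonzero: "z \<in> slit \<Longrightarrow> z \<noteq> 0" by auto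

lemma R_isCont:
  assumes g: "g \<in> H \<times> H" and y: "y \<in> slit"
  shows "((\<lambda>z. R z g) \<longlongrightarrow> R y g) (at y)"
proof -
  have y0: "y \<noteq> 0" using y by auto
  have "((\<lambda>z. cmod (y powr (- of_real \<alpha>) - z powr (- of_real \<alpha>)) * (cmod z powr \<alpha> / c0 * norm (R y g)))
      \<longlongrightarrow> cmod (y powr (- of_real \<alpha>) - y powr (- of_real \<alpha>)) * (cmod y powr \<alpha> / c0 * norm (R y g))) (at y)"
    using zeta_continuous y open_slit c0 y0
    by (intro tendsto_intros) (auto simp: continuous_on_eq_continuous_at isCont_def)
  then have lim: "((\<lambda>z. cmod (y powr (- of_real \<alpha>) - z powr (- of_real \<alpha>)) * (cmod z powr \<alpha> / c0 * norm (R y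
      g))) \<longlongrightarrow> 0) (at y)"
    by simp
  have "eventually (\<lambda>z. z \<in> slit) (at y)" by (rule eventually_at_in_open'[OF open_slit y])
  then have "eventually (\<lambda>z. norm (R z g - R y g)
      \<le> cmod (y powr (- of_real \<alpha>) - z powr (- of_real \<alpha>)) * (cmod z powr \<alpha> / c0 * norm (R y g))) (at y)"
  proof eventually_elim
    case (elim z)
    then have z0: "z \<noteq> 0" by auto
    show ?case
      unfolding resolvent_identity[OF g z0 y0] norm_cscale
      by (intro mult_left_mono R_bound R_in g y0 z0) auto
  qed
  from Lim_null_comparison[OF this lim] show ?thesis by (simp add: Lim_null[symmetric])
qed

lemma weakly_holomorphic_R:
  assumes g: "g \<in> H \<times> H"
  shows "weakly_holomorphic (\<lambda>z. R z g)"
  unfolding weakly_holomorphic_def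
proof (intro conjI allI)
  show "continuous_on slit (\<lambda>z. R z g)"
    using R_isCont[OF g] by (intro continuous_at_imp_continuous_on) (auto simp: isCont_def)
  fix w
  show "(\<lambda>z. cfun w (R z g)) holomorphic_on slit"
    unfolding holomorphic_on_open[OF open_slit]
  proof
    fix y assume y: "y \<in> slit"
    have y0: "y \<noteq> 0" using y by auto
    obtain D where D: "((\<lambda>z. z powr (- of_real \<alpha>)) has_field_derivative D) (at y)"
      using zeta_holomorphic y unfolding holomorphic_on_open[OF open_slit] by blast
    interpret cf: bounded_linear "cfun w" by (rule bounded_linear_cfun)
    \<comment> \<open>By the resolvent identity this is the difference quotient of \<open>R\<close>;
      the derivative is minus that of \<open>z powr - \<alpha>\<close> times the squared
      resolvent.\<close>
    have "((\<lambda>z. - ((z powr (- of_real \<alpha>) - y powr (- of_real \<alpha>)) / (z - y)) * cfun w (R z (R y g)))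
        \<longlongrightarrow> - D * cfun w (R y (R y g))) (at y)"
      using D unfolding has_field_derivative_iff
      by (intro tendsto_intros cf.tendsto R_isCont R_in g y0 y)
    moreover have "eventually (\<lambda>z. - ((z powr (- of_real \<alpha>) - y powr (- of_real \<alpha>)) / (z - y)) * cfun w (R z
        (R y g))
        = (cfun w (R z g) - cfun w (R y g)) / (z - y)) (at y)"
    proof -
      have "eventually (\<lambda>z. z \<in> slit) (at y)" by (rule eventually_at_in_open'[OF open_slit y])
      then show ?thesis
      proof eventually_elim
        case (elim z)
        then have z0: "z \<noteq> 0" by auto
        have "cfun w (R z g) - cfun w (R y g) = (y powr (- of_real \<alpha>) - z powr (- of_real \<alpha>)) * cfun w (R z
            (R y g))"
          unfolding cf.diff[symmetric] resolvent_identity[OF g z0 y0] cfun_cscale ..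
        then show ?case by (simp add: divide_simps) (simp add: algebra_simps)
      qed
    qed
    ultimately have "((\<lambda>z. cfun w (R z g)) has_field_derivative - D * cfun w (R y (R y g))) (at y)"
      unfolding has_field_derivative_iff by (rule Lim_transform_eventually)
    then show "\<exists>f'. ((\<lambda>z. cfun w (R z g)) has_field_derivative f') (at y)" by blast
  qed
qed

lemma K_resolvent:
  assumes "v \<in> H \<times> H" "z \<noteq> 0"
  shows "K z v = v - cscale (z powr (- of_real \<alpha>)) (R z v)"
  unfolding K_eq
proof (rule R_unique[OF _ assms(2)])
  show "v - cscale (z powr (- of_real \<alpha>)) (R z v) \<in> H \<times> H"
    by (intro subspace_diff[OF HH] cscale_in R_in assms)
  have "A z (v - cscale (z powr (- of_real \<alpha>)) (R z v)) = A z v - cscale (z powr (- of_real \<alpha>)) v"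
    by (simp add: A_diff A_cscale cscale_in R_in A_R assms)
  then show "A z (v - cscale (z powr (- of_real \<alpha>)) (R z v)) = map_prod S S v"
    by (simp add: A_def)
qed

lemma K_diff: "v \<in> H \<times> H \<Longrightarrow> v' \<in> H \<times> H \<Longrightarrow> z \<noteq> 0 \<Longrightarrow> K z (v - v') = K z v - K z v'"
  unfolding K_eq by (simp only: Sc_diff) (intro R_diff Sc_in)

lemma K_bound:
  assumes v: "v \<in> H \<times> H" and z: "z \<noteq> 0"
  shows "norm (K z v) \<le> (1 + 1 / c0) * norm v"
proof -
  have "norm (K z v) \<le> norm v + cmod z powr (- \<alpha>) * norm (R z v)"
    unfolding K_resolvent[OF v z]
    using norm_triangle_ineq4[of v "cscale (z powr (- of_real \<alpha>)) (R z v)"]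
        by (simp add: norm_cscale cmod_zeta[OF z])
  also have "\<dots> \<le> norm v + cmod z powr (- \<alpha>) * (cmod z powr \<alpha> / c0 * norm v)"
    by (intro add_left_mono mult_left_mono R_bound v z) auto
  also have "\<dots> = (1 + 1 / c0) * norm v"
    using z by (simp add: powr_minus field_simps)
  finally show ?thesis .
qed

lemma weakly_holomorphic_K:
  assumes v: "v \<in> H \<times> H"
  shows "weakly_holomorphic (\<lambda>z. K z v)"
  unfolding K_eq by (intro weakly_holomorphic_R Sc_in v)

end

locale psd_operator_pair =
  S1: psd_operator H S1 N1 \<alpha> + S2: psd_operator H S2 N2 \<alpha>
  for H :: "'h::{real_inner, banach} set" and S1 S2 :: "'h \<Rightarrow> 'h" and N1 N2 \<alpha> :: real +
  fixes \<epsilon> :: real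
  assumes close: "\<And>g. g \<in> H \<Longrightarrow> norm (S1 g - S2 g) \<le> \<epsilon> * norm g" and \<epsilon>: "0 \<le> \<epsilon>"
begin

text \<open>Regularity of \<open>v\<close> is known only with respect to the exact operator, so the
  bound must retain \<open>S2.R z v\<close>; from the resolvent of the approximation only the crude
  bound by \<open>S1.c0\<close> is used.\<close>

lemma K_difference:
  assumes v: "v \<in> H \<times> H" and z: "z \<noteq> 0"
  shows "norm (S1.K z v - S2.K z v) \<le> \<epsilon> / S1.c0 * norm (S2.R z v)"
proof -
  let ?w = "S2.R z v"
  have w: "?w \<in> H \<times> H" by (intro S2.R_in v z)
  define d where "d = map_prod S1 S1 ?w - map_prod S2 S2 ?w"
  have d_in: "d \<in> H \<times> H"
    unfolding d_def by (intro subspace_diff[OF S1.HH] S1.Sc_in S2.Sc_in w)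
  have d: "norm d \<le> \<epsilon> * norm ?w"
    using w norm_Pair_le[OF close close \<epsilon>] unfolding d_def by (cases ?w) auto
  have "d = S1.A z ?w - v"
    using S2.A_R[OF v z] by (simp add: d_def S1.A_def S2.A_def algebra_simps)
  then have "S1.R z d = S1.R z (S1.A z ?w) - S1.R z v"
    using S1.R_diff[OF S1.A_in[OF w] v z] by simp
  also have "S1.R z (S1.A z ?w) = ?w" by (intro S1.R_unique w z refl)
  finally have "S1.K z v - S2.K z v = cscale (z powr (- of_real \<alpha>)) (S1.R z d)"
    unfolding S1.K_resolvent[OF v z] S2.K_resolvent[OF v z] by (simp add: cscale.diff_right)
  then have "norm (S1.K z v - S2.K z v) \<le> cmod z powr (- \<alpha>) * (cmod z powr \<alpha> / S1.c0 * norm d)"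
    using S1.R_bound[OF d_in z] by (simp only: norm_cscale S1.cmod_zeta[OF z]) (intro mult_left_mono, auto)
  also have "\<dots> = norm d / S1.c0" using z by (simp add: powr_minus field_simps)
  also have "\<dots> \<le> \<epsilon> * norm ?w / S1.c0" using d S1.c0 by (intro divide_right_mono) auto
  finally show ?thesis by simp
qed

end

section \<open>Solution operators\<close>

text \<open>The convolution kernels are estimated for positive times only, so the end point
  \<open>s = t\<close> has to be exempt from the pointwise bound.\<close>

lemma norm_integral_bound_open:
  fixes f :: "real \<Rightarrow> 'a::banach"
  assumes f: "f integrable_on {c..d}" and g: "(g has_integral I) {c..d}"
    and le: "\<And>x. c < x \<Longrightarrow> x < d \<Longrightarrow> norm (f x) \<le> g x"
  shows "norm (integral {c..d} f) \<le> I"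
proof -
  have "norm (integral {c<..<d} f) \<le> integral {c<..<d} g"
    using f g le by (intro integral_norm_bound_integral) (auto simp: integrable_on_Icc_iff_Ioo[symmetric])
  then show ?thesis using integral_unique[OF g] by (simp only: integral_open_interval_real[symmetric])
qed

lemma norm_prefactor:
  fixes v :: "'h::real_inner \<times> 'h"
  shows "norm (cscale (1 / (2 * of_real pi * \<i>)) v) \<le> norm v"
proof -
  have "cmod (1 / (2 * of_real pi * \<i>)) = 1 / (2 * pi)" by (simp add: norm_divide norm_mult)
  also have "\<dots> \<le> 1" using pi_gt3 by simp
  finally have "cmod (1 / (2 * of_real pi * \<i>)) * norm v \<le> 1 * norm v"
    by (rule mult_right_mono) simp
  then show ?thesis unfolding norm_cscale by (simp only: mult_1)
qed

context hankel
begin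

lemma Gamma_integral_cong:
  assumes "\<And>z. z \<in> slit \<Longrightarrow> F z = G z"
  shows "Gamma_integral \<theta> \<delta> F = Gamma_integral \<theta> \<delta> G"
proof -
  have "integral {\<delta>..} (\<lambda>\<rho>. cscale (cis \<psi>) (F (of_real \<rho> * cis \<psi>)))
      = integral {\<delta>..} (\<lambda>\<rho>. cscale (cis \<psi>) (G (of_real \<rho> * cis \<psi>)))" if "\<bar>\<psi>\<bar> < pi" for \<psi>
    using that \<delta> by (intro integral_cong arg_cong[where f="cscale _"] assms polar_in_slit) auto
  moreover have "integral {-\<theta>..\<theta>} (\<lambda>\<psi>. cscale (\<i> * of_real \<delta> * cis \<psi>) (F (of_real \<delta> * cis \<psi>)))
      = integral {-\<theta>..\<theta>} (\<lambda>\<psi>. cscale (\<i> * of_real \<delta> * cis \<psi>) (G (of_real \<delta> * cis \<psi>)))"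
    using \<theta> \<delta> by (intro integral_cong arg_cong[where f="cscale _"] assms polar_in_slit) auto
  moreover have "\<bar>\<theta>\<bar> < pi" "\<bar>- \<theta>\<bar> < pi" using \<theta> \<theta>0 by auto
  ultimately show ?thesis unfolding Gamma_integral_def by (simp only:)
qed

lemma J_cong: "(\<And>z. z \<in> slit \<Longrightarrow> k z = l z) \<Longrightarrow> J k t = J l t"
  unfolding J_def by (rule Gamma_integral_cong) simp

end

locale scheme = hankel \<theta> \<delta> + psd_operator H S N \<alpha>
  for \<theta> \<delta> :: real and H :: "'h::{real_inner, banach} set" and S N \<alpha>
begin

abbreviation E where "E \<equiv> E_op H S \<alpha> \<theta> \<delta>"
abbreviation Eb where "Eb \<equiv> E_bar_op H S \<alpha> \<theta> \<delta>"

definition kE where "kE v z = cscale (inverse z) (K z v)"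
definition kB where "kB v z = cscale (z powr (- of_real \<alpha>)) (K z v)"

lemma E_eq: "E t v = cscale (1 / (2 * of_real pi * \<i>)) (J (kE v) t)"
  by (simp add: E_op_def J_def kE_def[abs_def] cscale_cscale)

lemma Eb_eq: "Eb t v = cscale (1 / (2 * of_real pi * \<i>)) (J (kB v) t)"
  by (simp add: E_bar_op_def J_def kB_def[abs_def] cscale_cscale)

lemma norm_E_diff: "norm (E t v - E s w) \<le> norm (J (kE v) t - J (kE w) s)"
  unfolding E_eq cscale.diff_right[symmetric] by (rule norm_prefactor)

lemma norm_Eb_diff: "norm (Eb t v - Eb s w) \<le> norm (J (kB v) t - J (kB w) s)"
  unfolding Eb_eq cscale.diff_right[symmetric] by (rule norm_prefactor)

lemma inverse_holomorphic_slit: "inverse holomorphic_on slit"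
  by (intro holomorphic_intros) auto

lemma wh_kE: "v \<in> H \<times> H \<Longrightarrow> weakly_holomorphic (kE v)"
  unfolding kE_def[abs_def] by (intro weakly_holomorphic_cscale weakly_holomorphic_K inverse_holomorphic_slit)

lemma wh_kB: "v \<in> H \<times> H \<Longrightarrow> weakly_holomorphic (kB v)"
  unfolding kB_def[abs_def] by (intro weakly_holomorphic_cscale weakly_holomorphic_K zeta_holomorphic)

definition CK where "CK = 1 + 1 / c0"

lemma CK: "0 \<le> CK" using c0 by (simp add: CK_def)

lemma growth_kE: "v \<in> H \<times> H \<Longrightarrow> growth 0 (CK * norm v) (kE v)"
  unfolding growth_def
proof
  fix z assume v: "v \<in> H \<times> H" and "z \<in> slit"
  then have z: "z \<noteq> 0" by auto
  have "norm (kE v z) \<le> inverse (cmod z) * (CK * norm v)"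
    unfolding kE_def norm_cscale norm_inverse CK_def by (intro mult_left_mono K_bound v z) auto
  then show "norm (kE v z) \<le> CK * norm v * cmod z powr (0 - 1)"
    using z by (simp add: powr_minus powr_one mult.commute)
qed

lemma growth_kB: "v \<in> H \<times> H \<Longrightarrow> growth (1 - \<alpha>) (CK * norm v) (kB v)"
  unfolding growth_def
proof
  fix z assume v: "v \<in> H \<times> H" and "z \<in> slit"
  then have z: "z \<noteq> 0" by auto
  have "norm (kB v z) \<le> cmod z powr (- \<alpha>) * (CK * norm v)"
    unfolding kB_def norm_cscale cmod_zeta[OF z] CK_def by (intro mult_left_mono K_bound v z) auto
  then show "norm (kB v z) \<le> CK * norm v * cmod z powr (1 - \<alpha> - 1)"
    by (simp add: mult.commute)
qed

text \<open>Bounds for the solution operator, the convolution kernel, and the time derivative of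
  that kernel. They depend on \<theta> and \<alpha> but not on \<open>S\<close> or \<open>N\<close>,
  so the two schemes of a pair share them.\<close>

definition cE where "cE = J_const 0 * CK"
definition cB where "cB = J_const (1 - \<alpha>) * CK"
definition cB' where "cB' = J_const (2 - \<alpha>) * CK"

lemma constants_nonneg: "0 \<le> cE" "0 \<le> cB" "0 \<le> cB'"
  by (simp_all add: cE_def cB_def cB'_def CK J_const_nonneg)

lemma E_bound:
  assumes "v \<in> H \<times> H" "t > 0"
  shows "norm (E t v) \<le> cE * norm v"
proof -
  have "norm (E t v) \<le> norm (J (kE v) t)" unfolding E_eq by (rule norm_prefactor)
  also have "\<dots> \<le> J_const 0 * (CK * norm v) * t powr (- 0)"
    by (intro J_bound wh_kE growth_kE assms)
  finally show ?thesis using assms(2) by (simp add: cE_def mult.assoc)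
qed

lemma Eb_bound:
  assumes "v \<in> H \<times> H" "t > 0"
  shows "norm (Eb t v) \<le> cB * norm v * t powr (\<alpha> - 1)"
proof -
  have "norm (Eb t v) \<le> norm (J (kB v) t)" unfolding Eb_eq by (rule norm_prefactor)
  also have "\<dots> \<le> J_const (1 - \<alpha>) * (CK * norm v) * t powr (- (1 - \<alpha>))"
    by (intro J_bound wh_kB growth_kB assms)
  finally show ?thesis by (simp add: cB_def mult.assoc)
qed

lemma Eb_diff:
  assumes v: "v \<in> H \<times> H" "w \<in> H \<times> H" and t: "t > 0"
  shows "Eb t v - Eb t w = Eb t (v - w)"
proof -
  have "J (kB (v - w)) t = J (\<lambda>z. kB v z - kB w z) t"
    by (intro J_cong) (simp add: kB_def K_diff[OF v slit_nonzero] cscale.diff_right)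
  also have "\<dots> = J (kB v) t - J (kB w) t"
    by (intro J_diff[OF wh_kB growth_kB wh_kB growth_kB] v t)
  finally show ?thesis unfolding Eb_eq by (simp add: cscale.diff_right)
qed

lemma J_kB_continuous: "v \<in> H \<times> H \<Longrightarrow> t > 0 \<Longrightarrow> isCont (J (kB v)) t"
  by (rule has_vector_derivative_continuous[OF J_has_vector_derivative[OF wh_kB growth_kB]])

text \<open>The derivative of the kernel is of order \<open>\<tau>^(\<alpha> - 2)\<close>. The bound
  is kept as a difference of powers so that it can later be integrated exactly in the time variable
  of the convolution.\<close>

lemma Eb_increment:
  assumes v: "v \<in> H \<times> H" and st: "0 < s" "s \<le> t"
  shows "norm (Eb t v - Eb s v) \<le> cB' * norm v * ((s powr (\<alpha> - 1) - t powr (\<alpha> - 1)) / (1 - \<alpha>))"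
proof -
  have w: "weakly_holomorphic (\<lambda>z. cscale z (kB v z))"
    by (intro weakly_holomorphic_cscale wh_kB v holomorphic_intros)
  have g: "growth (2 - \<alpha>) (CK * norm v) (\<lambda>z. cscale z (kB v z))"
    using growth_mult[OF growth_kB[OF v]] by simp
  have "norm (J (kB v) t - J (kB v) s) \<le> cB' * norm v * ((t powr (\<alpha> - 1) - s powr (\<alpha> - 1)) / (\<alpha> - 1))"
  proof (rule norm_increment_powr[OF st])
    fix \<tau> assume "s \<le> \<tau>" "\<tau> \<le> t"
    then have "\<tau> > 0" using st by simp
    then show "(J (kB v) has_vector_derivative J (\<lambda>z. cscale z (kB v z)) \<tau>) (at \<tau>)"
      by (intro J_has_vector_derivative[OF wh_kB growth_kB] v)
    show "norm (J (\<lambda>z. cscale z (kB v z)) \<tau>) \<le> cB' * norm v * \<tau> powr (\<alpha> - 1 - 1)"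
      using J_bound[OF w g \<open>\<tau> > 0\<close>] by (simp add: cB'_def mult.assoc)
  qed (use \<alpha> in simp)
  also have "(t powr (\<alpha> - 1) - s powr (\<alpha> - 1)) / (\<alpha> - 1) = (s powr (\<alpha> - 1) - t powr (\<alpha> - 1)) / (1 - \<alpha>)"
    using \<alpha> by (simp add: field_simps)
  finally show ?thesis using norm_Eb_diff order_trans by blast
qed

text \<open>The time derivative is the contour integral of \<open>K z v\<close>, whose size alone
  gives only \<open>1 / \<tau>\<close>. Subtracting the constant \<open>v\<close> changes nothing
  and leaves \<open>- z powr - \<alpha>\<close> times \<open>R z v\<close>, so \<open>reg\<close>
  improves the rate to the integrable \<open>\<tau>^(\<alpha> \<nu> - 1)\<close>.\<close>

lemma E_increment:
  assumes v: "v \<in> H \<times> H" and st: "0 < s" "s \<le> t" and \<nu>: "0 < \<nu>" "\<nu> \<le> 1"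
    and reg: "\<And>z. z \<in> slit \<Longrightarrow> norm (R z v) \<le> M * cmod z powr (\<alpha> * (1 - \<nu>))"
  shows "norm (E t v - E s v) \<le> J_const (1 - \<alpha> * \<nu>) * M * ((t - s) powr (\<alpha> * \<nu>) / (\<alpha> * \<nu>))"
proof -
  define q where "q = \<alpha> * \<nu>"
  have q: "0 < q" "q \<le> 1" using \<alpha> \<nu> mult_le_one[of \<alpha> \<nu>] by (auto simp: q_def)
  define k where "k z = K z v - v" for z
  have k: "weakly_holomorphic k"
    unfolding k_def[abs_def] by (intro weakly_holomorphic_diff weakly_holomorphic_K weakly_holomorphic_const v)
  have g: "growth (1 - q) M k"
    unfolding growth_def
  proof
    fix z assume z: "z \<in> slit"
    then have z0: "z \<noteq> 0" by auto
    have "norm (k z) = cmod z powr (- \<alpha>) * norm (R z v)"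
      by (simp add: k_def K_resolvent[OF v z0] norm_cscale cmod_zeta[OF z0])
    also have "\<dots> \<le> cmod z powr (- \<alpha>) * (M * cmod z powr (\<alpha> * (1 - \<nu>)))"
      by (intro mult_left_mono reg z) auto
    also have "\<dots> = M * (cmod z powr (- \<alpha>) * cmod z powr (\<alpha> * (1 - \<nu>)))" by simp
    also have "cmod z powr (- \<alpha>) * cmod z powr (\<alpha> * (1 - \<nu>)) = cmod z powr (1 - q - 1)"
      by (simp add: powr_add[symmetric] q_def algebra_simps)
    finally show "norm (k z) \<le> M * cmod z powr (1 - q - 1)" .
  qed
  have M: "0 \<le> M" by (rule growth_nonneg[OF g])
  have gK: "growth 1 (CK * norm v) (\<lambda>z. K z v)"
    using K_bound[OF v] by (auto simp: growth_def CK_def)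
  have gv: "growth 1 (norm v) (\<lambda>z. v)" by (auto simp: growth_def)
  have "norm (J (kE v) t - J (kE v) s) \<le> J_const (1 - q) * M * ((t powr q - s powr q) / q)"
  proof (rule norm_increment_powr[OF st])
    fix \<tau> assume "s \<le> \<tau>" "\<tau> \<le> t"
    then have \<tau>: "\<tau> > 0" using st by simp
    have "J (\<lambda>z. cscale z (kE v z)) \<tau> = J (\<lambda>z. K z v) \<tau>"
      by (intro J_cong) (simp only: kE_def cscale_cscale right_inverse[OF slit_nonzero] cscale_one)
    also have "\<dots> = J k \<tau>"
      unfolding k_def[abs_def]
      using J_diff[OF weakly_holomorphic_K[OF v] gK weakly_holomorphic_const gv \<tau>] J_const_function[OF \<tau>]
          by simp
    finally show "(J (kE v) has_vector_derivative J k \<tau>) (at \<tau>)"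
      using J_has_vector_derivative[OF wh_kE[OF v] growth_kE[OF v] \<tau>] by simp
    show "norm (J k \<tau>) \<le> J_const (1 - q) * M * \<tau> powr (q - 1)"
      using J_bound[OF k g \<tau>] by simp
  qed (use q in simp)
  also have "\<dots> \<le> J_const (1 - q) * M * ((t - s) powr q / q)"
    using q st M by (intro mult_left_mono divide_right_mono powr_diff_le) (auto simp: J_const_nonneg)
  finally show ?thesis unfolding q_def using norm_E_diff order_trans by blast
qed

text \<open>Two effects are separated: the change of \<open>g\<close>, controlled by the kernel
  bound, and the change of time for the fixed vector \<open>g x\<close>. The interval is half open
  because the kernel is singular at time zero.\<close>

lemma convolution_continuous:
  assumes g: "continuous_on {0..<t} g" and gH: "\<And>s. 0 \<le> s \<Longrightarrow> s < t \<Longrightarrow> g s \<in> H \<times> H"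
  shows "continuous_on {0..<t} (\<lambda>s. Eb (t - s) (g s))"
  unfolding continuous_on_def
proof
  fix x assume x: "x \<in> {0..<t}"
  let ?F = "at x within {0..<t}"
  have gx: "g x \<in> H \<times> H" and tx: "t - x > 0" using x gH by auto
  have c1: "((\<lambda>s. Eb (t - s) (g x)) \<longlongrightarrow> Eb (t - x) (g x)) ?F"
    unfolding Eb_eq
  proof (intro cscale.tendsto tendsto_const)
    show "((\<lambda>s. J (kB (g x)) (t - s)) \<longlongrightarrow> J (kB (g x)) (t - x)) ?F"
      by (rule isCont_tendsto_compose[OF J_kB_continuous[OF gx tx]]) (intro tendsto_intros)
  qed
  have ev: "eventually (\<lambda>s. s \<in> {0..<t}) ?F" by (simp add: eventually_at_filter)
  have "((\<lambda>s. Eb (t - s) (g s) - Eb (t - s) (g x)) \<longlongrightarrow> 0) ?F"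
  proof (rule Lim_null_comparison)
    show "eventually (\<lambda>s. norm (Eb (t - s) (g s) - Eb (t - s) (g x))
        \<le> cB * norm (g s - g x) * (t - s) powr (\<alpha> - 1)) ?F"
      using ev
    proof eventually_elim
      case (elim s)
      then have "g s \<in> H \<times> H" "t - s > 0" using gH by auto
      then show ?case by (simp only: Eb_diff[OF _ gx]) (intro Eb_bound subspace_diff[OF HH] gx)
    qed
    have "((\<lambda>s. cB * norm (g s - g x) * (t - s) powr (\<alpha> - 1)) \<longlongrightarrow> cB * norm (g x - g x) * (t - x) powr (\<alpha> -
        1)) ?F"
      using g x tx by (intro tendsto_intros) (auto simp: continuous_on_def)
    then show "((\<lambda>s. cB * norm (g s - g x) * (t - s) powr (\<alpha> - 1)) \<longlongrightarrow> 0) ?F" by simp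
  qed
  from tendsto_add[OF this c1] show "((\<lambda>s. Eb (t - s) (g s)) \<longlongrightarrow> Eb (t - x) (g x)) ?F" by simp
qed

lemma convolution_integrable:
  assumes t: "0 \<le> t" and g: "continuous_on {0..t} g" and gH: "\<And>s. s \<in> {0..t} \<Longrightarrow> g s \<in> H \<times> H"
  shows "(\<lambda>s. Eb (t - s) (g s)) integrable_on {0..t}"
proof -
  obtain G where "\<forall>s\<in>{0..t}. norm (g s) \<le> G"
    using compact_imp_bounded[OF compact_continuous_image[OF g compact_Icc]] by (auto simp: bounded_iff)
  then have G: "norm (g s) \<le> G" if "s \<in> {0..t}" for s using that by blast
  show ?thesis
  proof (rule convolution_integral(1)[OF \<alpha>(1) t convolution_continuous])
    show "continuous_on {0..<t} g" by (rule continuous_on_subset[OF g]) auto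
    fix s assume s: "0 \<le> s" "s < t"
    then show "g s \<in> H \<times> H" by (intro gH) auto
    have "norm (Eb (t - s) (g s)) \<le> cB * norm (g s) * (t - s) powr (\<alpha> - 1)" using s by (intro Eb_bound gH) auto
    also have "\<dots> \<le> cB * G * (t - s) powr (\<alpha> - 1)"
      using s constants_nonneg by (intro mult_right_mono mult_left_mono G) auto
    finally show "norm (Eb (t - s) (g s)) \<le> cB * G * (t - s) powr (\<alpha> - 1)" .
  qed
qed

end

section \<open>Regularity of solutions\<close>

lemma weighted_integrable:
  fixes \<phi> :: "real \<Rightarrow> real"
  assumes "0 < \<alpha>" "0 \<le> t" and c: "continuous_on {0..t} \<phi>"
  shows "(\<lambda>s. (t - s) powr (\<alpha> - 1) * \<phi> s) integrable_on {0..t}"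
proof -
  obtain M where "\<forall>s\<in>{0..t}. norm (\<phi> s) \<le> M"
    using compact_imp_bounded[OF compact_continuous_image[OF c compact_Icc]] by (auto simp: bounded_iff)
  then have M: "norm (\<phi> s) \<le> M" if "s \<in> {0..t}" for s using that by blast
  show ?thesis
  proof (rule convolution_integral(1)[OF assms(1,2), where M=M])
    show "continuous_on {0..<t} (\<lambda>s. (t - s) powr (\<alpha> - 1) * \<phi> s)"
      by (intro continuous_intros continuous_on_subset[OF c]) auto
    show "norm ((t - s) powr (\<alpha> - 1) * \<phi> s) \<le> M * (t - s) powr (\<alpha> - 1)" if "0 \<le> s" "s < t" for s
      using M[of s] that by (auto simp: abs_mult mult.commute intro!: mult_left_mono)
  qed
qed

text \<open>The integral equation holds for positive times only; continuity carries bounds derived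
  from it to \<open>t = 0\<close>.\<close>

lemma bound_at_zero:
  fixes \<phi> :: "real \<Rightarrow> real"
  assumes c: "continuous_on {0..T} \<phi>" and T: "0 < T" and le: "\<And>t. 0 < t \<Longrightarrow> t \<le> T \<Longrightarrow> \<phi> t \<le> C"
    and t: "t \<in> {0..T}"
  shows "\<phi> t \<le> C"
proof (cases "t = 0")
  case True
  have "(\<phi> \<longlongrightarrow> \<phi> 0) (at 0 within {0..T})" using c T by (auto simp: continuous_on_def)
  then have "(\<phi> \<longlongrightarrow> \<phi> 0) (at_right 0)" using T by (simp add: at_within_Icc_at_right)
  moreover have "eventually (\<lambda>t. \<phi> t \<le> C) (at_right 0)"
    using T le by (auto simp: eventually_at_right_field intro!: exI[of _ T])
  ultimately have "\<phi> 0 \<le> C" by (rule tendsto_upperbound) simp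
  then show ?thesis using True by simp
qed (use t le in auto)

text \<open>All that the error analysis uses of the nonlinearity. Lipschitz dependence on time is
  included because the source term has to be Hoelder continuous along the solution.\<close>

definition lipschitz_nonlinearity :: "'h::real_normed_vector set \<Rightarrow> real \<Rightarrow> real \<Rightarrow> real \<Rightarrow> (real \<Rightarrow> 'h \<Rightarrow> 'h) \<Rightarrow>
    bool" where
  "lipschitz_nonlinearity H T \<Lambda> \<rho> F \<longleftrightarrow> (\<forall>s\<in>{0..T}. \<forall>w\<in>H. F s w \<in> H) \<and>
    (\<forall>s\<in>{0..T}. \<forall>s'\<in>{0..T}. \<forall>w\<in>H. \<forall>w'\<in>H. norm (F s w - F s' w') \<le> \<Lambda> * (\<bar>s - s'\<bar> + norm (w - w'))) \<and>
    (\<forall>s\<in>{0..T}. norm (F s 0) \<le> \<rho>)"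

locale solution = scheme \<theta> \<delta> H S N \<alpha>
  for \<theta> \<delta> :: real and H :: "'h::{real_inner, banach} set" and S N \<alpha> +
  fixes T \<Lambda> \<rho> :: real and F :: "real \<Rightarrow> 'h \<Rightarrow> 'h" and u0 :: 'h and u :: "real \<Rightarrow> 'h"
  assumes T: "0 < T" and \<Lambda>: "0 \<le> \<Lambda>" and \<rho>: "0 \<le> \<rho>"
    and F: "lipschitz_nonlinearity H T \<Lambda> \<rho> F" and u0: "u0 \<in> H"
    and sol: "is_solution H S \<alpha> \<theta> \<delta> F T u0 u"
begin

lemma F_in: "s \<in> {0..T} \<Longrightarrow> w \<in> H \<Longrightarrow> F s w \<in> H"
  and F_lipschitz: "s \<in> {0..T} \<Longrightarrow> s' \<in> {0..T} \<Longrightarrow> w \<in> H \<Longrightarrow> w' \<in> H \<Longrightarrow>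
    norm (F s w - F s' w') \<le> \<Lambda> * (\<bar>s - s'\<bar> + norm (w - w'))"
  and F_zero: "s \<in> {0..T} \<Longrightarrow> norm (F s 0) \<le> \<rho>"
  using F by (auto simp: lipschitz_nonlinearity_def)

lemma u_continuous: "continuous_on {0..T} u" and u_in: "t \<in> {0..T} \<Longrightarrow> u t \<in> H"
  using sol by (auto simp: is_solution_def)

definition g where "g s = (F s (u s), 0 :: 'h)"

lemma zero_in: "0 \<in> H" using H(1) by (rule subspace_0)

lemma g_in: "s \<in> {0..T} \<Longrightarrow> g s \<in> H \<times> H"
  by (simp add: g_def F_in u_in zero_in)

lemma g_norm: "s \<in> {0..T} \<Longrightarrow> norm (g s) \<le> \<rho> + \<Lambda> * norm (u s)"
  using F_lipschitz[of s s "u s" 0] F_zero[of s] u_in[of s] zero_in norm_triangle_sub[of "F s (u s)" "F s 0"]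
  by (simp add: g_def)

lemma g_diff: "s \<in> {0..T} \<Longrightarrow> t \<in> {0..T} \<Longrightarrow> norm (g t - g s) \<le> \<Lambda> * (\<bar>t - s\<bar> + norm (u t - u s))"
  using F_lipschitz[of t s "u t" "u s"] u_in by (simp add: g_def)

lemma g_continuous: "continuous_on {0..T} g"
  unfolding continuous_on_def
proof
  fix x assume x: "x \<in> {0..T}"
  show "(g \<longlongrightarrow> g x) (at x within {0..T})"
  proof (rule Lim_null[THEN iffD2, OF Lim_null_comparison])
    have "eventually (\<lambda>t. t \<in> {0..T}) (at x within {0..T})" by (simp add: eventually_at_filter)
    then show "eventually (\<lambda>t. norm (g t - g x) \<le> \<Lambda> * (\<bar>t - x\<bar> + norm (u t - u x))) (at x within {0..T})"
      by eventually_elim (rule g_diff[OF x])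
    have "((\<lambda>t. \<Lambda> * (\<bar>t - x\<bar> + norm (u t - u x))) \<longlongrightarrow> \<Lambda> * (\<bar>x - x\<bar> + norm (u x - u x))) (at x within {0..T})"
      using u_continuous x by (intro tendsto_intros) (auto simp: continuous_on_def)
    then show "((\<lambda>t. \<Lambda> * (\<bar>t - x\<bar> + norm (u t - u x))) \<longlongrightarrow> 0) (at x within {0..T})" by simp
  qed
qed

lemma g_continuous_sub: "t \<le> T \<Longrightarrow> continuous_on {0..t} g"
  by (rule continuous_on_subset[OF g_continuous]) auto

lemma conv_integrable: "0 \<le> t \<Longrightarrow> t \<le> T \<Longrightarrow> (\<lambda>s. Eb (t - s) (g s)) integrable_on {0..t}"
  by (intro convolution_integrable g_continuous_sub g_in) auto

lemma u_eq: "t \<in> {0<..T} \<Longrightarrow> (u t, 0) = E t (u0, 0) + integral {0..t} (\<lambda>s. Eb (t - s) (g s))"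
  using sol by (auto simp: is_solution_def g_def)

lemma u0_in: "(u0, 0) \<in> H \<times> H" using u0 zero_in by auto

text \<open>The factor \<open>t powr (- 0)\<close> puts the inequality into the shape of
  \<open>gronwall_constant\<close> with \<open>\<beta> = 0\<close>.\<close>

lemma u_volterra:
  assumes t: "t \<in> {0<..T}"
  shows "norm (u t) \<le> (cE * norm u0 + cB * \<rho> * (T powr \<alpha> / \<alpha>)) * t powr (- 0) +
    cB * \<Lambda> * integral {0..t} (\<lambda>s. (t - s) powr (\<alpha> - 1) * norm (u s))"
proof -
  have t0: "0 < t" "t \<le> T" using t by auto
  have uc: "continuous_on {0..t} (\<lambda>s. norm (u s))"
    using t0 by (intro continuous_intros continuous_on_subset[OF u_continuous]) auto
  have hi: "((\<lambda>s. cB * \<rho> * (t - s) powr (\<alpha> - 1) + cB * \<Lambda> * ((t - s) powr (\<alpha> - 1) * norm (u s)))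
    has_integral cB * \<rho> * (((t - 0) powr \<alpha> - (t - t) powr \<alpha>) / \<alpha>) + cB * \<Lambda> * integral {0..t} (\<lambda>s. (t - s)
        powr (\<alpha> - 1) * norm (u s))) {0..t}"
    using t0 \<alpha> by (intro has_integral_add has_integral_mult_right[OF has_integral_powr_diff]
      has_integral_mult_right[OF integrable_integral] weighted_integrable uc) auto
  have "norm (integral {0..t} (\<lambda>s. Eb (t - s) (g s)))
      \<le> cB * \<rho> * (((t - 0) powr \<alpha> - (t - t) powr \<alpha>) / \<alpha>) + cB * \<Lambda> * integral {0..t} (\<lambda>s. (t - s) powr (\<alpha> -
          1) * norm (u s))"
  proof (rule norm_integral_bound_open[OF conv_integrable hi])
    fix s assume s: "0 < s" "s < t"
    have "norm (Eb (t - s) (g s)) \<le> cB * norm (g s) * (t - s) powr (\<alpha> - 1)"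
      using s t0 by (intro Eb_bound g_in) auto
    also have "\<dots> \<le> cB * (\<rho> + \<Lambda> * norm (u s)) * (t - s) powr (\<alpha> - 1)"
      using s t0 constants_nonneg by (intro mult_right_mono mult_left_mono g_norm) auto
    finally show "norm (Eb (t - s) (g s)) \<le> cB * \<rho> * (t - s) powr (\<alpha> - 1) + cB * \<Lambda> * ((t - s) powr (\<alpha> - 1) *
        norm (u s))"
      by (simp add: algebra_simps)
  qed (use t0 in auto)
  also have "cB * \<rho> * (((t - 0) powr \<alpha> - (t - t) powr \<alpha>) / \<alpha>) \<le> cB * \<rho> * (T powr \<alpha> / \<alpha>)"
    using t0 \<alpha> constants_nonneg \<rho> by (intro mult_left_mono divide_right_mono) (auto intro!: powr_mono2)
  finally have "norm (integral {0..t} (\<lambda>s. Eb (t - s) (g s))) \<le> cB * \<rho> * (T powr \<alpha> / \<alpha>)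
      + cB * \<Lambda> * integral {0..t} (\<lambda>s. (t - s) powr (\<alpha> - 1) * norm (u s))"
    by simp
  moreover have "norm (E t (u0, 0)) \<le> cE * norm u0" using E_bound[OF u0_in t0(1)] by simp
  moreover have "norm (u t) \<le> norm (E t (u0, 0)) + norm (integral {0..t} (\<lambda>s. Eb (t - s) (g s)))"
    using norm_triangle_ineq[of "E t (u0, 0)" "integral {0..t} (\<lambda>s. Eb (t - s) (g s))"] u_eq[OF t,
        symmetric] by simp
  ultimately show ?thesis using t0 by simp
qed

lemma u_bound:
  assumes c: "gronwall_constant \<alpha> 0 T (cB * \<Lambda>) c" and t: "t \<in> {0..T}"
  shows "norm (u t) \<le> c * (cE * norm u0 + cB * \<rho> * (T powr \<alpha> / \<alpha>))"
proof (rule bound_at_zero[OF _ T _ t])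
  show uc: "continuous_on {0..T} (\<lambda>t. norm (u t))" by (intro continuous_intros u_continuous)
  fix t assume t: "0 < t" "t \<le> T"
  have "norm (u t) \<le> c * (cE * norm u0 + cB * \<rho> * (T powr \<alpha> / \<alpha>)) * t powr (- 0)"
    using c[unfolded gronwall_constant_def, THEN conjunct2, rule_format, OF _ uc _ u_volterra, of t]
      constants_nonneg \<rho> \<alpha> t by (auto intro!: add_nonneg_nonneg mult_nonneg_nonneg)
  then show "norm (u t) \<le> c * (cE * norm u0 + cB * \<rho> * (T powr \<alpha> / \<alpha>))" using t by simp
qed

text \<open>The homogeneous part limits the exponent to \<open>\<alpha> \<nu>\<close>. The
  convolution part, split into the increment of the kernel on \<open>[0, s]\<close> and the new
  piece on \<open>[s, t]\<close>, is Hoelder continuous with the better exponent \<alpha>.\<close>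

lemma u_hoelder:
  assumes \<nu>: "0 < \<nu>" "\<nu> \<le> 1"
    and reg: "\<And>z. z \<in> slit \<Longrightarrow> norm (R z (u0, 0)) \<le> M * cmod z powr (\<alpha> * (1 - \<nu>))"
    and G: "\<And>s. s \<in> {0..T} \<Longrightarrow> norm (g s) \<le> G"
    and st: "0 < s" "s \<le> t" "t \<le> T"
  shows "norm (u t - u s) \<le> (J_const (1 - \<alpha> * \<nu>) * M / (\<alpha> * \<nu>) +
    (cB * G / \<alpha> + cB' * G / ((1 - \<alpha>) * \<alpha>)) * T powr (\<alpha> * (1 - \<nu>))) * (t - s) powr (\<alpha> * \<nu>)"
proof -
  let ?c = "\<lambda>t s. Eb (t - s) (g s)"
  have G0: "0 \<le> G" using G[of s] st order_trans[OF norm_ge_zero] by force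
  have it: "?c t integrable_on {0..t}" and iss: "?c s integrable_on {0..s}"
    using st by (auto intro!: conv_integrable)
  have its: "?c t integrable_on {0..s}" "?c t integrable_on {s..t}"
    using st by (auto intro!: integrable_on_subinterval[OF it])
  have split: "integral {0..t} (?c t) - integral {0..s} (?c s) = integral {0..s} (\<lambda>\<sigma>. ?c t \<sigma> - ?c s \<sigma>)
      + integral {s..t} (?c t)"
    using Henstock_Kurzweil_Integration.integral_combine[OF _ st(2) it] st
        by (simp add: integral_diff[OF its(1) iss])
  have 2: "norm (integral {s..t} (?c t)) \<le> cB * G * (((t - s) powr \<alpha> - (t - t) powr \<alpha>) / \<alpha>)"
  proof (rule norm_integral_bound_open[OF its(2)])
    show "((\<lambda>\<sigma>. cB * G * (t - \<sigma>) powr (\<alpha> - 1)) has_integral cB * G * (((t - s) powr \<alpha> - (t - t) powr \<alpha>) /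
        \<alpha>)) {s..t}"
      using st \<alpha> by (intro has_integral_mult_right has_integral_powr_diff) auto
    fix \<sigma> assume \<sigma>: "s < \<sigma>" "\<sigma> < t"
    have "norm (?c t \<sigma>) \<le> cB * norm (g \<sigma>) * (t - \<sigma>) powr (\<alpha> - 1)" using \<sigma> st by (intro Eb_bound g_in) auto
    also have "\<dots> \<le> cB * G * (t - \<sigma>) powr (\<alpha> - 1)"
      using \<sigma> st constants_nonneg by (intro mult_right_mono mult_left_mono G) auto
    finally show "norm (?c t \<sigma>) \<le> cB * G * (t - \<sigma>) powr (\<alpha> - 1)" .
  qed
  have 1: "norm (integral {0..s} (\<lambda>\<sigma>. ?c t \<sigma> - ?c s \<sigma>)) \<le>
      cB' * G / (1 - \<alpha>) * (((s - 0) powr \<alpha> - (s - s) powr \<alpha>) / \<alpha> - ((t - 0) powr \<alpha> - (t - s) powr \<alpha>) / \<alpha>)"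
  proof (rule norm_integral_bound_open[OF integrable_diff[OF its(1) iss]])
    show "((\<lambda>\<sigma>. cB' * G / (1 - \<alpha>) * ((s - \<sigma>) powr (\<alpha> - 1) - (t - \<sigma>) powr (\<alpha> - 1))) has_integral
      cB' * G / (1 - \<alpha>) * (((s - 0) powr \<alpha> - (s - s) powr \<alpha>) / \<alpha> - ((t - 0) powr \<alpha> - (t - s) powr \<alpha>) / \<alpha>))
          {0..s}"
      using st \<alpha> by (intro has_integral_mult_right has_integral_diff has_integral_powr_diff) auto
    fix \<sigma> assume \<sigma>: "0 < \<sigma>" "\<sigma> < s"
    have "norm (?c t \<sigma> - ?c s \<sigma>) \<le> cB' * norm (g \<sigma>) * (((s - \<sigma>) powr (\<alpha> - 1) - (t - \<sigma>) powr (\<alpha> - 1)) / (1 - \<alpha>))"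
      using \<sigma> st by (intro Eb_increment g_in) auto
    also have "\<dots> \<le> cB' * G * (((s - \<sigma>) powr (\<alpha> - 1) - (t - \<sigma>) powr (\<alpha> - 1)) / (1 - \<alpha>))"
    proof (intro mult_right_mono mult_left_mono G)
      have "(t - \<sigma>) powr (\<alpha> - 1) \<le> (s - \<sigma>) powr (\<alpha> - 1)" using \<sigma> st \<alpha> by (intro powr_mono2') auto
      then show "0 \<le> ((s - \<sigma>) powr (\<alpha> - 1) - (t - \<sigma>) powr (\<alpha> - 1)) / (1 - \<alpha>)" using \<alpha> by simp
    qed (use \<sigma> st constants_nonneg in auto)
    finally show "norm (?c t \<sigma> - ?c s \<sigma>) \<le> cB' * G / (1 - \<alpha>) * ((s - \<sigma>) powr (\<alpha> - 1) - (t - \<sigma>) powr (\<alpha> -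
        1))" by simp
  qed
  \<comment> \<open>The increments of the kernel integrate to
    \<open>s^\<alpha> - t^\<alpha> + (t - s)^\<alpha>\<close> up to a factor, and the first two
    terms together are not positive.\<close>
  also have "\<dots> \<le> cB' * G / (1 - \<alpha>) * ((t - s) powr \<alpha> / \<alpha>)"
  proof (intro mult_left_mono)
    have "s powr \<alpha> \<le> t powr \<alpha>" using st \<alpha> by (intro powr_mono2) auto
    then show "((s - 0) powr \<alpha> - (s - s) powr \<alpha>) / \<alpha> - ((t - 0) powr \<alpha> - (t - s) powr \<alpha>) / \<alpha>
        \<le> (t - s) powr \<alpha> / \<alpha>"
      using \<alpha> unfolding diff_divide_distrib[symmetric] by (intro divide_right_mono) auto
  qed (use constants_nonneg G0 \<alpha> in auto)
  finally have 1: "norm (integral {0..s} (\<lambda>\<sigma>. ?c t \<sigma> - ?c s \<sigma>)) \<le> cB' * G / ((1 - \<alpha>) * \<alpha>) * (t - s) powr \<alpha>"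
      by simp
  have 2: "norm (integral {s..t} (?c t)) \<le> cB * G / \<alpha> * (t - s) powr \<alpha>" using 2 \<alpha> by simp
  have 3: "norm (E t (u0, 0) - E s (u0, 0)) \<le> J_const (1 - \<alpha> * \<nu>) * M / (\<alpha> * \<nu>) * (t - s) powr (\<alpha> * \<nu>)"
    using E_increment[OF u0_in st(1,2) \<nu> reg] by simp
  \<comment> \<open>Brings the better exponent of the convolution down to
    \<open>\<alpha> \<nu>\<close>, using that increments of time do not exceed
    \<open>T\<close>.\<close>
  have pw: "(t - s) powr \<alpha> \<le> T powr (\<alpha> * (1 - \<nu>)) * (t - s) powr (\<alpha> * \<nu>)"
  proof -
    have "(t - s) powr \<alpha> = (t - s) powr (\<alpha> * (1 - \<nu>)) * (t - s) powr (\<alpha> * \<nu>)"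
      by (simp add: powr_add[symmetric] algebra_simps)
    also have "\<dots> \<le> T powr (\<alpha> * (1 - \<nu>)) * (t - s) powr (\<alpha> * \<nu>)"
      using st \<alpha> \<nu> by (intro mult_right_mono powr_mono2) auto
    finally show ?thesis .
  qed
  have ut: "(u t, 0) = E t (u0, 0) + integral {0..t} (?c t)" and us: "(u s, 0)
      = E s (u0, 0) + integral {0..s} (?c s)"
    using st by (auto intro!: u_eq)
  have "norm (u t - u s) = norm ((u t, 0 :: 'h) - (u s, 0))" by simp
  also have "(u t, 0) - (u s, 0) = (E t (u0, 0) - E s (u0, 0)) + (integral {0..s} (\<lambda>\<sigma>. ?c t \<sigma> - ?c s \<sigma>)
      + integral {s..t} (?c t))"
    unfolding ut us split[symmetric] by simp
  also have "norm \<dots> \<le> norm (E t (u0, 0) - E s (u0, 0)) + (norm (integral {0..s} (\<lambda>\<sigma>. ?c t \<sigma> - ?c s \<sigma>))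
      + norm (integral {s..t} (?c t)))"
    by (intro order_trans[OF norm_triangle_ineq] add_left_mono norm_triangle_ineq)
  also have "\<dots> \<le> J_const (1 - \<alpha> * \<nu>) * M / (\<alpha> * \<nu>) * (t - s) powr (\<alpha> * \<nu>)
      + (cB' * G / ((1 - \<alpha>) * \<alpha>) * (t - s) powr \<alpha> + cB * G / \<alpha> * (t - s) powr \<alpha>)"
    by (intro add_mono 1 2 3)
  also have "\<dots> = J_const (1 - \<alpha> * \<nu>) * M / (\<alpha> * \<nu>) * (t - s) powr (\<alpha> * \<nu>)
      + (cB * G / \<alpha> + cB' * G / ((1 - \<alpha>) * \<alpha>)) * (t - s) powr \<alpha>" by (simp add: algebra_simps)
  also have "\<dots> \<le> J_const (1 - \<alpha> * \<nu>) * M / (\<alpha> * \<nu>) * (t - s) powr (\<alpha> * \<nu>)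
      + (cB * G / \<alpha> + cB' * G / ((1 - \<alpha>) * \<alpha>)) * (T powr (\<alpha> * (1 - \<nu>)) * (t - s) powr (\<alpha> * \<nu>))"
    using constants_nonneg G0 \<alpha> by (intro add_left_mono mult_left_mono pw) (auto intro!: add_nonneg_nonneg
        divide_nonneg_nonneg mult_nonneg_nonneg)
  finally show ?thesis by (simp add: algebra_simps)
qed

text \<open>The explicit time dependence of the nonlinearity contributes \<open>|t - s|\<close>,
  which the bounded time interval turns into a multiple of
  \<open>(t - s)^(\<alpha> \<nu>)\<close>.\<close>

lemma g_hoelder:
  assumes \<nu>: "0 < \<nu>" "\<nu> \<le> 1" and st: "0 < s" "s \<le> t" "t \<le> T"
    and C: "norm (u t - u s) \<le> C * (t - s) powr (\<alpha> * \<nu>)"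
  shows "norm (g t - g s) \<le> \<Lambda> * (T powr (1 - \<alpha> * \<nu>) + C) * (t - s) powr (\<alpha> * \<nu>)"
proof -
  have q: "\<alpha> * \<nu> \<le> 1" using \<alpha> \<nu> by (simp add: mult_le_one)
  have "norm (g t - g s) \<le> \<Lambda> * (\<bar>t - s\<bar> + norm (u t - u s))" using st by (intro g_diff) auto
  also have "\<dots> \<le> \<Lambda> * (T powr (1 - \<alpha> * \<nu>) * (t - s) powr (\<alpha> * \<nu>) + C * (t - s) powr (\<alpha> * \<nu>))"
  proof (intro mult_left_mono add_mono C \<Lambda>)
    have "\<bar>t - s\<bar> = (t - s) powr (1 - \<alpha> * \<nu>) * (t - s) powr (\<alpha> * \<nu>)"
      using st by (simp add: powr_add[symmetric])
    also have "\<dots> \<le> T powr (1 - \<alpha> * \<nu>) * (t - s) powr (\<alpha> * \<nu>)"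
      using st q by (intro mult_right_mono powr_mono2) auto
    finally show "\<bar>t - s\<bar> \<le> T powr (1 - \<alpha> * \<nu>) * (t - s) powr (\<alpha> * \<nu>)" .
  qed
  finally show ?thesis by (simp add: algebra_simps)
qed

end

section \<open>Comparison of two schemes\<close>

locale scheme_pair =
  A1: scheme \<theta> \<delta> H S1 N1 \<alpha> + A2: scheme \<theta> \<delta> H S2 N2 \<alpha> + psd_operator_pair H S1 S2 N1 N2 \<alpha> \<epsilon>
  for \<theta> \<delta> :: real and H :: "'h::{real_inner, banach} set" and S1 S2 N1 N2 \<alpha> \<epsilon>
begin

text \<open>One factor \<open>1 / c0\<close> for each of the two resolvents in the kernel
  difference.\<close>

definition B0 where "B0 = 1 / (A1.c0 * A1.c0)"

lemma B0: "0 \<le> B0" by (simp add: B0_def)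

text \<open>The factor \<open>z powr - \<alpha>\<close> exactly cancels the growth of the remaining
  resolvent, so the difference is merely bounded in \<open>z\<close>. This is the borderline case:
  the resulting \<open>1 / t\<close> just fails to be integrable.\<close>

lemma kB_difference:
  assumes v: "v \<in> H \<times> H"
  shows "weakly_holomorphic (\<lambda>z. A1.kB v z - A2.kB v z)"
    and "growth 1 (B0 * \<epsilon> * norm v) (\<lambda>z. A1.kB v z - A2.kB v z)"
proof -
  show "weakly_holomorphic (\<lambda>z. A1.kB v z - A2.kB v z)"
    by (intro weakly_holomorphic_diff A1.wh_kB A2.wh_kB v)
  show "growth 1 (B0 * \<epsilon> * norm v) (\<lambda>z. A1.kB v z - A2.kB v z)"
    unfolding growth_def
  proof
    fix z assume "z \<in> slit"
    then have z: "z \<noteq> 0" by auto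
    have "norm (A1.kB v z - A2.kB v z) = cmod z powr (- \<alpha>) * norm (A1.K z v - A2.K z v)"
      by (simp only: A1.kB_def A2.kB_def cscale.diff_right[symmetric] norm_cscale A1.cmod_zeta[OF z])
    also have "\<dots> \<le> cmod z powr (- \<alpha>) * (\<epsilon> / A1.c0 * (cmod z powr \<alpha> / A1.c0 * norm v))"
      using \<epsilon> A1.c0 by (intro mult_left_mono order_trans[OF K_difference[OF v z]] A2.R_bound v z) auto
    also have "\<dots> = B0 * \<epsilon> * norm v * cmod z powr (1 - 1)"
      using z by (simp add: B0_def powr_minus field_simps)
    finally show "norm (A1.kB v z - A2.kB v z) \<le> B0 * \<epsilon> * norm v * cmod z powr (1 - 1)" .
  qed
qed

lemma Eb_difference_eq:
  assumes v: "v \<in> H \<times> H" and t: "t > 0"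
  shows "A1.Eb t v - A2.Eb t v = cscale (1 / (2 * of_real pi * \<i>)) (A1.J (\<lambda>z. A1.kB v z - A2.kB v z) t)"
  unfolding A1.Eb_eq A2.Eb_eq cscale.diff_right[symmetric]
  by (simp only: A1.J_diff[OF A1.wh_kB[OF v] A1.growth_kB[OF v] A2.wh_kB[OF v] A2.growth_kB[OF v] t])

lemma Eb_difference:
  assumes v: "v \<in> H \<times> H" and t: "t > 0"
  shows "norm (A1.Eb t v - A2.Eb t v) \<le> A1.J_const 1 * B0 * \<epsilon> * norm v * t powr (- 1)"
  unfolding Eb_difference_eq[OF v t]
  using order_trans[OF norm_prefactor A1.J_bound[OF kB_difference[OF v] t]] by (simp add: mult.assoc)

lemma E_difference:
  assumes v: "v \<in> H \<times> H" and t: "t > 0"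
    and reg: "\<And>z. z \<in> slit \<Longrightarrow> norm (A2.R z v) \<le> M * cmod z powr (\<alpha> * (1 - \<nu>))"
  shows "norm (A1.E t v - A2.E t v) \<le> A1.J_const (\<alpha> * (1 - \<nu>)) * (\<epsilon> / A1.c0 * M) * t powr (- (\<alpha> * (1 - \<nu>)))"
proof -
  let ?k = "\<lambda>z. A1.kE v z - A2.kE v z"
  have w: "weakly_holomorphic ?k" by (intro weakly_holomorphic_diff A1.wh_kE A2.wh_kE v)
  have g: "growth (\<alpha> * (1 - \<nu>)) (\<epsilon> / A1.c0 * M) ?k"
    unfolding growth_def
  proof
    fix z assume z: "z \<in> slit"
    then have z0: "z \<noteq> 0" by auto
    have "norm (?k z) = inverse (cmod z) * norm (A1.K z v - A2.K z v)"
      by (simp only: A1.kE_def A2.kE_def cscale.diff_right[symmetric] norm_cscale norm_inverse)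
    also have "\<dots> \<le> inverse (cmod z) * (\<epsilon> / A1.c0 * (M * cmod z powr (\<alpha> * (1 - \<nu>))))"
      using \<epsilon> A1.c0 by (intro mult_left_mono order_trans[OF K_difference[OF v z0]] reg z) auto
    also have "\<dots> = \<epsilon> / A1.c0 * M * (cmod z powr (\<alpha> * (1 - \<nu>)) / cmod z)"
      by (simp add: divide_inverse mult_ac)
    also have "cmod z powr (\<alpha> * (1 - \<nu>)) / cmod z = cmod z powr (\<alpha> * (1 - \<nu>) - 1)"
      using powr_diff[of "cmod z" "\<alpha> * (1 - \<nu>)" 1] by (simp only: powr_one norm_ge_zero if_True)
    finally show "norm (?k z) \<le> \<epsilon> / A1.c0 * M * cmod z powr (\<alpha> * (1 - \<nu>) - 1)" .
  qed
  have "A1.E t v - A2.E t v = cscale (1 / (2 * of_real pi * \<i>)) (A1.J ?k t)"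
    unfolding A1.E_eq A2.E_eq cscale.diff_right[symmetric]
    by (simp only: A1.J_diff[OF A1.wh_kE[OF v] A1.growth_kE[OF v] A2.wh_kE[OF v] A2.growth_kE[OF v] t])
  then show ?thesis using order_trans[OF norm_prefactor A1.J_bound[OF w g t]] by simp
qed

section \<open>The consistency term\<close>

lemma conv_difference_integrable:
  assumes "0 \<le> t" "continuous_on {0..t} g" "\<And>s. s \<in> {0..t} \<Longrightarrow> g s \<in> H \<times> H"
  shows "(\<lambda>s. A1.Eb (t - s) (g s) - A2.Eb (t - s) (g s)) integrable_on {0..t}"
  using assms by (intro integrable_diff A1.convolution_integrable A2.convolution_integrable)

text \<open>The time integral of the kernel difference gains the factor that is missing in
  \<open>Eb_difference\<close>: it is a difference of two values of a bounded primitive.\<close>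

lemma Eb_difference_integral:
  assumes v: "v \<in> H \<times> H" and t: "t > 0"
  shows "norm (integral {0..t} (\<lambda>s. A1.Eb (t - s) v - A2.Eb (t - s) v)) \<le> 2 * (A1.J_const 0 * B0 * \<epsilon> * norm v)"
proof -
  define p where "p = 1 / (2 * of_real pi * \<i>)"
  note eq = Eb_difference_eq[OF v, folded p_def] and prefactor = norm_prefactor[folded p_def]
  have sign: "- cscale p ((0 - 1) *\<^sub>R y) = cscale p y" for y :: "'h \<times> 'h"
    by (simp add: cscale.minus_right)
  let ?f = "\<lambda>s. A1.Eb (t - s) v - A2.Eb (t - s) v"
  let ?kB = "\<lambda>z. A1.kB v z - A2.kB v z"
  \<comment> \<open>Division by \<open>z\<close> is integration in time: \<open>k\<close> belongs to
    a primitive of the kernel difference, and growth exponent 0 makes that primitive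
    bounded.\<close>
  define k where "k z = cscale (inverse z) (?kB z)" for z
  note kB = kB_difference[OF v]
  have k: "weakly_holomorphic k"
    unfolding k_def[abs_def] by (intro weakly_holomorphic_cscale kB A1.inverse_holomorphic_slit)
  have gk: "growth 0 (B0 * \<epsilon> * norm v) k"
    unfolding growth_def
  proof
    fix z assume z: "z \<in> slit"
    then have "z \<noteq> 0" by auto
    have "norm (k z) \<le> inverse (cmod z) * (B0 * \<epsilon> * norm v * cmod z powr (1 - 1))"
      unfolding k_def norm_cscale norm_inverse by (intro mult_left_mono growthD[OF kB(2)] z) auto
    then show "norm (k z) \<le> B0 * \<epsilon> * norm v * cmod z powr (0 - 1)"
      using \<open>z \<noteq> 0\<close> by (simp add: powr_minus powr_one mult.commute)
  qed
  have Jk: "norm (cscale p (A1.J k \<tau>)) \<le> A1.J_const 0 * B0 * \<epsilon> * norm v" if "\<tau> > 0" for \<tau>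
    using order_trans[OF prefactor A1.J_bound[OF k gk that]] that by (simp add: mult.assoc)
  have zk: "A1.J (\<lambda>z. cscale z (k z)) \<tau> = A1.J ?kB \<tau>" for \<tau>
    by (intro A1.J_cong) (simp only: k_def cscale_cscale right_inverse[OF A1.slit_nonzero] cscale_one)
  \<comment> \<open>The primitive is used on \<open>[0, x]\<close> with \<open>x < t\<close> only;
    the singular end point is reached by continuity of the indefinite integral.\<close>
  have part: "norm (integral {0..x} ?f) \<le> 2 * (A1.J_const 0 * B0 * \<epsilon> * norm v)" if x: "x \<in> {0..<t}" for x
  proof -
    have "(?f has_integral - cscale p (A1.J k (t - x)) - (- cscale p (A1.J k (t - 0)))) {0..x}"
    proof (rule fundamental_theorem_of_calculus)
      fix s assume "s \<in> {0..x}"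
      then have ts: "t - s > 0" using x by auto
      have 1: "((\<lambda>s. t - s) has_vector_derivative (0 - 1)) (at s)"
        by (intro derivative_intros)
      have 2: "(A1.J k has_vector_derivative A1.J ?kB (t - s)) (at (t - s))"
        using A1.J_has_vector_derivative[OF k gk ts] unfolding zk .
      have "((A1.J k \<circ> (\<lambda>s. t - s)) has_vector_derivative (0 - 1) *\<^sub>R A1.J ?kB (t - s)) (at s)"
        by (rule vector_diff_chain_at[OF 1 2])
      from bounded_linear.has_vector_derivative[OF cscale.bounded_linear_right this, of "- p"]
      have "((\<lambda>s. cscale (- p) (A1.J k (t - s))) has_vector_derivative cscale (- p) ((0 - 1) *\<^sub>R A1.J ?kB (t
          - s))) (at s)"
        by (simp only: o_def)
      then show "((\<lambda>s. - cscale p (A1.J k (t - s))) has_vector_derivative ?f s) (at s within {0..x})"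
        unfolding eq[OF ts] cscale.minus_left sign by (rule has_vector_derivative_at_within)
    qed (use x in auto)
    then have "integral {0..x} ?f = cscale p (A1.J k t) - cscale p (A1.J k (t - x))"
      by (simp add: integral_unique)
    then have "norm (integral {0..x} ?f) \<le> norm (cscale p (A1.J k t)) + norm (cscale p (A1.J k (t - x)))"
      by (simp only: norm_triangle_ineq4)
    also have "\<dots> \<le> A1.J_const 0 * B0 * \<epsilon> * norm v + A1.J_const 0 * B0 * \<epsilon> * norm v"
      using t x by (intro add_mono Jk) auto
    finally show ?thesis by (simp only: mult_2)
  qed
  have fi: "?f integrable_on {0..t}"
    using v t by (intro conv_difference_integrable) auto
  have "((\<lambda>x. norm (integral {0..x} ?f)) \<longlongrightarrow> norm (integral {0..t} ?f)) (at t within {0..t})"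
    using indefinite_integral_continuous_1[OF fi] t by (intro tendsto_norm) (auto simp: continuous_on_def)
  then have "((\<lambda>x. norm (integral {0..x} ?f)) \<longlongrightarrow> norm (integral {0..t} ?f)) (at_left t)"
    using t by (simp add: at_within_Icc_at_left)
  moreover have "eventually (\<lambda>x. norm (integral {0..x} ?f) \<le> 2 * (A1.J_const 0 * B0 * \<epsilon> * norm v)) (at_left t)"
    using t part by (auto simp: eventually_at_left_field intro!: exI[of _ 0])
  ultimately show ?thesis by (rule tendsto_upperbound) simp
qed

lemma conv_difference_hoelder:
  assumes t: "t > 0" and g: "continuous_on {0..t} g" and gH: "\<And>s. s \<in> {0..t} \<Longrightarrow> g s \<in> H \<times> H"
    and q: "0 < q" and G: "norm (g t) \<le> G"
    and h: "\<And>s. 0 < s \<Longrightarrow> s < t \<Longrightarrow> norm (g s - g t) \<le> C * (t - s) powr q"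
  shows "norm (integral {0..t} (\<lambda>s. A1.Eb (t - s) (g s) - A2.Eb (t - s) (g s)))
    \<le> \<epsilon> * (A1.J_const 1 * B0 * C * (t powr q / q) + 2 * (A1.J_const 0 * B0 * G))"
proof -
  let ?f = "\<lambda>g s. A1.Eb (t - s) (g s) - A2.Eb (t - s) (g s)"
  have gt: "g t \<in> H \<times> H" using gH t by auto
  have i1: "?f g integrable_on {0..t}" and i2: "?f (\<lambda>s. g t) integrable_on {0..t}"
    using t g gH gt by (auto intro!: conv_difference_integrable)
  have "norm (integral {0..t} (\<lambda>s. ?f g s - ?f (\<lambda>s. g t) s))
      \<le> A1.J_const 1 * B0 * \<epsilon> * C * (((t - 0) powr q - (t - t) powr q) / q)"
  proof (rule norm_integral_bound_open[OF integrable_diff[OF i1 i2]])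
    show "((\<lambda>s. A1.J_const 1 * B0 * \<epsilon> * C * (t - s) powr (q - 1)) has_integral
        A1.J_const 1 * B0 * \<epsilon> * C * (((t - 0) powr q - (t - t) powr q) / q)) {0..t}"
      using t q by (intro has_integral_mult_right has_integral_powr_diff) auto
    fix s assume s: "0 < s" "s < t"
    then have ts: "t - s > 0" and gs: "g s \<in> H \<times> H" using gH by auto
    have "?f g s - ?f (\<lambda>s. g t) s = A1.Eb (t - s) (g s - g t) - A2.Eb (t - s) (g s - g t)"
      using A1.Eb_diff[OF gs gt ts] A2.Eb_diff[OF gs gt ts] by (simp add: algebra_simps)
    also have "norm \<dots> \<le> A1.J_const 1 * B0 * \<epsilon> * norm (g s - g t) * (t - s) powr (- 1)"
      by (intro Eb_difference subspace_diff[OF A1.HH] gs gt ts)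
    also have "\<dots> \<le> A1.J_const 1 * B0 * \<epsilon> * (C * (t - s) powr q) * (t - s) powr (- 1)"
      using s \<epsilon> B0 A1.J_const_nonneg by (intro mult_right_mono mult_left_mono h) auto
    also have "\<dots> = A1.J_const 1 * B0 * \<epsilon> * C * ((t - s) powr q * (t - s) powr (- 1))" by simp
    also have "(t - s) powr q * (t - s) powr (- 1) = (t - s) powr (q - 1)"
      by (simp only: powr_add[symmetric]) simp
    finally show "norm (?f g s - ?f (\<lambda>s. g t) s) \<le> A1.J_const 1 * B0 * \<epsilon> * C * (t - s) powr (q - 1)" .
  qed
  then have 1: "norm (integral {0..t} (?f g) - integral {0..t} (?f (\<lambda>s. g t)))
      \<le> \<epsilon> * (A1.J_const 1 * B0 * C * (t powr q / q))"
    using q by (simp add: integral_diff[OF i1 i2] mult_ac)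
  have "norm (integral {0..t} (?f (\<lambda>s. g t))) \<le> 2 * (A1.J_const 0 * B0 * \<epsilon> * norm (g t))"
    by (rule Eb_difference_integral[OF gt t])
  also have "\<dots> \<le> 2 * (A1.J_const 0 * B0 * \<epsilon> * G)"
    using \<epsilon> B0 A1.J_const_nonneg by (intro mult_left_mono G) auto
  finally have 2: "norm (integral {0..t} (?f (\<lambda>s. g t))) \<le> \<epsilon> * (2 * (A1.J_const 0 * B0 * G))"
      by (simp add: mult_ac)
  show ?thesis
    using norm_triangle_sub[of "integral {0..t} (?f g)" "integral {0..t} (?f (\<lambda>s. g t))"] 1 2
    by (simp only: distrib_left)
qed

text \<open>Interpolating between the bounds \<open>\<tau> powr (\<alpha> - 1)\<close> and \<open>\<epsilon> / \<tau>\<close> with weight \<open>1 / (1 + |ln \<epsilon>|)\<close>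
  costs a logarithm.\<close>

lemma conv_difference_log:
  assumes t: "t > 0" "t \<le> T" and g: "continuous_on {0..t} g" and gH: "\<And>s. s \<in> {0..t} \<Longrightarrow> g s \<in> H \<times> H"
    and G: "\<And>s. s \<in> {0..t} \<Longrightarrow> norm (g s) \<le> G" and \<epsilon>': "\<epsilon> > 0"
  shows "norm (integral {0..t} (\<lambda>s. A1.Eb (t - s) (g s) - A2.Eb (t - s) (g s)))
    \<le> \<epsilon> * (1 + \<bar>ln \<epsilon>\<bar>) * ((2 * A1.cB + A1.J_const 1 * B0) * G * exp 1 * (max 1 T / \<alpha>))"
proof -
  let ?f = "\<lambda>s. A1.Eb (t - s) (g s) - A2.Eb (t - s) (g s)"
  define C where "C = (2 * A1.cB + A1.J_const 1 * B0) * G"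
  \<comment> \<open>Balances two losses: \<open>\<epsilon>^(-\<kappa>)\<close> stays below
    \<open>e\<close>, while integrating \<open>(t - s)^(\<alpha> \<kappa> - 1)\<close> costs the
    factor \<open>1 / (\<alpha> \<kappa>)\<close>, which is the logarithm.\<close>
  define \<kappa> where "\<kappa> = 1 / (1 + \<bar>ln \<epsilon>\<bar>)"
  have \<kappa>: "0 < \<kappa>" "\<kappa> \<le> 1" by (auto simp: \<kappa>_def)
  have G0: "0 \<le> G" using G[of 0] t order_trans[OF norm_ge_zero] by force
  have p: "0 \<le> A1.cB" "0 \<le> A1.J_const 1 * B0" using A1.constants_nonneg B0 A1.J_const_nonneg by auto
  then have C0: "0 \<le> C" using G0 by (simp add: C_def)
  have \<alpha>\<kappa>: "0 < \<alpha> * \<kappa>" "\<alpha> * \<kappa> \<le> 1" using A1.\<alpha> \<kappa> by (auto intro: mult_le_one)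
  have "norm (integral {0..t} ?f) \<le> C * \<epsilon> powr (1 - \<kappa>) * (((t - 0) powr (\<alpha> * \<kappa>) - (t - t) powr (\<alpha> * \<kappa>)) / (\<alpha>
      * \<kappa>))"
  proof (rule norm_integral_bound_open)
    show "?f integrable_on {0..t}" using t g gH by (intro conv_difference_integrable) auto
    show "((\<lambda>s. C * \<epsilon> powr (1 - \<kappa>) * (t - s) powr (\<alpha> * \<kappa> - 1)) has_integral
       C * \<epsilon> powr (1 - \<kappa>) * (((t - 0) powr (\<alpha> * \<kappa>) - (t - t) powr (\<alpha> * \<kappa>)) / (\<alpha> * \<kappa>))) {0..t}"
      using t \<alpha>\<kappa> by (intro has_integral_mult_right has_integral_powr_diff) auto
    fix s assume s: "0 < s" "s < t"
    then have ts: "t - s > 0" and gs: "g s \<in> H \<times> H" and gG: "norm (g s) \<le> G" using gH G by auto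
    have "norm (?f s) \<le> norm (A1.Eb (t - s) (g s)) + norm (A2.Eb (t - s) (g s))" by (rule norm_triangle_ineq4)
    also have "\<dots> \<le> A1.cB * norm (g s) * (t - s) powr (\<alpha> - 1) + A1.cB * norm (g s) * (t - s) powr (\<alpha> - 1)"
      by (intro add_mono A1.Eb_bound A2.Eb_bound gs ts)
    also have "\<dots> = 2 * A1.cB * norm (g s) * (t - s) powr (\<alpha> - 1)" by simp
    also have "\<dots> \<le> C * (t - s) powr (\<alpha> - 1)"
      unfolding C_def using p gG by (intro mult_right_mono mult_mono) auto
    finally have 1: "norm (?f s) \<le> C * (t - s) powr (\<alpha> - 1)" .
    have "norm (?f s) \<le> A1.J_const 1 * B0 * \<epsilon> * norm (g s) * (t - s) powr (- 1)"
      by (rule Eb_difference[OF gs ts])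
    also have "\<dots> = A1.J_const 1 * B0 * norm (g s) * (\<epsilon> * (t - s) powr (- 1))" by simp
    also have "\<dots> \<le> C * (\<epsilon> * (t - s) powr (- 1))"
      unfolding C_def using p gG \<epsilon>' by (intro mult_right_mono mult_mono) auto
    finally have 2: "norm (?f s) \<le> C * (\<epsilon> * (t - s) powr (- 1))" .
    have "norm (?f s) = norm (?f s) powr \<kappa> * norm (?f s) powr (1 - \<kappa>)"
      by (simp add: powr_add[symmetric])
    also have "\<dots> \<le> (C * (t - s) powr (\<alpha> - 1)) powr \<kappa> * (C * (\<epsilon> * (t - s) powr (- 1))) powr (1 - \<kappa>)"
      using \<kappa> by (intro mult_mono powr_mono2 1 2) auto
    also have "(C * (t - s) powr (\<alpha> - 1)) powr \<kappa> = C powr \<kappa> * (t - s) powr ((\<alpha> - 1) * \<kappa>)"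
      using C0 by (simp add: powr_mult powr_powr)
    also have "(C * (\<epsilon> * (t - s) powr (- 1))) powr (1 - \<kappa>) = C powr (1 - \<kappa>) * (\<epsilon> powr (1 - \<kappa>) * (t - s) powr
        (- 1 * (1 - \<kappa>)))"
    proof -
      have "(C * (\<epsilon> * X)) powr y = C powr y * (\<epsilon> powr y * X powr y)" if "0 \<le> X" for X y
        using that C0 \<epsilon>' by (simp add: powr_mult)
      from this[OF powr_ge_zero] show ?thesis by (simp only: powr_powr)
    qed
    also have "C powr \<kappa> * (t - s) powr ((\<alpha> - 1) * \<kappa>) * (C powr (1 - \<kappa>) * (\<epsilon> powr (1 - \<kappa>) * (t - s) powr (- 1
        * (1 - \<kappa>))))
        = (C powr \<kappa> * C powr (1 - \<kappa>)) * \<epsilon> powr (1 - \<kappa>) * ((t - s) powr ((\<alpha> - 1) * \<kappa>) * (t - s) powr (- 1 *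
            (1 - \<kappa>)))"
      by (simp only: mult_ac)
    also have "C powr \<kappa> * C powr (1 - \<kappa>) = C" using C0 by (simp add: powr_add[symmetric])
    also have "(t - s) powr ((\<alpha> - 1) * \<kappa>) * (t - s) powr (- 1 * (1 - \<kappa>)) = (t - s) powr (\<alpha> * \<kappa> - 1)"
      by (simp add: powr_add[symmetric] algebra_simps)
    finally show "norm (?f s) \<le> C * \<epsilon> powr (1 - \<kappa>) * (t - s) powr (\<alpha> * \<kappa> - 1)" .
  qed
  also have "\<dots> = C * \<epsilon> powr (1 - \<kappa>) * t powr (\<alpha> * \<kappa>) * (1 / (\<alpha> * \<kappa>))" using \<alpha>\<kappa> by simp
  also have "\<dots> \<le> C * (\<epsilon> * exp 1) * max 1 T * (1 / (\<alpha> * \<kappa>))"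
  proof (intro mult_right_mono mult_mono)
    have "- \<kappa> * ln \<epsilon> \<le> \<kappa> * \<bar>ln \<epsilon>\<bar>" using \<kappa> by (simp add: abs_if)
    also have "\<dots> \<le> 1" by (simp add: \<kappa>_def field_simps)
    finally have "\<epsilon> powr (- \<kappa>) \<le> exp 1" using \<epsilon>' by (simp add: powr_def)
    then have "\<epsilon> * \<epsilon> powr (- \<kappa>) \<le> \<epsilon> * exp 1" using \<epsilon>' by (intro mult_left_mono) auto
    then show "\<epsilon> powr (1 - \<kappa>) \<le> \<epsilon> * exp 1" using \<epsilon>' powr_mult_base[of \<epsilon> "- \<kappa>"] by simp
    \<comment> \<open>The exponent depends on \<epsilon> but lies in \<open>(0, 1]\<close>, so
      \<open>max 1 T\<close> is a bound independent of \<epsilon>.\<close>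
    have "t powr (\<alpha> * \<kappa>) \<le> max 1 T powr (\<alpha> * \<kappa>)" using t \<alpha>\<kappa> by (intro powr_mono2) auto
    also have "\<dots> \<le> max 1 T powr 1" using \<alpha>\<kappa> by (intro powr_mono) auto
    finally show "t powr (\<alpha> * \<kappa>) \<le> max 1 T" by simp
  qed (use C0 \<epsilon>' \<alpha>\<kappa> in auto)
  also have "\<dots> = \<epsilon> * (1 + \<bar>ln \<epsilon>\<bar>) * (C * exp 1 * (max 1 T / \<alpha>))"
    using A1.\<alpha> by (simp add: \<kappa>_def)
  finally show ?thesis by (simp add: C_def)
qed

end

text \<open>Both solutions start from the same \<open>v\<close>; the projected initial value of the
  discrete problem is exchanged for it with \<open>is_solution_initial_cong\<close>.\<close>

locale error_setting =
  scheme_pair \<theta> \<delta> H S1 S2 N1 N2 \<alpha> \<epsilon> +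
  U1: solution \<theta> \<delta> H S1 N1 \<alpha> T \<Lambda> \<rho> F v u1 + U2: solution \<theta> \<delta> H S2 N2 \<alpha> T \<Lambda> \<rho> F v u2
  for \<theta> \<delta> :: real and H :: "'h::{real_inner, banach} set" and S1 S2 N1 N2 \<alpha> \<epsilon> T \<Lambda> \<rho> F v u1 u2
begin

text \<open>The mixed term \<open>A1.Eb (t - s) (U2.g s)\<close> is inserted. The kernel difference
  then acts on the source of the exact solution, whose regularity is known, and the difference of
  the sources meets the discrete kernel and feeds Gronwall's inequality.\<close>

lemma error_volterra:
  assumes t: "t \<in> {0<..T}"
    and reg: "\<And>z. z \<in> slit \<Longrightarrow> norm (A2.R z (v, 0)) \<le> M * cmod z powr (\<alpha> * (1 - \<nu>))"
    and Q: "norm (integral {0..t} (\<lambda>s. A1.Eb (t - s) (U2.g s) - A2.Eb (t - s) (U2.g s)))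
        \<le> Q * t powr (- (\<alpha> * (1 - \<nu>)))"
  shows "norm (u1 t - u2 t) \<le> (A1.J_const (\<alpha> * (1 - \<nu>)) * (\<epsilon> / A1.c0 * M) + Q) * t powr (- (\<alpha> * (1 - \<nu>))) +
    A1.cB * \<Lambda> * integral {0..t} (\<lambda>s. (t - s) powr (\<alpha> - 1) * norm (u1 s - u2 s))"
proof -
  have t0: "0 < t" "t \<le> T" using t by auto
  let ?d1 = "\<lambda>s. A1.Eb (t - s) (U1.g s) - A1.Eb (t - s) (U2.g s)"
  let ?d2 = "\<lambda>s. A1.Eb (t - s) (U2.g s) - A2.Eb (t - s) (U2.g s)"
  have i11: "(\<lambda>s. A1.Eb (t - s) (U1.g s)) integrable_on {0..t}"
    and i12: "(\<lambda>s. A1.Eb (t - s) (U2.g s)) integrable_on {0..t}"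
    and i22: "(\<lambda>s. A2.Eb (t - s) (U2.g s)) integrable_on {0..t}"
    using t0 by (auto intro!: U1.conv_integrable U2.conv_integrable A1.convolution_integrable
        U2.g_continuous_sub U2.g_in)
  have eq: "(u1 t, 0) - (u2 t, 0) = (A1.E t (v, 0) - A2.E t (v, 0)) + (integral {0..t} ?d1
      + integral {0..t} ?d2)"
    unfolding U1.u_eq[OF t] U2.u_eq[OF t] integral_diff[OF i11 i12] integral_diff[OF i12 i22] by simp
  have "norm (u1 t - u2 t) = norm ((u1 t, 0 :: 'h) - (u2 t, 0))" by simp
  also have "(u1 t, 0) - (u2 t, 0) = (A1.E t (v, 0) - A2.E t (v, 0)) + (integral {0..t} ?d1
      + integral {0..t} ?d2)"
    by (rule eq)
  also have "norm \<dots> \<le> norm (A1.E t (v, 0) - A2.E t (v, 0)) + (norm (integral {0..t} ?d1)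
      + norm (integral {0..t} ?d2))"
    by (intro order_trans[OF norm_triangle_ineq] add_left_mono norm_triangle_ineq)
  finally have e: "norm (u1 t - u2 t) \<le> \<dots>" .
  have uc: "continuous_on {0..t} (\<lambda>s. norm (u1 s - u2 s))"
    using t0 by (intro continuous_intros continuous_on_subset[OF U1.u_continuous]
        continuous_on_subset[OF U2.u_continuous]) auto
  have 1: "norm (integral {0..t} ?d1) \<le> A1.cB * \<Lambda> * integral {0..t} (\<lambda>s. (t - s) powr (\<alpha> - 1) * norm (u1 s -
      u2 s))"
  proof (rule norm_integral_bound_open[OF integrable_diff[OF i11 i12]])
    show "((\<lambda>s. A1.cB * \<Lambda> * ((t - s) powr (\<alpha> - 1) * norm (u1 s - u2 s))) has_integral
      A1.cB * \<Lambda> * integral {0..t} (\<lambda>s. (t - s) powr (\<alpha> - 1) * norm (u1 s - u2 s))) {0..t}"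
      using t0 A1.\<alpha> by (intro has_integral_mult_right[OF integrable_integral] weighted_integrable uc) auto
    fix s assume s: "0 < s" "s < t"
    then have ts: "t - s > 0" and sT: "s \<in> {0..T}" using t0 by auto
    note g = U1.g_in[OF sT] U2.g_in[OF sT]
    have "norm (?d1 s) \<le> A1.cB * norm (U1.g s - U2.g s) * (t - s) powr (\<alpha> - 1)"
      unfolding A1.Eb_diff[OF g ts] by (intro A1.Eb_bound subspace_diff[OF A1.HH] g ts)
    also have "\<dots> \<le> A1.cB * (\<Lambda> * norm (u1 s - u2 s)) * (t - s) powr (\<alpha> - 1)"
    proof (intro mult_right_mono mult_left_mono)
      show "norm (U1.g s - U2.g s) \<le> \<Lambda> * norm (u1 s - u2 s)"
        using U1.F_lipschitz[OF sT sT U1.u_in[OF sT] U2.u_in[OF sT]] by (simp add: U1.g_def U2.g_def)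
    qed (use A1.constants_nonneg in auto)
    finally show "norm (?d1 s) \<le> A1.cB * \<Lambda> * ((t - s) powr (\<alpha> - 1) * norm (u1 s - u2 s))" by (simp add: mult_ac)
  qed
  show ?thesis
    using order_trans[OF e add_mono[OF E_difference[OF U2.u0_in t0(1) reg] add_mono[OF 1 Q]]]
    by (simp only: distrib_right add_ac)
qed

lemma error_bound:
  assumes c: "gronwall_constant \<alpha> (\<alpha> * (1 - \<nu>)) T (A1.cB * \<Lambda>) c" and M: "0 \<le> M" and Q0: "0 \<le> Q"
    and reg: "\<And>z. z \<in> slit \<Longrightarrow> norm (A2.R z (v, 0)) \<le> M * cmod z powr (\<alpha> * (1 - \<nu>))"
    and Q: "\<And>t. t \<in> {0<..T} \<Longrightarrow>
      norm (integral {0..t} (\<lambda>s. A1.Eb (t - s) (U2.g s) - A2.Eb (t - s) (U2.g s)))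
          \<le> Q * t powr (- (\<alpha> * (1 - \<nu>)))"
    and t: "t \<in> {0<..T}"
  shows "norm (u1 t - u2 t) \<le> c * (A1.J_const (\<alpha> * (1 - \<nu>)) * (\<epsilon> / A1.c0 * M) + Q) * t powr (- (\<alpha> * (1 - \<nu>)))"
proof -
  have uc: "continuous_on {0..T} (\<lambda>s. norm (u1 s - u2 s))"
    by (intro continuous_intros U1.u_continuous U2.u_continuous)
  have a: "0 \<le> A1.J_const (\<alpha> * (1 - \<nu>)) * (\<epsilon> / A1.c0 * M) + Q"
    using \<epsilon> M Q0 A1.c0 A1.J_const_nonneg by (intro add_nonneg_nonneg mult_nonneg_nonneg
        divide_nonneg_nonneg) auto
  show ?thesis
    using c[unfolded gronwall_constant_def, THEN conjunct2, rule_format, OF a uc _ _ t] error_volterra[OF _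
        reg Q] by simp
qed

text \<open>This and the following constants bound the exact solution, its source, the Hoelder
  quotient of the solution, the consistency term and the error. None depends on the two operators or
  on \<epsilon>, so they can be named before \<open>h\<close> is given.\<close>

definition U_bound where "U_bound c m = c * (A1.cE * m + A1.cB * \<rho> * (T powr \<alpha> / \<alpha>))"
definition G_bound where "G_bound c m = \<rho> + \<Lambda> * U_bound c m"
definition H_const where "H_const \<nu> c m M = A1.J_const (1 - \<alpha> * \<nu>) * M / (\<alpha> * \<nu>) +
    (A1.cB * G_bound c m / \<alpha> + A1.cB' * G_bound c m / ((1 - \<alpha>) * \<alpha>)) * T powr (\<alpha> * (1 - \<nu>))"
text \<open>The branches belong to \<open>conv_difference_log\<close> and
  \<open>conv_difference_hoelder\<close>; the second divides by \<open>\<alpha> * \<nu>\<close> and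
  is therefore restricted to nonzero \<nu>.\<close>

definition Q_const where "Q_const \<nu> c m M = (if \<nu> = 0
    then (2 * A1.cB + A1.J_const 1 * B0) * G_bound c m * exp 1 * (max 1 T / \<alpha>)
    else A1.J_const 1 * B0 * (\<Lambda> * (T powr (1 - \<alpha> * \<nu>) + H_const \<nu> c m M)) * (T powr (\<alpha> * \<nu>) / (\<alpha> * \<nu>)) +
      2 * (A1.J_const 0 * B0 * G_bound c m))"
definition error_const where "error_const \<nu> c c' m M =
    c' * (A1.J_const (\<alpha> * (1 - \<nu>)) * (M / A1.c0) + Q_const \<nu> c m M * T powr (\<alpha> * (1 - \<nu>)))"

lemma error_rate:
  assumes \<nu>: "0 \<le> \<nu>" "\<nu> \<le> 1" and \<epsilon>': "0 < \<epsilon>"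
    and c: "gronwall_constant \<alpha> 0 T (A1.cB * \<Lambda>) c"
    and c': "gronwall_constant \<alpha> (\<alpha> * (1 - \<nu>)) T (A1.cB * \<Lambda>) c'"
    and m: "norm v \<le> m" and M: "0 \<le> M"
    and reg: "\<And>z. z \<in> slit \<Longrightarrow> norm (A2.R z (v, 0)) \<le> M * cmod z powr (\<alpha> * (1 - \<nu>))"
    and t: "t \<in> {0<..T}"
  shows "norm (u1 t - u2 t) \<le> error_const \<nu> c c' m M * (\<epsilon> * (if \<nu>
      = 0 then 1 + \<bar>ln \<epsilon>\<bar> else 1)) * t powr (- (\<alpha> * (1 - \<nu>)))"
proof -
  define \<beta> where "\<beta> = \<alpha> * (1 - \<nu>)"
  have \<beta>: "0 \<le> \<beta>" using A1.\<alpha> \<nu> by (simp add: \<beta>_def)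
  define lf where "lf = (if \<nu> = 0 then 1 + \<bar>ln \<epsilon>\<bar> else 1)"
  have lf: "1 \<le> lf" by (simp add: lf_def)
  have c0: "0 \<le> c" "0 \<le> c'" using c c' by (simp_all add: gronwall_constant_def)
  define G where "G = G_bound c m"
  have U: "norm (u2 s) \<le> U_bound c m" if "s \<in> {0..T}" for s
  proof -
    have "norm (u2 s) \<le> c * (A1.cE * norm v + A1.cB * \<rho> * (T powr \<alpha> / \<alpha>))" by (rule U2.u_bound[OF c that])
    also have "\<dots> \<le> U_bound c m"
      unfolding U_bound_def using c0 A1.constants_nonneg by (intro mult_left_mono add_right_mono m) auto
    finally show ?thesis .
  qed
  have G: "norm (U2.g s) \<le> G" if "s \<in> {0..T}" for s
    unfolding G_def G_bound_def
    by (intro order_trans[OF U2.g_norm] add_left_mono mult_left_mono U that U2.\<Lambda>)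
  have G0: "0 \<le> G" using G[of T] U2.T order_trans[OF norm_ge_zero] by force
  have pos: "0 \<le> A1.J_const x" "0 \<le> A1.cB" "0 \<le> A1.cB'" "0 \<le> B0" for x
    using A1.J_const_nonneg A1.constants_nonneg B0 by auto
  define Q where "Q = Q_const \<nu> c m M"
  have Q: "norm (integral {0..t} (\<lambda>s. A1.Eb (t - s) (U2.g s) - A2.Eb (t - s) (U2.g s))) \<le> \<epsilon> * lf * Q \<and> 0 \<le> Q"
    if t: "t \<in> {0<..T}" for t
  proof (cases "\<nu> = 0")
    case True
    have "0 \<le> Q" unfolding Q_def Q_const_def G_def[symmetric] using True pos G0 A1.\<alpha> by simp
    moreover have "norm (integral {0..t} (\<lambda>s. A1.Eb (t - s) (U2.g s) - A2.Eb (t - s) (U2.g s)))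
        \<le> \<epsilon> * (1 + \<bar>ln \<epsilon>\<bar>) * ((2 * A1.cB + A1.J_const 1 * B0) * G * exp 1 * (max 1 T / \<alpha>))"
      using t by (intro conv_difference_log U2.g_continuous_sub U2.g_in G \<epsilon>') auto
    ultimately show ?thesis using True by (simp add: Q_def Q_const_def lf_def G_def)
  next
    case False
    then have \<nu>0: "0 < \<nu>" using \<nu> by simp
    define q where "q = \<alpha> * \<nu>"
    have q: "0 < q" using A1.\<alpha> \<nu>0 by (simp add: q_def)
    define C where "C = \<Lambda> * (T powr (1 - \<alpha> * \<nu>) + H_const \<nu> c m M)"
    have C0: "0 \<le> C"
      unfolding C_def H_const_def G_def[symmetric] using U2.\<Lambda> pos M G0 A1.\<alpha> \<nu>0
      by (intro mult_nonneg_nonneg add_nonneg_nonneg divide_nonneg_nonneg) auto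
    have h: "norm (U2.g s - U2.g t) \<le> C * (t - s) powr q" if "0 < s" "s < t" for s
    proof -
      have "norm (u2 t - u2 s) \<le> H_const \<nu> c m M * (t - s) powr (\<alpha> * \<nu>)"
        unfolding H_const_def G_def[symmetric] using that t by (intro U2.u_hoelder \<nu>0 \<nu> reg G) auto
      from U2.g_hoelder[OF \<nu>0 \<nu>(2) that(1) _ _ this] show ?thesis
        using that t by (simp add: C_def q_def norm_minus_commute)
    qed
    have Q0: "0 \<le> Q" and Qe: "Q = A1.J_const 1 * B0 * C * (T powr q / q) + 2 * (A1.J_const 0 * B0 * G)"
      using False pos C0 G0 q by (auto simp: Q_def Q_const_def G_def C_def q_def)
    have "norm (integral {0..t} (\<lambda>s. A1.Eb (t - s) (U2.g s) - A2.Eb (t - s) (U2.g s)))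
        \<le> \<epsilon> * (A1.J_const 1 * B0 * C * (t powr q / q) + 2 * (A1.J_const 0 * B0 * G))"
      using t by (intro conv_difference_hoelder U2.g_continuous_sub U2.g_in q G h) auto
    also have "\<dots> \<le> \<epsilon> * Q"
      unfolding Qe using \<epsilon>' pos C0 q t
      by (intro mult_left_mono add_right_mono divide_right_mono powr_mono2 mult_nonneg_nonneg) auto
    finally show ?thesis using Q0 False by (simp add: lf_def)
  qed
  have Q0: "0 \<le> Q" using Q[OF t] by simp
  \<comment> \<open>The consistency term has no singularity at \<open>t = 0\<close>; it is
    multiplied by \<open>(T / t)^\<beta> \<ge> 1\<close> to fit the singular datum of Gronwall's
    inequality.\<close>
  have Q': "norm (integral {0..t} (\<lambda>s. A1.Eb (t - s) (U2.g s) - A2.Eb (t - s) (U2.g s)))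
      \<le> \<epsilon> * lf * Q * T powr \<beta> * t powr (- \<beta>)" if t: "t \<in> {0<..T}" for t
  proof -
    have "1 = t powr \<beta> * t powr (- \<beta>)" using t by (simp add: powr_add[symmetric])
    also have "\<dots> \<le> T powr \<beta> * t powr (- \<beta>)" using t \<beta> by (intro mult_right_mono powr_mono2) auto
    finally have "\<epsilon> * lf * Q * 1 \<le> \<epsilon> * lf * Q * (T powr \<beta> * t powr (- \<beta>))"
      using \<epsilon>' lf Q0 by (intro mult_left_mono) auto
    then show ?thesis using Q[OF t] by (simp add: mult.assoc)
  qed
  have "norm (u1 t - u2 t) \<le> c' * (A1.J_const \<beta> * (\<epsilon> / A1.c0 * M) + \<epsilon> * lf * Q * T powr \<beta>) * t powr (- \<beta>)"
    unfolding \<beta>_def using error_bound[OF c' M _ reg Q'[unfolded \<beta>_def] t] \<epsilon>' lf Q0 by simp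
  \<comment> \<open>Since \<open>1 \<le> lf\<close>, the term of the initial value may carry the
    same factor.\<close>
  also have "\<dots> \<le> c' * (lf * (A1.J_const \<beta> * (\<epsilon> / A1.c0 * M)) + \<epsilon> * lf * Q * T powr \<beta>) * t powr (- \<beta>)"
  proof (intro mult_right_mono mult_left_mono add_right_mono)
    have "0 \<le> A1.J_const \<beta> * (\<epsilon> / A1.c0 * M)" using pos \<epsilon>' M A1.c0 by auto
    from mult_right_mono[OF lf this] show "A1.J_const \<beta> * (\<epsilon> / A1.c0 * M)
        \<le> lf * (A1.J_const \<beta> * (\<epsilon> / A1.c0 * M))"
      by simp
  qed (use c0 in auto)
  also have "\<dots> = error_const \<nu> c c' m M * (\<epsilon> * lf) * t powr (- \<beta>)"
    by (simp add: error_const_def \<beta>_def Q_def algebra_simps)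
  finally show ?thesis by (simp only: lf_def \<beta>_def)
qed

end

section \<open>The inverse of a selfadjoint operator\<close>

lemma orthonormal_sum_norm:
  fixes \<phi> :: "nat \<Rightarrow> 'h::real_inner"
  assumes "\<And>i j. inner (\<phi> i) (\<phi> j) = (if i = j then 1 else 0)"
  shows "(norm (\<Sum>j<n. x j *\<^sub>R \<phi> j))\<^sup>2 = (\<Sum>j<n. (x j)\<^sup>2)"
proof (induction n)
  case (Suc n)
  have "inner (\<Sum>j<n. x j *\<^sub>R \<phi> j) (\<phi> n) = 0"
    unfolding inner_sum_left inner_scaleR_left using assms by (intro sum.neutral) auto
  then have "(norm ((\<Sum>j<n. x j *\<^sub>R \<phi> j) + x n *\<^sub>R \<phi> n))\<^sup>2 = (norm (\<Sum>j<n. x j *\<^sub>R \<phi> j))\<^sup>2 + (x n)\<^sup>2"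
    using assms[of n n] inner_commute[of "\<Sum>j<n. x j *\<^sub>R \<phi> j" "\<phi> n"]
    unfolding power2_norm_eq_inner by (simp add: inner_add_left inner_add_right power2_eq_square)
  then show ?case using Suc by simp
qed simp

text \<open>The partial sum is the orthogonal projection of \<open>u\<close> onto the span of the
  first \<open>n\<close> vectors, hence at least as close to \<open>u\<close> as any approximation
  \<open>y\<close> in that span; each \<open>y\<close> in the full span lies in one of
  these.\<close>

lemma orthonormal_expansion:
  fixes \<phi> :: "nat \<Rightarrow> 'h::real_inner"
  assumes on: "\<And>i j. inner (\<phi> i) (\<phi> j) = (if i = j then 1 else 0)"
    and u: "u \<in> closure (span (range \<phi>))"
  shows "(\<lambda>n. \<Sum>j<n. inner u (\<phi> j) *\<^sub>R \<phi> j) \<longlonglongrightarrow> u"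
proof (rule LIMSEQ_I)
  fix e :: real assume e: "0 < e"
  obtain y where y: "y \<in> span (range \<phi>)" "dist y u < e" using u e by (auto simp: closure_approachable)
  have sub: "span (\<phi> ` {..<m}) \<subseteq> span (\<phi> ` {..<k})" if "m \<le> k" for m k
    using that by (intro span_mono image_mono) auto
  have "\<exists>m. y \<in> span (\<phi> ` {..<m})"
    using y(1)
  proof (induction rule: span_induct_alt)
    case base
    show ?case using span_zero by blast
  next
    case (step c x y)
    then obtain m j where m: "y \<in> span (\<phi> ` {..<m})" and j: "x = \<phi> j" by blast
    have "y \<in> span (\<phi> ` {..<max m (Suc j)})"
      using subsetD[OF sub[of m "max m (Suc j)"] m] by simp
    moreover have "x \<in> span (\<phi> ` {..<max m (Suc j)})" unfolding j by (intro span_base imageI) auto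
    ultimately have "c *\<^sub>R x + y \<in> span (\<phi> ` {..<max m (Suc j)})" by (intro span_add span_scale)
    then show ?case by blast
  qed
  then obtain m where m: "y \<in> span (\<phi> ` {..<m})" by blast
  show "\<exists>m. \<forall>n\<ge>m. norm ((\<Sum>j<n. inner u (\<phi> j) *\<^sub>R \<phi> j) - u) < e"
  proof (intro exI allI impI)
    fix n assume n: "m \<le> n"
    define p where "p = (\<Sum>j<n. inner u (\<phi> j) *\<^sub>R \<phi> j)"
    have yn: "y \<in> span (\<phi> ` {..<n})" by (rule subsetD[OF sub[OF n] m])
    have "p \<in> span (\<phi> ` {..<n})"
      unfolding p_def by (intro span_sum span_scale span_base imageI) auto
    then have py: "p - y \<in> span (\<phi> ` {..<n})" using yn by (rule span_diff)
    have orth: "inner (u - p) (\<phi> i) = 0" if "i < n" for i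
    proof -
      have "inner p (\<phi> i) = (\<Sum>j<n. inner u (\<phi> j) * (if j = i then 1 else 0))"
        unfolding p_def inner_sum_left inner_scaleR_left on ..
      also have "\<dots> = inner u (\<phi> i)" using that by (simp add: sum.delta if_distrib[of "\<lambda>x. _ * x"] cong: if_cong)
      finally show ?thesis by (simp add: inner_diff_left)
    qed
    have "inner (u - p) w = 0" if "w \<in> span (\<phi> ` {..<n})" for w
      using that
    proof (induction rule: span_induct_alt)
      case (step c x y)
      then show ?case using orth by (auto simp: inner_add_right)
    qed simp
    from this[OF py] have "(norm (u - y))\<^sup>2 = (norm (u - p))\<^sup>2 + (norm (p - y))\<^sup>2"
      using dot_norm[of "u - p" "p - y"] by simp
    then have "(norm (u - p))\<^sup>2 \<le> (norm (u - y))\<^sup>2" by simp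
    then have "norm (u - p) \<le> norm (u - y)" by (rule power2_le_imp_le) simp
    then show "norm ((\<Sum>j<n. inner u (\<phi> j) *\<^sub>R \<phi> j) - u) < e"
      using y(2) by (simp add: p_def dist_norm norm_minus_commute)
  qed
qed

text \<open>Every \<open>u\<close> in \<open>H\<close> is the image of its preimage, so symmetry and
  nonnegativity are those of \<open>L\<close> on \<open>D\<close>. The bound \<open>N\<close> comes
  from compactness of the image of the unit ball, and \<open>H\<close> is a subspace as the closure
  of \<open>D\<close>.\<close>

lemma selfadjoint_inverse_psd:
  fixes H :: "'h::{real_inner, banach} set"
  assumes sa: "selfadjoint_on H D L" and pd: "positive_definite_on D L" and ci: "has_compact_inverse H D L"
    and \<alpha>: "0 < \<alpha>" "\<alpha> < 1"
  shows "\<exists>N. psd_operator H (inv_into D L) N \<alpha>"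
proof -
  let ?T = "inv_into D L"
  have D: "subspace D" and cl: "closure D = H" and L: "linear_op_on D L"
    and sym: "\<And>u v. u \<in> D \<Longrightarrow> v \<in> D \<Longrightarrow> inner (L u) v = inner u (L v)"
    using sa by (auto simp: selfadjoint_on_def)
  have bij: "bij_betw L D H" and comp: "compact (closure (?T ` (H \<inter> cball 0 1)))"
    using ci by (auto simp: has_compact_inverse_def)
  have inj: "inj_on L D" and img: "L ` D = H" using bij by (auto simp: bij_betw_def)
  have DH: "D \<subseteq> H" using closure_subset cl by blast
  have T_in: "?T u \<in> D" and L_T: "L (?T u) = u" if "u \<in> H" for u
    using that img by (auto intro: inv_into_into f_inv_into_f)
  have T_L: "?T (L w) = w" if "w \<in> D" for w using inj that by (rule inv_into_f_f)
  have "closed H" using cl closed_closure by metis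
  have "subspace H"
    unfolding subspace_def
  proof (intro conjI ballI allI)
    show "0 \<in> H" using DH subspace_0[OF D] by blast
    fix x y assume "x \<in> H" "y \<in> H"
    then obtain a b where "\<And>n. a n \<in> D" "a \<longlonglongrightarrow> x" "\<And>n. b n \<in> D" "b \<longlonglongrightarrow> y"
      unfolding cl[symmetric] closure_sequential by blast
    then have "\<And>n. a n + b n \<in> D" "(\<lambda>n. a n + b n) \<longlonglongrightarrow> x + y"
      using subspace_add[OF D] by (auto intro: tendsto_add)
    then show "x + y \<in> H"
      unfolding cl[symmetric] closure_sequential by (intro exI[of _ "\<lambda>n. a n + b n"] conjI allI)
  next
    fix c x assume "x \<in> H"
    then obtain a where "\<And>n. a n \<in> D" "a \<longlonglongrightarrow> x" unfolding cl[symmetric] closure_sequential by blast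
    then have "\<And>n. c *\<^sub>R a n \<in> D" "(\<lambda>n. c *\<^sub>R a n) \<longlonglongrightarrow> c *\<^sub>R x"
      using subspace_scale[OF D] by (auto intro: tendsto_intros)
    then show "c *\<^sub>R x \<in> H"
      unfolding cl[symmetric] closure_sequential by (intro exI[of _ "\<lambda>n. c *\<^sub>R a n"] conjI allI)
  qed
  have "bounded (?T ` (H \<inter> cball 0 1))"
    using compact_imp_bounded[OF comp] bounded_subset closure_subset by blast
  then obtain N where "\<forall>u\<in>H \<inter> cball 0 1. norm (?T u) \<le> N" by (auto simp: bounded_iff)
  then have N: "norm (?T u) \<le> N" if "u \<in> H" "norm u \<le> 1" for u using that by simp
  have N0: "0 \<le> N" using N[of 0] subspace_0[OF \<open>subspace H\<close>] order_trans[OF norm_ge_zero] by force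
  have add: "?T (u + v) = ?T u + ?T v" if "u \<in> H" "v \<in> H" for u v
  proof -
    have "L (?T u + ?T v) = u + v" using L T_in L_T that by (auto simp: linear_op_on_def)
    then show ?thesis using T_L[of "?T u + ?T v"] subspace_add[OF D T_in T_in] that by simp
  qed
  have scale: "?T (c *\<^sub>R u) = c *\<^sub>R ?T u" if "u \<in> H" for u c
  proof -
    have "L (c *\<^sub>R ?T u) = c *\<^sub>R u" using L T_in L_T that by (auto simp: linear_op_on_def)
    then show ?thesis using T_L[of "c *\<^sub>R ?T u"] subspace_scale[OF D T_in] that by simp
  qed
  have "psd_operator H ?T N \<alpha>"
  proof
    show "linear_op_on H ?T" using add scale by (auto simp: linear_op_on_def)
    fix u assume u: "u \<in> H"
    show "?T u \<in> H" using T_in[OF u] DH by blast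
    show "inner (?T u) v = inner u (?T v)" if v: "v \<in> H" for v
      using sym[OF T_in[OF u] T_in[OF v]] L_T[OF u] L_T[OF v] by simp
    show "0 \<le> inner (?T u) u"
      using pd T_in[OF u] L_T[OF u] unfolding positive_definite_on_def
      by (cases "?T u = 0") (force simp: inner_commute intro: less_imp_le)+
    show "norm (?T u) \<le> N * norm u"
    proof (cases "u = 0")
      case False
      have "?T u = norm u *\<^sub>R ?T (u /\<^sub>R norm u)"
        using scale[OF u, of "inverse (norm u)"] False by simp
      moreover have "norm (?T (u /\<^sub>R norm u)) \<le> N"
        using False u subspace_scale[OF \<open>subspace H\<close>] by (intro N) auto
      ultimately show ?thesis using mult_left_mono[of "norm (?T (u /\<^sub>R norm u))" N "norm u"]
          by (simp add: mult.commute)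
    next
      case True
      then show ?thesis using scale[OF u, of 0] by simp
    qed
  qed (use \<open>subspace H\<close> \<open>closed H\<close> N0 \<alpha> in auto)
  then show ?thesis by blast
qed

section \<open>Spectral estimates for data in the domain of a fractional power\<close>

context psd_operator
begin

text \<open>Rotation by half the angle puts both summands into a sector around the positive axis, so
  the modulus of the sum is at least \<open>c0 (|z|^(-\<alpha>) + \<mu>)\<close>; a sum of positive
  numbers dominates their weighted geometric mean.\<close>

lemma zeta_shift_lower:
  assumes z: "z \<noteq> 0" and \<mu>: "0 < \<mu>" and \<nu>: "0 \<le> \<nu>" "\<nu> \<le> 1"
  shows "c0 * (cmod z powr (- \<alpha> * (1 - \<nu>)) * \<mu> powr \<nu>) \<le> cmod (z powr (- of_real \<alpha>) + of_real \<mu>)"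
proof -
  let ?r = "cis (\<alpha> * Arg z / 2)" and ?x = "cmod z powr (- \<alpha>)"
  note c = c0_le_cos[of z]
  have "?x powr (1 - \<nu>) * \<mu> powr \<nu> \<le> (?x + \<mu>) powr (1 - \<nu>) * (?x + \<mu>) powr \<nu>"
    using \<mu> \<nu> by (intro mult_mono powr_mono2) auto
  also have "\<dots> = ?x + \<mu>"
  proof -
    have "0 \<le> ?x + \<mu>" using \<mu> by (intro add_nonneg_nonneg) auto
    then show ?thesis by (simp only: powr_add[symmetric]) simp
  qed
  finally have "c0 * (?x powr (1 - \<nu>) * \<mu> powr \<nu>) \<le> cos (\<alpha> * Arg z / 2) * (?x + \<mu>)"
    using c c0 \<mu> by (intro mult_mono) auto
  also have "\<dots> = Re (?r * (z powr (- of_real \<alpha>) + of_real \<mu>))"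
    by (simp add: distrib_left rotated_zeta[OF z])
  also have "\<dots> \<le> cmod (?r * (z powr (- of_real \<alpha>) + of_real \<mu>))" by (rule complex_Re_le_cmod)
  also have "\<dots> = cmod (z powr (- of_real \<alpha>) + of_real \<mu>)" by (simp add: norm_mult)
  finally show ?thesis by (simp add: powr_powr)
qed

context
  fixes lam :: "nat \<Rightarrow> real" and \<phi> :: "nat \<Rightarrow> 'h" and \<nu> :: real
  assumes lam: "\<And>j. 0 < lam j" and \<phi>_in: "\<And>j. \<phi> j \<in> H" and eig: "\<And>j. S (\<phi> j) = inverse (lam j) *\<^sub>R \<phi> j"
    and on: "\<And>i j. inner (\<phi> i) (\<phi> j) = (if i = j then 1 else 0)"
    and dense: "closure (span (range \<phi>)) = H" and \<nu>: "0 \<le> \<nu>" "\<nu> \<le> 1"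
begin

lemma frac_power_partial:
  assumes u: "u \<in> frac_domain H lam \<phi> \<nu>"
  shows "(\<Sum>j<n. (lam j powr \<nu> * inner u (\<phi> j))\<^sup>2) \<le> (norm (frac_power lam \<phi> \<nu> u))\<^sup>2"
proof -
  let ?g = "\<lambda>n. \<Sum>j<n. (lam j powr \<nu> * inner u (\<phi> j)) *\<^sub>R \<phi> j"
  have "?g \<longlonglongrightarrow> frac_power lam \<phi> \<nu> u"
    using u unfolding frac_domain_def frac_power_def by (auto intro: summable_LIMSEQ)
  then have "(\<lambda>n. (norm (?g n))\<^sup>2) \<longlonglongrightarrow> (norm (frac_power lam \<phi> \<nu> u))\<^sup>2" by (intro tendsto_intros)
  then have "(\<lambda>n. \<Sum>j<n. (lam j powr \<nu> * inner u (\<phi> j))\<^sup>2) \<longlonglongrightarrow> (norm (frac_power lam \<phi> \<nu> u))\<^sup>2"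
    unfolding orthonormal_sum_norm[OF on] .
  then show ?thesis by (intro incseq_le) (auto simp: incseq_def intro!: sum_mono2)
qed

text \<open>The eigenvalues \<open>1 / lam j\<close> of \<open>S\<close> are at most
  \<open>N\<close>, hence \<open>1 \<le> (N lam j)^\<nu>\<close> in every coefficient. This bounds
  the initial value itself by the quantity controlled by \<open>r\<close>.\<close>

lemma frac_domain_norm:
  assumes u: "u \<in> frac_domain H lam \<phi> \<nu>"
  shows "norm u \<le> N powr \<nu> * norm (frac_power lam \<phi> \<nu> u)"
proof -
  have "u \<in> H" using u by (simp add: frac_domain_def)
  have le: "1 \<le> N powr \<nu> * lam j powr \<nu>" for j
  proof -
    have "norm (S (\<phi> j)) \<le> N * norm (\<phi> j)" by (intro S_bounded \<phi>_in)
    moreover have "norm (\<phi> j) = 1" using on[of j j] by (simp add: norm_eq_sqrt_inner)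
    ultimately have "inverse (lam j) \<le> N" using lam[of j] by (simp add: eig)
    then have "1 \<le> N * lam j" using lam[of j] by (simp add: field_simps)
    then have "1 powr \<nu> \<le> (N * lam j) powr \<nu>" using \<nu> by (intro powr_mono2) auto
    then show ?thesis using N lam[of j] by (simp add: powr_mult)
  qed
  have "norm (\<Sum>j<n. inner u (\<phi> j) *\<^sub>R \<phi> j) \<le> N powr \<nu> * norm (frac_power lam \<phi> \<nu> u)" for n
  proof (rule power2_le_imp_le)
    have "(norm (\<Sum>j<n. inner u (\<phi> j) *\<^sub>R \<phi> j))\<^sup>2 = (\<Sum>j<n. (inner u (\<phi> j))\<^sup>2)"
        by (rule orthonormal_sum_norm[OF on])
    also have "\<dots> \<le> (\<Sum>j<n. (N powr \<nu>)\<^sup>2 * (lam j powr \<nu> * inner u (\<phi> j))\<^sup>2)"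
    proof (rule sum_mono)
      fix j
      have "1\<^sup>2 * (inner u (\<phi> j))\<^sup>2 \<le> (N powr \<nu> * lam j powr \<nu>)\<^sup>2 * (inner u (\<phi> j))\<^sup>2"
        using le[of j] by (intro mult_right_mono power_mono) auto
      then show "(inner u (\<phi> j))\<^sup>2 \<le> (N powr \<nu>)\<^sup>2 * (lam j powr \<nu> * inner u (\<phi> j))\<^sup>2"
        by (simp add: power_mult_distrib mult_ac)
    qed
    also have "\<dots> \<le> (N powr \<nu>)\<^sup>2 * (norm (frac_power lam \<phi> \<nu> u))\<^sup>2"
      unfolding sum_distrib_left[symmetric] by (intro mult_left_mono frac_power_partial u) auto
    finally show "(norm (\<Sum>j<n. inner u (\<phi> j) *\<^sub>R \<phi> j))\<^sup>2 \<le> (N powr \<nu> * norm (frac_power lam \<phi> \<nu> u))\<^sup>2"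
      by (simp add: power_mult_distrib)
  qed simp
  moreover have "(\<lambda>n. norm (\<Sum>j<n. inner u (\<phi> j) *\<^sub>R \<phi> j)) \<longlonglongrightarrow> norm u"
    using \<open>u \<in> H\<close> dense by (intro tendsto_norm orthonormal_expansion[OF on]) simp
  ultimately show ?thesis using LIMSEQ_le_const2 by blast
qed

text \<open>On finite eigenfunction sums the resolvent is explicit, and each coefficient is bounded
  through \<open>zeta_shift_lower\<close> with \<open>\<mu> = 1 / lam j\<close>. The resolvent is
  bounded for fixed \<open>z\<close>, so the estimate survives the limit without summing the series
  of its coefficients.\<close>

lemma R_frac_domain:
  assumes u: "u \<in> frac_domain H lam \<phi> \<nu>" and z: "z \<noteq> 0"
  shows "norm (R z (u, 0)) \<le> norm (frac_power lam \<phi> \<nu> u) / c0 * cmod z powr (\<alpha> * (1 - \<nu>))"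
proof -
  have uH: "u \<in> H" using u by (simp add: frac_domain_def)
  have zero_H: "0 \<in> H" using H(1) by (rule subspace_0)
  define a where "a j = inner u (\<phi> j)" for j
  define \<zeta> where "\<zeta> = z powr (- of_real \<alpha>)"
  define c where "c j = of_real (a j) / (\<zeta> + of_real (inverse (lam j)))" for j
  define p where "p n = (\<Sum>j<n. a j *\<^sub>R \<phi> j)" for n
  define w where "w n = (\<Sum>j<n. cscale (c j) (\<phi> j, 0))" for n
  define G where "G = norm (frac_power lam \<phi> \<nu> u)"
  define x where "x = cmod z powr (\<alpha> * (1 - \<nu>)) / c0"
  have x: "0 \<le> x" using c0 by (simp add: x_def)
  have lower: "lam j powr (- \<nu>) \<le> x * cmod (\<zeta> + of_real (inverse (lam j)))" for j
  proof -
    have "c0 * (cmod z powr (- \<alpha> * (1 - \<nu>)) * inverse (lam j) powr \<nu>) \<le> cmod (\<zeta> + of_real (inverse (lam j)))"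
      unfolding \<zeta>_def using lam[of j] by (intro zeta_shift_lower z \<nu>) auto
    then have le: "x * (c0 * (cmod z powr (- \<alpha> * (1 - \<nu>)) * inverse (lam j) powr \<nu>))
        \<le> x * cmod (\<zeta> + of_real (inverse (lam j)))"
      using x by (rule mult_left_mono)
    have 1: "x * (c0 * (cmod z powr (- \<alpha> * (1 - \<nu>)) * inverse (lam j) powr \<nu>))
        = (cmod z powr (\<alpha> * (1 - \<nu>)) * cmod z powr (- \<alpha> * (1 - \<nu>))) * inverse (lam j) powr \<nu>"
      using c0 by (simp add: x_def)
    have 2: "cmod z powr (\<alpha> * (1 - \<nu>)) * cmod z powr (- \<alpha> * (1 - \<nu>)) = 1"
      using z by (simp add: powr_add[symmetric])
    have 3: "inverse (lam j) powr \<nu> = lam j powr (- \<nu>)"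
      using lam[of j] by (simp add: powr_minus inverse_powr)
    show ?thesis using le[unfolded 1, unfolded 2 3 mult_1] .
  qed
  have nz: "\<zeta> + of_real (inverse (lam j)) \<noteq> 0" for j
  proof
    assume "\<zeta> + of_real (inverse (lam j)) = 0"
    then have "lam j powr (- \<nu>) \<le> 0" using lower[of j] by simp
    then show False using lam[of j] by simp
  qed
  have \<phi>_pair: "(\<phi> j, 0) \<in> H \<times> H" for j using \<phi>_in zero_H by auto
  have p_H: "(p n, 0) \<in> H \<times> H" for n
    unfolding p_def using \<phi>_in zero_H by (auto intro!: subspace_sum[OF H(1)] subspace_scale[OF H(1)])
  \<comment> \<open>Both claims are proved in one induction: additivity of \<open>A z\<close> is
    available on \<open>H \<times> H\<close> only.\<close>
  have w_in: "w n \<in> H \<times> H" and Aw: "A z (w n) = (p n, 0)" for n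
  proof (induction n)
    case 0
    show "w 0 \<in> H \<times> H" "A z (w 0) = (p 0, 0)"
      using zero_H by (auto simp: w_def p_def A_def S_zero zero_prod_def cscale_def)
  next
    case (Suc n)
    have w_Suc: "w (Suc n) = w n + cscale (c n) (\<phi> n, 0)" by (simp add: w_def)
    have cin: "cscale (c n) (\<phi> n, 0) \<in> H \<times> H" by (intro cscale_in \<phi>_pair)
    show "w (Suc n) \<in> H \<times> H" unfolding w_Suc by (intro subspace_add[OF HH] Suc cin)
    have "A z (\<phi> n, 0) = cscale (\<zeta> + of_real (inverse (lam n))) (\<phi> n, 0)"
      by (simp add: A_def \<zeta>_def eig S_zero cscale.add_left cscale_of_real del: of_real_inverse)
    then have "A z (cscale (c n) (\<phi> n, 0)) = cscale (of_real (a n)) (\<phi> n, 0)"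
      using nz[of n] by (simp add: A_cscale[OF \<phi>_pair] cscale_cscale c_def)
    moreover have "A z (w (Suc n)) = A z (w n) + A z (cscale (c n) (\<phi> n, 0))"
      unfolding w_Suc A_def using Sc_add[OF Suc(1) cin] by (simp add: cscale.add_right)
    ultimately show "A z (w (Suc n)) = (p (Suc n), 0)"
      using Suc(2) by (simp add: p_def cscale_of_real)
  qed
  have w_norm: "norm (w n) \<le> x * G" for n
  proof (rule power2_le_imp_le)
    have fst_w: "fst (w n) = (\<Sum>j<n. Re (c j) *\<^sub>R \<phi> j)" and snd_w: "snd (w n) = (\<Sum>j<n. Im (c j) *\<^sub>R \<phi> j)"
      unfolding w_def fst_sum snd_sum by (simp_all add: cscale_def)
    have "(norm (w n))\<^sup>2 = (norm (fst (w n)))\<^sup>2 + (norm (snd (w n)))\<^sup>2" by (simp add: norm_prod_def)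
    also have "\<dots> = (\<Sum>j<n. (cmod (c j))\<^sup>2)"
      unfolding fst_w snd_w orthonormal_sum_norm[OF on] sum.distrib[symmetric] by (simp add: cmod_power2)
    also have "\<dots> \<le> (\<Sum>j<n. x\<^sup>2 * (lam j powr \<nu> * a j)\<^sup>2)"
    proof (rule sum_mono)
      fix j
      let ?d = "cmod (\<zeta> + of_real (inverse (lam j)))"
      have d: "?d > 0" using nz[of j] by simp
      have "lam j powr \<nu> * lam j powr (- \<nu>) \<le> lam j powr \<nu> * (x * ?d)"
        by (intro mult_left_mono lower) simp
      moreover have "lam j powr \<nu> * lam j powr (- \<nu>) = 1"
        using lam[of j] by (simp add: powr_minus)
      ultimately have one: "1 \<le> lam j powr \<nu> * (x * ?d)" by simp
      have "\<bar>a j\<bar> * 1 \<le> \<bar>a j\<bar> * (lam j powr \<nu> * (x * ?d))" by (intro mult_left_mono one) simp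
      then have "\<bar>a j\<bar> / ?d \<le> x * (lam j powr \<nu> * \<bar>a j\<bar>)" using d by (simp add: field_simps)
      then have "cmod (c j) \<le> x * (lam j powr \<nu> * \<bar>a j\<bar>)" unfolding c_def norm_divide by simp
      then have "(cmod (c j))\<^sup>2 \<le> (x * (lam j powr \<nu> * \<bar>a j\<bar>))\<^sup>2" by (intro power_mono) auto
      then show "(cmod (c j))\<^sup>2 \<le> x\<^sup>2 * (lam j powr \<nu> * a j)\<^sup>2" by (simp add: power_mult_distrib)
    qed
    also have "\<dots> \<le> x\<^sup>2 * G\<^sup>2"
      unfolding sum_distrib_left[symmetric] a_def G_def by (intro mult_left_mono frac_power_partial u) auto
    finally show "(norm (w n))\<^sup>2 \<le> (x * G)\<^sup>2" by (simp add: power_mult_distrib)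
    show "0 \<le> x * G" using x by (simp add: G_def)
  qed
  have Rw: "R z (p n, 0) = w n" for n by (intro R_unique w_in z Aw)
  have p_lim: "(\<lambda>n. p n) \<longlonglongrightarrow> u"
    unfolding p_def a_def using uH dense by (intro orthonormal_expansion[OF on]) simp
  have "(\<lambda>n. R z (p n, 0)) \<longlonglongrightarrow> R z (u, 0)"
  proof (rule Lim_null[THEN iffD2, OF Lim_null_comparison])
    have u_pair: "(u, 0) \<in> H \<times> H" using uH zero_H by auto
    show "eventually (\<lambda>n. norm (R z (p n, 0) - R z (u, 0)) \<le> cmod z powr \<alpha> / c0 * norm (p n - u)) sequentially"
    proof (rule always_eventually, rule allI)
      fix n
      have "R z (p n, 0) - R z (u, 0) = R z ((p n, 0) - (u, 0))" by (intro R_diff[symmetric] p_H u_pair z)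
      also have "norm \<dots> \<le> cmod z powr \<alpha> / c0 * norm ((p n, 0 :: 'h) - (u, 0))"
        by (intro R_bound subspace_diff[OF HH] p_H u_pair z)
      finally show "norm (R z (p n, 0) - R z (u, 0)) \<le> cmod z powr \<alpha> / c0 * norm (p n - u)" by simp
    qed
    have "(\<lambda>n. cmod z powr \<alpha> / c0 * norm (p n - u)) \<longlonglongrightarrow> cmod z powr \<alpha> / c0 * norm (u - u)"
      by (intro tendsto_intros p_lim)
    then show "(\<lambda>n. cmod z powr \<alpha> / c0 * norm (p n - u)) \<longlonglongrightarrow> 0" by simp
  qed
  then have "(\<lambda>n. norm (w n)) \<longlonglongrightarrow> norm (R z (u, 0))" unfolding Rw by (rule tendsto_norm)
  then have "norm (R z (u, 0)) \<le> x * G" using w_norm LIMSEQ_le_const2 by blast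
  then show ?thesis by (simp add: x_def G_def mult.commute)
qed

end

end

section \<open>Completeness of the space of square integrable functions\<close>

lemma sq_integrable_rep: "sq_integrable (rep_L2 u)"
  using Quotient_rep_reflp[OF Quotient_L2] by blast

lemma abs_rep_L2: "abs_L2 (rep_L2 u) = u"
  by (rule Quotient_abs_rep[OF Quotient_L2])

lemma rep_abs_L2: "sq_integrable f \<Longrightarrow> AE x in lebesgue. rep_L2 (abs_L2 f) x = f x"
  using Quotient_rep_abs[OF Quotient_L2, of f] by simp

lemma abs_L2_cong_AE: "sq_integrable f \<Longrightarrow> sq_integrable g \<Longrightarrow> AE x in lebesgue. f x = g x \<Longrightarrow> abs_L2 f = abs_L2 g"
  using Quotient_rel_abs[OF Quotient_L2, of f g] by simp

lemma abs_L2_add: "sq_integrable f \<Longrightarrow> sq_integrable g \<Longrightarrow> abs_L2 f + abs_L2 g = abs_L2 (\<lambda>x. f x + g x)"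
  by (simp add: plus_L2.abs_eq)

lemma abs_L2_diff: "sq_integrable f \<Longrightarrow> sq_integrable g \<Longrightarrow> abs_L2 f - abs_L2 g = abs_L2 (\<lambda>x. f x - g x)"
  by (simp add: minus_L2.abs_eq)

lemma abs_L2_scale: "sq_integrable f \<Longrightarrow> c *\<^sub>R abs_L2 f = abs_L2 (\<lambda>x. c * f x)"
  by (simp add: scaleR_L2.abs_eq)

lemma norm_abs_L2: "sq_integrable f \<Longrightarrow> (norm (abs_L2 f))\<^sup>2 = (LINT x|lebesgue. (f x)\<^sup>2)"
  unfolding power2_norm_eq_inner by (simp add: inner_L2.abs_eq power2_eq_square)

lemma sq_integrable_bound:
  assumes "f \<in> borel_measurable lebesgue" "sq_integrable g" "\<And>x. \<bar>f x\<bar> \<le> \<bar>g x\<bar>"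
  shows "sq_integrable f"
  unfolding sq_integrable_def
proof
  show "integrable lebesgue (\<lambda>x. (f x)\<^sup>2)"
  proof (rule Bochner_Integration.integrable_bound)
    show "integrable lebesgue (\<lambda>x. (g x)\<^sup>2)" using assms(2) by (simp add: sq_integrable_def)
    show "(\<lambda>x. (f x)\<^sup>2) \<in> borel_measurable lebesgue" using assms(1) by (rule borel_measurable_power)
    show "AE x in lebesgue. norm ((f x)\<^sup>2) \<le> norm ((g x)\<^sup>2)"
      using assms(3) by (auto simp: abs_le_square_iff)
  qed
qed (rule assms(1))

lemma sq_integrable_abs: "sq_integrable f \<Longrightarrow> sq_integrable (\<lambda>x. \<bar>f x\<bar>)"
  by (rule sq_integrable_bound[of _ f]) (auto simp: sq_integrable_def intro: borel_measurable_abs)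

lemma norm_abs_L2_mono:
  assumes f: "sq_integrable f" and g: "sq_integrable g" and le: "\<And>x. \<bar>f x\<bar> \<le> \<bar>g x\<bar>"
  shows "norm (abs_L2 f) \<le> norm (abs_L2 g)"
proof -
  have "(norm (abs_L2 f))\<^sup>2 \<le> (norm (abs_L2 g))\<^sup>2"
    unfolding norm_abs_L2[OF f] norm_abs_L2[OF g]
    using f g le by (intro integral_mono) (auto simp: sq_integrable_def abs_le_square_iff)
  then show ?thesis by (rule power2_le_imp_le) simp
qed

lemma norm_abs_L2_abs: "sq_integrable f \<Longrightarrow> norm (abs_L2 (\<lambda>x. \<bar>f x\<bar>)) = norm (abs_L2 f)"
  by (intro antisym norm_abs_L2_mono sq_integrable_abs) auto

text \<open>Riesz--Fischer: a sufficiently fast subsequence converges almost everywhere by monotone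
  convergence, and the limit is identified by Fatou's lemma.\<close>

lemma L2_complete:
  fixes X :: "nat \<Rightarrow> 'a::euclidean_space L2"
  assumes X: "Cauchy X"
  shows "convergent X"
proof -
  have "\<exists>N. \<forall>m\<ge>N. \<forall>n\<ge>N. norm (X m - X n) < (1 / 2) ^ k" for k :: nat
    using X unfolding Cauchy_iff by simp
  then obtain N where N: "\<And>k m n. m \<ge> N k \<Longrightarrow> n \<ge> N k \<Longrightarrow> norm (X m - X n) < (1 / 2) ^ k"
    by metis
  \<comment> \<open>The sum dominates all of \<open>N 0\<close>, ..., \<open>N n\<close> at once, so
    consecutive terms of the chosen sequence are closer than \<open>(1 / 2) ^ n\<close>.\<close>
  define r where "r n = (\<Sum>i\<le>n. N i)" for n
  have rN: "N k \<le> r n" if "k \<le> n" for k n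
    unfolding r_def using that by (intro member_le_sum) auto
  define f where "f n = rep_L2 (X (r n))" for n
  have f: "sq_integrable (f n)" "abs_L2 (f n) = X (r n)" for n
    by (simp_all add: f_def sq_integrable_rep abs_rep_L2)
  have fm [measurable]: "f n \<in> borel_measurable lebesgue" for n using f(1)[of n]
      by (simp add: sq_integrable_def)
  define d where "d n x = \<bar>f (Suc n) x - f n x\<bar>" for n x
  have d: "sq_integrable (d n)" for n unfolding d_def[abs_def] by (intro sq_integrable_abs sq_integrable_diff f)
  have dm [measurable]: "d n \<in> borel_measurable lebesgue" for n using d[of n] by (simp add: sq_integrable_def)
  have nd: "norm (abs_L2 (d n)) \<le> (1 / 2) ^ n" for n
  proof -
    have "norm (abs_L2 (d n)) = norm (X (r (Suc n)) - X (r n))"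
      unfolding d_def[abs_def] f(2)[symmetric] by (simp add: norm_abs_L2_abs sq_integrable_diff f(1)
          abs_L2_diff)
    then show ?thesis using N[of n "r (Suc n)" "r n"] rN[of n "Suc n"] rN[of n n] by simp
  qed
  define s where "s n x = (\<Sum>i<n. d i x)" for n x
  \<comment> \<open>The bound is the exact geometric partial sum, which is what lets the induction
    close.\<close>
  have s: "sq_integrable (s n)" "norm (abs_L2 (s n)) \<le> 2 - 2 * (1 / 2) ^ n" for n
  proof (induction n)
    case 0
    have "s 0 = (\<lambda>x. 0)" by (simp add: s_def fun_eq_iff)
    then show "sq_integrable (s 0)" "norm (abs_L2 (s 0)) \<le> 2 - 2 * (1 / 2) ^ 0"
      by (simp_all add: sq_integrable_zero zero_L2.abs_eq[symmetric])
  next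
    case (Suc n)
    have eq: "s (Suc n) = (\<lambda>x. s n x + d n x)" by (simp add: s_def fun_eq_iff)
    show "sq_integrable (s (Suc n))" unfolding eq by (intro sq_integrable_add Suc d)
    have "norm (abs_L2 (s (Suc n))) \<le> norm (abs_L2 (s n)) + norm (abs_L2 (d n))"
      unfolding eq abs_L2_add[OF Suc(1) d, symmetric] by (rule norm_triangle_ineq)
    also have "\<dots> \<le> 2 - 2 * (1 / 2) ^ n + (1 / 2) ^ n" by (intro add_mono Suc nd)
    finally show "norm (abs_L2 (s (Suc n))) \<le> 2 - 2 * (1 / 2) ^ Suc n" by simp
  qed
  have s0: "0 \<le> s n x" for n x by (auto simp: s_def d_def intro: sum_nonneg)
  have sm [measurable]: "s n \<in> borel_measurable lebesgue" for n using s(1)[of n]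
      by (simp add: sq_integrable_def)
  have smono: "s m x \<le> s n x" if "m \<le> n" for m n x
    unfolding s_def using that by (intro sum_mono2) (auto simp: d_def)
  have "(\<integral>\<^sup>+ x. (SUP n. ennreal ((s n x)\<^sup>2)) \<partial>lebesgue) = (SUP n. \<integral>\<^sup>+ x. ennreal ((s n x)\<^sup>2) \<partial>lebesgue)"
    using smono s0 by (intro nn_integral_monotone_convergence_SUP) (auto simp: incseq_def le_fun_def intro!:
        ennreal_leI power_mono)
  also have "\<dots> \<le> 4"
  proof (rule SUP_least)
    fix n
    have "(\<integral>\<^sup>+ x. ennreal ((s n x)\<^sup>2) \<partial>lebesgue) = ennreal ((norm (abs_L2 (s n)))\<^sup>2)"
      unfolding norm_abs_L2[OF s(1)] using s(1)[of n] by (intro nn_integral_eq_integral) (auto simp: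
          sq_integrable_def)
    also have "\<dots> \<le> ennreal (2\<^sup>2)"
      using order_trans[OF s(2)[of n], of 2] by (intro ennreal_leI power_mono) auto
    finally show "(\<integral>\<^sup>+ x. ennreal ((s n x)\<^sup>2) \<partial>lebesgue) \<le> 4" by simp
  qed
  finally have "(\<integral>\<^sup>+ x. (SUP n. ennreal ((s n x)\<^sup>2)) \<partial>lebesgue) \<noteq> \<infinity>" by (auto simp: top_unique)
  then have "AE x in lebesgue. (SUP n. ennreal ((s n x)\<^sup>2)) \<noteq> \<infinity>"
    by (intro nn_integral_noteq_infinite) auto
  then have conv: "AE x in lebesgue. convergent (\<lambda>n. f n x)"
  proof eventually_elim
    case (elim x)
    define K where "K = enn2real (SUP n. ennreal ((s n x)\<^sup>2))"
    have K: "(s n x)\<^sup>2 \<le> K" for n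
    proof -
      have "ennreal ((s n x)\<^sup>2) \<le> (SUP n. ennreal ((s n x)\<^sup>2))" by (rule SUP_upper) simp
      also have "\<dots> = ennreal K" using elim by (simp add: K_def less_top[symmetric])
      finally show ?thesis by (subst (asm) ennreal_le_iff) (auto simp: K_def)
    qed
    have "summable (\<lambda>i. \<bar>f (Suc i) x - f i x\<bar>)"
    proof (rule bounded_imp_summable)
      fix n
      have "(\<Sum>i\<le>n. \<bar>f (Suc i) x - f i x\<bar>) = s (Suc n) x" by (simp add: s_def d_def lessThan_Suc_atMost)
      also have "\<dots> \<le> sqrt K" using K by (rule real_le_rsqrt)
      finally show "(\<Sum>i\<le>n. \<bar>f (Suc i) x - f i x\<bar>) \<le> sqrt K" .
    qed simp
    then have "summable (\<lambda>i. f (Suc i) x - f i x)" by (rule summable_rabs_cancel)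
    then have "convergent (\<lambda>n. \<Sum>i<n. f (Suc i) x - f i x)" by (simp add: summable_iff_convergent)
    moreover have "(\<Sum>i<n. f (Suc i) x - f i x) = f n x - f 0 x" for n
      by (rule sum_lessThan_telescope)
    ultimately have "convergent (\<lambda>n. (f n x - f 0 x) + f 0 x)"
      by (intro convergent_add convergent_const) (simp only:)
    then show ?case by simp
  qed
  define F where "F x = lim (\<lambda>n. f n x)" for x
  have Fm [measurable]: "F \<in> borel_measurable lebesgue" unfolding F_def[abs_def] by measurable
  have lim: "AE x in lebesgue. (\<lambda>n. f n x) \<longlonglongrightarrow> F x"
    using conv by eventually_elim (simp add: F_def convergent_LIMSEQ_iff)
  \<comment> \<open>Fatou's lemma in the first index, with \<open>n\<close> fixed, turns the Cauchy
    bound into a bound for the distance to the limit.\<close>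
  have int: "(\<integral>\<^sup>+ x. ennreal ((F x - f n x)\<^sup>2) \<partial>lebesgue) \<le> ennreal (((1 / 2) ^ n)\<^sup>2)" for n
  proof -
    have "(\<integral>\<^sup>+ x. ennreal ((F x - f n x)\<^sup>2) \<partial>lebesgue) = (\<integral>\<^sup>+ x. liminf (\<lambda>m. ennreal ((f m x - f n x)\<^sup>2))
        \<partial>lebesgue)"
    proof (rule nn_integral_cong_AE)
      show "AE x in lebesgue. ennreal ((F x - f n x)\<^sup>2) = liminf (\<lambda>m. ennreal ((f m x - f n x)\<^sup>2))"
        using lim
      proof eventually_elim
        case (elim x)
        then have "(\<lambda>m. ennreal ((f m x - f n x)\<^sup>2)) \<longlonglongrightarrow> ennreal ((F x - f n x)\<^sup>2)"
          by (intro tendsto_intros) auto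
        then show ?case by (rule lim_imp_Liminf[OF sequentially_bot, symmetric])
      qed
    qed
    also have "\<dots> \<le> liminf (\<lambda>m. \<integral>\<^sup>+ x. ennreal ((f m x - f n x)\<^sup>2) \<partial>lebesgue)"
      by (rule nn_integral_liminf) measurable
    also have "\<dots> \<le> limsup (\<lambda>m. \<integral>\<^sup>+ x. ennreal ((f m x - f n x)\<^sup>2) \<partial>lebesgue)"
      by (rule Liminf_le_Limsup) simp
    also have "\<dots> \<le> ennreal (((1 / 2) ^ n)\<^sup>2)"
    proof (rule Limsup_bounded)
      show "eventually (\<lambda>m. (\<integral>\<^sup>+ x. ennreal ((f m x - f n x)\<^sup>2) \<partial>lebesgue)
          \<le> ennreal (((1 / 2) ^ n)\<^sup>2)) sequentially"
        using eventually_ge_at_top[of n]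
      proof eventually_elim
        case (elim m)
        have sq: "sq_integrable (\<lambda>x. f m x - f n x)" by (intro sq_integrable_diff f)
        have "(\<integral>\<^sup>+ x. ennreal ((f m x - f n x)\<^sup>2) \<partial>lebesgue) = ennreal ((norm (abs_L2 (\<lambda>x. f m x - f n x)))\<^sup>2)"
          unfolding norm_abs_L2[OF sq] using sq by (intro nn_integral_eq_integral) (auto simp:
              sq_integrable_def)
        also have "abs_L2 (\<lambda>x. f m x - f n x) = X (r m) - X (r n)"
          using abs_L2_diff[OF f(1) f(1), of m n] by (simp add: f(2))
        also have "ennreal ((norm (X (r m) - X (r n)))\<^sup>2) \<le> ennreal (((1 / 2) ^ n)\<^sup>2)"
          using N[of n "r m" "r n"] rN elim by (intro ennreal_leI power_mono) auto
        finally show ?case .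
      qed
    qed
    finally show ?thesis .
  qed
  have sqF: "sq_integrable (\<lambda>x. F x - f n x)" for n
    unfolding sq_integrable_def
  proof
    have "(\<integral>\<^sup>+ x. ennreal (norm ((F x - f n x)\<^sup>2)) \<partial>lebesgue) < \<infinity>"
      using int[of n] by (simp add: le_less_trans[OF _ ennreal_less_top])
    then show "integrable lebesgue (\<lambda>x. (F x - f n x)\<^sup>2)"
      by (intro integrableI_bounded) measurable
  qed measurable
  have "sq_integrable (\<lambda>x. (F x - f 0 x) + f 0 x)" by (intro sq_integrable_add sqF f)
  then have F: "sq_integrable F" by simp
  have nF: "norm (abs_L2 F - X (r n)) \<le> (1 / 2) ^ n" for n
  proof -
    have "abs_L2 F - X (r n) = abs_L2 (\<lambda>x. F x - f n x)"
      using abs_L2_diff[OF F f(1), of n] by (simp add: f(2))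
    then have "ennreal ((norm (abs_L2 F - X (r n)))\<^sup>2) = (\<integral>\<^sup>+ x. ennreal ((F x - f n x)\<^sup>2) \<partial>lebesgue)"
      unfolding norm_abs_L2[OF sqF, symmetric] using sqF[of n]
      by (subst nn_integral_eq_integral) (auto simp: sq_integrable_def norm_abs_L2[OF sqF])
    then have "ennreal ((norm (abs_L2 F - X (r n)))\<^sup>2) \<le> ennreal (((1 / 2) ^ n)\<^sup>2)"
      using int[of n] by (simp only:)
    then have "(norm (abs_L2 F - X (r n)))\<^sup>2 \<le> ((1 / 2) ^ n)\<^sup>2"
      by (subst (asm) ennreal_le_iff) simp_all
    then show ?thesis by (rule power2_le_imp_le) simp
  qed
  have "X \<longlonglongrightarrow> abs_L2 F"
  proof (rule LIMSEQ_I)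
    fix e :: real assume e: "0 < e"
    obtain k where k: "(1 / 2) ^ k < e / 2" using real_arch_pow_inv[of "e / 2" "1 / 2"] e by auto
    show "\<exists>n0. \<forall>n\<ge>n0. norm (X n - abs_L2 F) < e"
    proof (intro exI allI impI)
      fix n assume "n \<ge> N k"
      then have "norm (X n - X (r k)) < (1 / 2) ^ k" using N rN by simp
      moreover have "norm (X n - abs_L2 F) \<le> norm (X n - X (r k)) + norm (abs_L2 F - X (r k))"
        using norm_triangle_ineq4[of "X n - X (r k)" "abs_L2 F - X (r k)"] by simp
      ultimately show "norm (X n - abs_L2 F) < e" using nF[of k] k by linarith
    qed
  qed
  then show ?thesis by (auto simp: convergent_def)
qed

instance L2 :: (euclidean_space) banach
  by standard (rule L2_complete)

section \<open>The superposition operator\<close>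

lemma to_L2_in:
  assumes "sq_integrable (\<lambda>x. if x \<in> \<Omega> then g x else 0)"
  shows "to_L2 \<Omega> g \<in> L2_on \<Omega>"
  unfolding to_L2_def L2_on_def mem_Collect_eq using rep_abs_L2[OF assms] by eventually_elim simp

locale admissible_setting =
  fixes \<Omega> :: "(real^'n) set" and T0 L :: real and f :: "real^'n \<Rightarrow> real \<Rightarrow> real \<Rightarrow> real"
  assumes dom: "convex_polyhedral_domain \<Omega>" and T0: "0 < T0" and adm: "admissible_nonlinearity \<Omega> T0 L f"
begin

lemma \<Omega>: "open \<Omega>" "bounded \<Omega>" "\<Omega> \<noteq> {}"
  using dom by (auto simp: convex_polyhedral_domain_def)

lemma \<Omega>_measurable: "\<Omega> \<in> sets lebesgue" using \<Omega>(1) by auto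

definition ind :: "real^'n \<Rightarrow> real" where "ind x = (if x \<in> \<Omega> then 1 else 0)"

lemma ind: "sq_integrable ind"
proof -
  have "\<Omega> \<in> lmeasurable" using \<Omega> by (intro lmeasurable_open)
  then have "integrable lebesgue (indicat_real \<Omega>)" by (simp add: lmeasurable_iff_integrable)
  moreover have "indicat_real \<Omega> = ind" "(\<lambda>x. (ind x)\<^sup>2) = ind"
    by (auto simp: fun_eq_iff ind_def indicator_def)
  ultimately show ?thesis unfolding sq_integrable_def by (auto dest: borel_measurable_integrable)
qed

definition g where "g = (\<lambda>(x, t, w). f x t w)"
definition P where "P = closure \<Omega> \<times> {0..T0} \<times> (UNIV :: real set)"

lemma smooth:
  obtains U where "open U" "P \<subseteq> U" "continuous_on U g" "\<And>p. p \<in> U \<Longrightarrow> g differentiable (at p)"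
proof -
  obtain U where U: "open U" "P \<subseteq> U" and Ck: "\<And>k. Ck_on k U g"
    using adm unfolding admissible_nonlinearity_def smooth_near_def g_def P_def by blast
  show ?thesis
    using U Ck[of 0] Ck[of "Suc 0"] by (intro that[of U]) auto
qed

lemma g_differentiable: "p \<in> P \<Longrightarrow> g differentiable (at p)"
  using smooth by (metis subsetD)

lemma g_isCont: "p \<in> P \<Longrightarrow> isCont g p"
  using g_differentiable differentiable_imp_continuous_within by blast

lemma derivs:
  assumes x: "x \<in> \<Omega>" and t: "t \<in> {0<..<T0}"
  shows "(f x t has_real_derivative deriv (f x t) w) (at w)"
    and "((\<lambda>s. f x s w) has_real_derivative deriv (\<lambda>s. f x s w) t) (at t)"
    and "\<bar>deriv (f x t) w\<bar> \<le> L" "\<bar>deriv (\<lambda>s. f x s w) t\<bar> \<le> L"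
proof -
  have "x \<in> closure \<Omega>" using x closure_subset by blast
  then have p: "(x, t, w) \<in> P" using t by (auto simp: P_def)
  have "((\<lambda>w. (x, t, w)) has_derivative (\<lambda>h. (0, 0, h))) (at w)"
    by (auto intro!: derivative_eq_intros)
  then have "(\<lambda>w. (x, t, w)) differentiable (at w)" by (rule differentiableI)
  from differentiable_chain_at[OF this g_differentiable[OF p]]
  show "(f x t has_real_derivative deriv (f x t) w) (at w)"
    unfolding DERIV_deriv_iff_real_differentiable by (simp add: o_def g_def)
  have "((\<lambda>t. (x, t, w)) has_derivative (\<lambda>h. (0, h, 0))) (at t)"
    by (auto intro!: derivative_eq_intros)
  then have "(\<lambda>t. (x, t, w)) differentiable (at t)" by (rule differentiableI)
  from differentiable_chain_at[OF this g_differentiable[OF p]]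
  show "((\<lambda>s. f x s w) has_real_derivative deriv (\<lambda>s. f x s w) t) (at t)"
    unfolding DERIV_deriv_iff_real_differentiable by (simp add: o_def g_def)
  have "\<bar>deriv (\<lambda>s. f x s w) t\<bar> + \<bar>deriv (f x t) w\<bar> \<le> L"
    using adm x t unfolding admissible_nonlinearity_def by blast
  then show "\<bar>deriv (f x t) w\<bar> \<le> L" "\<bar>deriv (\<lambda>s. f x s w) t\<bar> \<le> L" by linarith+
qed

lemma L: "0 \<le> L"
proof -
  obtain x where "x \<in> \<Omega>" using \<Omega> by blast
  then have "\<bar>deriv (f x (T0 / 2)) 0\<bar> \<le> L" using derivs(3)[of x "T0 / 2" 0] T0 by simp
  then show ?thesis by linarith
qed

section \<open>Lipschitz continuity of the nonlinearity\<close>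

lemma f_lipschitz_interior:
  assumes x: "x \<in> \<Omega>" and s: "s \<in> {0<..<T0}" "s' \<in> {0<..<T0}"
  shows "\<bar>f x s w - f x s' w'\<bar> \<le> L * \<bar>s - s'\<bar> + L * \<bar>w - w'\<bar>"
proof -
  have "norm (f x s w - f x s w') \<le> L * norm (w - w')"
    using derivs[OF x s(1)] by (intro field_differentiable_bound[of UNIV "f x s" "deriv (f x s)"]) auto
  moreover have "norm (f x s w' - f x s' w') \<le> L * norm (s - s')"
  proof (rule field_differentiable_bound[of "{0<..<T0}" "\<lambda>s. f x s w'" "deriv (\<lambda>s. f x s w')"])
    fix z assume z: "z \<in> {0<..<T0}"
    show "((\<lambda>s. f x s w') has_real_derivative deriv (\<lambda>s. f x s w') z) (at z within {0<..<T0})"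
      using derivs(2)[OF x z] by (rule has_field_derivative_at_within)
    show "norm (deriv (\<lambda>s. f x s w') z) \<le> L" using derivs(4)[OF x z] by simp
  qed (use s in auto)
  ultimately show ?thesis by simp
qed

text \<open>The derivatives are bounded on the open time interval only; the end points are reached
  by continuity of \<open>f\<close> on the closed one.\<close>

lemma f_lipschitz:
  assumes x: "x \<in> \<Omega>" and s: "s \<in> {0..T0}" "s' \<in> {0..T0}"
  shows "\<bar>f x s w - f x s' w'\<bar> \<le> L * \<bar>s - s'\<bar> + L * \<bar>w - w'\<bar>"
proof -
  \<comment> \<open>Moves \<open>s\<close> towards the midpoint \<open>T0 / 2\<close> by a vanishing
    fraction, which lands in the open interval even for \<open>s = 0\<close> and
    \<open>s = T0\<close>.\<close>
  define c where "c s n = s + (T0 / 2 - s) / (real n + 2)" for s n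
  have c_in: "c s n \<in> {0<..<T0}" if "s \<in> {0..T0}" for s n
  proof -
    define e where "e = 1 / (real n + 2)"
    have e: "0 < e" "e \<le> 1 / 2" by (auto simp: e_def field_simps)
    have "c s n = s + (T0 / 2 - s) * e" by (simp add: c_def e_def)
    then have "c s n = s * (1 - e) + e * T0 / 2" by (simp add: algebra_simps)
    moreover have "0 \<le> s * (1 - e)" "s * (1 - e) \<le> T0 * (1 - e)"
      using that e by (auto intro!: mult_right_mono)
    moreover have "0 < e * T0" using e T0 by simp
    ultimately show ?thesis unfolding greaterThanLessThan_iff by (simp add: algebra_simps)
  qed
  have c_lim: "c s \<longlonglongrightarrow> s" for s unfolding c_def[abs_def] by real_asymp
  have f_lim: "(\<lambda>n. f x (c s n) w) \<longlonglongrightarrow> f x s w" if s: "s \<in> {0..T0}" for s w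
  proof -
    have "x \<in> closure \<Omega>" using x closure_subset by blast
    then have "isCont g (x, s, w)" using s by (intro g_isCont) (auto simp: P_def)
    moreover have "(\<lambda>n. (x, c s n, w)) \<longlonglongrightarrow> (x, s, w)" by (intro tendsto_intros c_lim)
    ultimately have "(\<lambda>n. g (x, c s n, w)) \<longlonglongrightarrow> g (x, s, w)" by (rule isCont_tendsto_compose)
    then show ?thesis by (simp add: g_def)
  qed
  show ?thesis
  proof (rule LIMSEQ_le)
    show "(\<lambda>n. \<bar>f x (c s n) w - f x (c s' n) w'\<bar>) \<longlonglongrightarrow> \<bar>f x s w - f x s' w'\<bar>"
      by (intro tendsto_intros f_lim s)
    show "(\<lambda>n. L * \<bar>c s n - c s' n\<bar> + L * \<bar>w - w'\<bar>) \<longlonglongrightarrow> L * \<bar>s - s'\<bar> + L * \<bar>w - w'\<bar>"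
      by (intro tendsto_intros c_lim)
    show "\<exists>N. \<forall>n\<ge>N. \<bar>f x (c s n) w - f x (c s' n) w'\<bar> \<le> L * \<bar>c s n - c s' n\<bar> + L * \<bar>w - w'\<bar>"
      using f_lipschitz_interior[OF x c_in[OF s(1)] c_in[OF s(2)]] by blast
  qed
qed

lemma f_zero_bounded: "\<exists>K\<ge>0. \<forall>x\<in>\<Omega>. \<forall>s\<in>{0..T0}. \<bar>f x s 0\<bar> \<le> K"
proof -
  have "compact (closure \<Omega> \<times> {0..T0} \<times> {0 :: real})"
    using \<Omega> by (intro compact_Times) (auto simp: compact_closure)
  moreover have "continuous_on (closure \<Omega> \<times> {0..T0} \<times> {0}) g"
    using g_isCont by (intro continuous_at_imp_continuous_on) (auto simp: P_def)
  ultimately have "bounded (g ` (closure \<Omega> \<times> {0..T0} \<times> {0}))"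
    by (intro compact_imp_bounded compact_continuous_image)
  then obtain K where K: "\<forall>y\<in>g ` (closure \<Omega> \<times> {0..T0} \<times> {0}). norm y \<le> K" unfolding bounded_iff by blast
  have "\<bar>f x s 0\<bar> \<le> \<bar>K\<bar>" if "x \<in> \<Omega>" "s \<in> {0..T0}" for x s
  proof -
    have "(x, s, 0) \<in> closure \<Omega> \<times> {0..T0} \<times> {0}" using that closure_subset by auto
    from K[rule_format, OF imageI[OF this]] show ?thesis by (simp add: g_def)
  qed
  then show ?thesis by (intro exI[of _ "\<bar>K\<bar>"]) auto
qed

text \<open>The Nemytskii operator on representatives.\<close>

definition nem where "nem s v x = (if x \<in> \<Omega> then f x s (v x) else 0)"

text \<open>Joint continuity is known on the open neighbourhood \<open>U\<close> only. Extension by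
  zero outside \<open>U\<close> gives a Borel function, and the arguments with \<open>x\<close> in
  \<Omega> never leave \<open>U\<close>.\<close>

lemma nem_measurable:
  assumes v: "v \<in> borel_measurable lebesgue" and s: "s \<in> {0..T0}"
  shows "nem s v \<in> borel_measurable lebesgue"
proof -
  obtain U where U: "open U" "P \<subseteq> U" "continuous_on U g" using smooth by metis
  define h where "h p = (if p \<in> U then g p else 0)" for p
  have h: "h \<in> borel_measurable borel"
    unfolding h_def[abs_def] using U by (intro borel_measurable_continuous_on_if) auto
  have "(\<lambda>x. (x, s, v x)) \<in> borel_measurable lebesgue"
    using v by (intro borel_measurable_Pair borel_measurable_const measurable_completion[of "\<lambda>x. x" lborel])
        auto
  then have hm: "(\<lambda>x. h (x, s, v x)) \<in> borel_measurable lebesgue" using h by (rule measurable_compose)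
  have "nem s v = (\<lambda>x. if x \<in> \<Omega> then h (x, s, v x) else 0)"
  proof
    fix x
    show "nem s v x = (if x \<in> \<Omega> then h (x, s, v x) else 0)"
    proof (cases "x \<in> \<Omega>")
      case True
      then have "(x, s, v x) \<in> P" using closure_subset s by (auto simp: P_def)
      then show ?thesis using U True by (auto simp: nem_def h_def g_def)
    qed (simp add: nem_def)
  qed
  also have "\<dots> \<in> borel_measurable lebesgue"
    using \<Omega>_measurable hm by (intro measurable_If_set) auto
  finally show ?thesis .
qed

lemma nem_sq_integrable:
  assumes v: "sq_integrable v" and s: "s \<in> {0..T0}"
  shows "sq_integrable (nem s v)"
proof -
  obtain K where K: "0 \<le> K" "\<And>x. x \<in> \<Omega> \<Longrightarrow> \<bar>f x s 0\<bar> \<le> K" using f_zero_bounded s by blast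
  show ?thesis
  proof (rule sq_integrable_bound)
    show "nem s v \<in> borel_measurable lebesgue"
      using v by (intro nem_measurable s) (simp add: sq_integrable_def)
    show "sq_integrable (\<lambda>x. K * ind x + L * \<bar>v x\<bar>)"
      by (intro sq_integrable_add sq_integrable_scale ind sq_integrable_abs v)
    fix x
    show "\<bar>nem s v x\<bar> \<le> \<bar>K * ind x + L * \<bar>v x\<bar>\<bar>"
    proof (cases "x \<in> \<Omega>")
      case True
      then show ?thesis using f_lipschitz[OF True s s, of "v x" 0] K(2)[OF True] K(1) L
        by (simp add: nem_def ind_def)
    qed (simp add: nem_def)
  qed
qed

lemma superpose_nem: "superpose \<Omega> f s v = abs_L2 (nem s (rep_L2 v))"
  by (simp add: superpose_def to_L2_def nem_def[abs_def])

text \<open>The state contributes \<open>L\<close>, the time contributes \<open>L\<close> times the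
  norm of the indicator function of \<Omega>. Since \<open>f\<close> does not occur, the constant
  can be fixed before \<open>f\<close>.\<close>

definition \<Lambda> where "\<Lambda> = L * (norm (abs_L2 ind) + 1)"

lemma superpose_lipschitz:
  assumes s: "s \<in> {0..T0}" "s' \<in> {0..T0}"
  shows "norm (superpose \<Omega> f s v - superpose \<Omega> f s' w) \<le> \<Lambda> * (\<bar>s - s'\<bar> + norm (v - w))"
proof -
  let ?v = "rep_L2 v" and ?w = "rep_L2 w"
  have d: "sq_integrable (\<lambda>x. ?v x - ?w x)" by (intro sq_integrable_diff sq_integrable_rep)
  have i1: "sq_integrable (\<lambda>x. L * \<bar>s - s'\<bar> * ind x)" by (intro sq_integrable_scale ind)
  have i2: "sq_integrable (\<lambda>x. L * \<bar>?v x - ?w x\<bar>)" by (intro sq_integrable_scale sq_integrable_abs d)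
  have n: "sq_integrable (nem s ?v)" "sq_integrable (nem s' ?w)"
    by (intro nem_sq_integrable sq_integrable_rep s)+
  have "norm (superpose \<Omega> f s v - superpose \<Omega> f s' w) = norm (abs_L2 (\<lambda>x. nem s ?v x - nem s' ?w x))"
    unfolding superpose_nem abs_L2_diff[OF n] ..
  also have "\<dots> \<le> norm (abs_L2 (\<lambda>x. L * \<bar>s - s'\<bar> * ind x + L * \<bar>?v x - ?w x\<bar>))"
  proof (intro norm_abs_L2_mono sq_integrable_diff n sq_integrable_add i1 i2)
    fix x
    show "\<bar>nem s ?v x - nem s' ?w x\<bar> \<le> \<bar>L * \<bar>s - s'\<bar> * ind x + L * \<bar>?v x - ?w x\<bar>\<bar>"
      using f_lipschitz[OF _ s, of x "?v x" "?w x"] L by (auto simp: nem_def ind_def)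
  qed
  also have "\<dots> = norm (abs_L2 (\<lambda>x. L * \<bar>s - s'\<bar> * ind x) + abs_L2 (\<lambda>x. L * \<bar>?v x - ?w x\<bar>))"
    by (simp only: abs_L2_add[OF i1 i2])
  also have "\<dots> \<le> norm (abs_L2 (\<lambda>x. L * \<bar>s - s'\<bar> * ind x)) + norm (abs_L2 (\<lambda>x. L * \<bar>?v x - ?w x\<bar>))"
    by (rule norm_triangle_ineq)
  also have "norm (abs_L2 (\<lambda>x. L * \<bar>s - s'\<bar> * ind x)) = L * \<bar>s - s'\<bar> * norm (abs_L2 ind)"
    using L by (simp add: abs_L2_scale[OF ind, symmetric])
  also have "norm (abs_L2 (\<lambda>x. L * \<bar>?v x - ?w x\<bar>)) = L * norm (abs_L2 (\<lambda>x. ?v x - ?w x))"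
    using L by (simp add: abs_L2_scale[OF sq_integrable_abs[OF d], symmetric] norm_abs_L2_abs[OF d])
  also have "abs_L2 (\<lambda>x. ?v x - ?w x) = v - w"
    by (simp add: abs_L2_diff[OF sq_integrable_rep sq_integrable_rep, symmetric] abs_rep_L2)
  also have "L * \<bar>s - s'\<bar> * norm (abs_L2 ind) + L * norm (v - w) \<le> \<Lambda> * (\<bar>s - s'\<bar> + norm (v - w))"
    using L by (simp add: \<Lambda>_def algebra_simps)
  finally show ?thesis .
qed

lemma superpose_in: "s \<in> {0..T0} \<Longrightarrow> superpose \<Omega> f s v \<in> L2_on \<Omega>"
  unfolding superpose_def
  using nem_sq_integrable[OF sq_integrable_rep, of s v] by (intro to_L2_in) (simp add: nem_def[abs_def])

text \<open>The norms are bounded above because \<open>f\<close> is continuous on a compact set;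
  without this the supremum of reals would be no upper bound.\<close>

lemma f0_norm: "s \<in> {0..T0} \<Longrightarrow> norm (to_L2 \<Omega> (\<lambda>x. f x s 0)) \<le> f0_norm \<Omega> T0 f"
proof -
  assume s: "s \<in> {0..T0}"
  have eq: "to_L2 \<Omega> (\<lambda>x. f x s 0) = abs_L2 (nem s (\<lambda>x. 0))" for s
    by (simp add: to_L2_def nem_def[abs_def])
  obtain K where K: "0 \<le> K" "\<And>x s. x \<in> \<Omega> \<Longrightarrow> s \<in> {0..T0} \<Longrightarrow> \<bar>f x s 0\<bar> \<le> K" using f_zero_bounded by blast
  have "norm (to_L2 \<Omega> (\<lambda>x. f x s 0)) \<le> norm (abs_L2 (\<lambda>x. K * ind x))" if "s \<in> {0..T0}" for s
    unfolding eq using K that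
    by (intro norm_abs_L2_mono nem_sq_integrable sq_integrable_zero sq_integrable_scale ind)
      (auto simp: nem_def ind_def)
  then have "bdd_above ((\<lambda>s. norm (to_L2 \<Omega> (\<lambda>x. f x s 0))) ` {0..T0})" by (rule bdd_aboveI2)
  then show ?thesis unfolding f0_norm_def using s by (intro cSUP_upper)
qed

lemma superpose_zero: "s \<in> {0..T0} \<Longrightarrow> norm (superpose \<Omega> f s 0) \<le> f0_norm \<Omega> T0 f"
proof -
  assume s: "s \<in> {0..T0}"
  \<comment> \<open>The chosen representative of the zero class vanishes only almost
    everywhere.\<close>
  have "AE x in lebesgue. rep_L2 (0 :: (real^'n) L2) x = 0"
    using rep_abs_L2[OF sq_integrable_zero] by (simp add: zero_L2.abs_eq)
  then have "AE x in lebesgue. nem s (rep_L2 0) x = nem s (\<lambda>x. 0) x"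
    by eventually_elim (simp add: nem_def)
  then have "superpose \<Omega> f s 0 = abs_L2 (nem s (\<lambda>x. 0))"
    unfolding superpose_nem
    by (intro abs_L2_cong_AE nem_sq_integrable sq_integrable_rep sq_integrable_zero s)
  then show ?thesis using f0_norm[OF s] by (simp add: to_L2_def nem_def[abs_def])
qed

lemma superpose_lipschitz_nonlinearity:
  "f0_norm \<Omega> T0 f \<le> \<rho> \<Longrightarrow> lipschitz_nonlinearity (L2_on \<Omega>) T0 \<Lambda> \<rho> (superpose \<Omega> f)"
  unfolding lipschitz_nonlinearity_def
  using superpose_lipschitz superpose_in order_trans[OF superpose_zero] by blast

end

section \<open>The error estimate\<close>

text \<open>The initial value enters only through the right-hand side of the resolvent equation,
  where \<open>S\<close> has already been applied to it. With \<open>T\<^sub>h\<close> absorbing the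
  projection, this removes the projection from the discrete problem.\<close>

lemma is_solution_initial_cong:
  assumes "is_solution H S \<alpha> \<theta> \<delta> F T v u" "S v = S w"
  shows "is_solution H S \<alpha> \<theta> \<delta> F T w u"
  using assms by (simp add: is_solution_def E_op_def K_op_def)

text \<open>The approximation inherits boundedness from its distance to the exact operator.\<close>

lemma (in psd_operator) psd_perturbation:
  assumes S': "S' ` H \<subseteq> H" "linear_op_on H S'"
    and sym: "\<And>u v. u \<in> H \<Longrightarrow> v \<in> H \<Longrightarrow> inner (S' u) v = inner u (S' v)"
    and nonneg: "\<And>u. u \<in> H \<Longrightarrow> 0 \<le> inner (S' u) u"
    and close: "\<And>u. u \<in> H \<Longrightarrow> norm (S' u - S u) \<le> \<epsilon> * norm u" and \<epsilon>: "0 \<le> \<epsilon>"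
  shows "psd_operator_pair H S' S (N + \<epsilon>) N \<alpha> \<epsilon>"
proof -
  have "norm (S' u) \<le> (N + \<epsilon>) * norm u" if "u \<in> H" for u
    using close[OF that] S_bounded[OF that] norm_triangle_sub[of "S' u" "S u"] by (simp add: distrib_right)
  then have "psd_operator H S' (N + \<epsilon>) \<alpha>"
    using S' sym nonneg H \<alpha> N \<epsilon> by unfold_locales auto
  then show ?thesis
    using close \<epsilon> psd_operator_axioms
    by (intro psd_operator_pair.intro psd_operator_pair_axioms.intro) auto
qed

text \<open>For \<open>h \<le> h\<^sub>0 < 1\<close> the quantity \<open>|ln h|\<close> is at least
  \<open>|ln h\<^sub>0| > 0\<close>, so it can absorb the constant
  \<open>1 + |ln C|\<close>.\<close>

lemma log_factor_bound:
  fixes h h\<^sub>0 C \<gamma> :: real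
  assumes h: "0 < h" "h \<le> h\<^sub>0" "h\<^sub>0 < 1" and C: "0 < C" and \<gamma>: "0 < \<gamma>"
  shows "1 + \<bar>ln (C * h powr \<gamma>)\<bar> \<le> ((1 + \<bar>ln C\<bar>) / \<bar>ln h\<^sub>0\<bar> + \<gamma>) * \<bar>ln h\<bar>"
proof -
  have "ln h \<le> ln h\<^sub>0" using h by (intro ln_mono) auto
  moreover have h0: "ln h\<^sub>0 < 0" using h by (intro ln_less_zero) auto
  ultimately have "\<bar>ln h\<^sub>0\<bar> \<le> \<bar>ln h\<bar>" by linarith
  then have "(1 + \<bar>ln C\<bar>) / \<bar>ln h\<^sub>0\<bar> * \<bar>ln h\<^sub>0\<bar> \<le> (1 + \<bar>ln C\<bar>) / \<bar>ln h\<^sub>0\<bar> * \<bar>ln h\<bar>"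
    by (intro mult_left_mono) auto
  then have "1 + \<bar>ln C\<bar> \<le> (1 + \<bar>ln C\<bar>) / \<bar>ln h\<^sub>0\<bar> * \<bar>ln h\<bar>" using h0 by simp
  moreover have "\<bar>ln (C * h powr \<gamma>)\<bar> \<le> \<bar>ln C\<bar> + \<gamma> * \<bar>ln h\<bar>"
    using C h \<gamma> abs_triangle_ineq[of "ln C" "\<gamma> * ln h"] by (simp add: ln_mult ln_powr abs_mult)
  ultimately show ?thesis by (simp add: distrib_right)
qed

theorem theorem3p1:
  fixes \<Omega> :: "(real^'n) set"
    and A :: "real^'n \<Rightarrow> real^'n^'n"
    and \<kappa> :: "real^'n \<Rightarrow> real"
    and T0 \<alpha> \<theta> \<delta> \<gamma> C \<nu> r L h\<^sub>0 :: real
    and lam :: "nat \<Rightarrow> real"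
    and \<phi> :: "nat \<Rightarrow> (real^'n) L2"
  assumes "CARD('n) \<ge> 2"
    and "convex_polyhedral_domain \<Omega>"
    and "0 < T0" and "0 < \<alpha>" and "\<alpha> < 1"
    and "elliptic_coefficients \<Omega> A \<kappa>"
    and "selfadjoint_on (L2_on \<Omega>) (elliptic_domain \<Omega>) (elliptic_op \<Omega> A \<kappa>)"
    and "positive_definite_on (elliptic_domain \<Omega>) (elliptic_op \<Omega> A \<kappa>)"
    and "has_compact_inverse (L2_on \<Omega>) (elliptic_domain \<Omega>) (elliptic_op \<Omega> A \<kappa>)"
    and "eigensystem (L2_on \<Omega>) (elliptic_domain \<Omega>) (elliptic_op \<Omega> A \<kappa>) lam \<phi>"
    and "pi / 2 < \<theta>" and "\<theta> < pi" and "0 < \<delta>"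
    and "0 < \<gamma>" and "0 < C"
    and "0 \<le> \<nu>" and "\<nu> \<le> 1"
    and "0 < h\<^sub>0" and "h\<^sub>0 < 1"
  shows "\<exists>c. \<forall>f V T\<^sub>h u\<^sub>0 h u u\<^sub>h.
    admissible_nonlinearity \<Omega> T0 L f \<longrightarrow>
    approximation_family (L2_on \<Omega>) (elliptic_inverse \<Omega> A \<kappa>) \<gamma> C V T\<^sub>h \<longrightarrow>
    u\<^sub>0 \<in> frac_domain (L2_on \<Omega>) lam \<phi> \<nu> \<longrightarrow>
    norm (frac_power lam \<phi> \<nu> u\<^sub>0) + f0_norm \<Omega> T0 f \<le> r \<longrightarrow>
    0 < h \<longrightarrow> h < 1 \<longrightarrow> (\<nu> = 0 \<longrightarrow> h \<le> h\<^sub>0) \<longrightarrow>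
    is_solution (L2_on \<Omega>) (elliptic_inverse \<Omega> A \<kappa>) \<alpha> \<theta> \<delta> (superpose \<Omega> f) T0 u\<^sub>0 u \<longrightarrow>
    is_solution (L2_on \<Omega>) (T\<^sub>h h) \<alpha> \<theta> \<delta> (superpose \<Omega> f) T0 (orth_proj (V h) u\<^sub>0) u\<^sub>h \<longrightarrow>
    (\<forall>t\<in>{0<..T0}. norm (u\<^sub>h t - u t) \<le> c * h powr \<gamma> * ell h \<nu> * t powr (- \<alpha> * (1 - \<nu>)))"
proof -
  let ?H = "L2_on \<Omega>" and ?D = "elliptic_domain \<Omega>" and ?L = "elliptic_op \<Omega> A \<kappa>"
  let ?T = "elliptic_inverse \<Omega> A \<kappa>"
  note \<alpha> = assms(4,5) and sa = assms(7) and pd = assms(8) and ci = assms(9) and es = assms(10)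
    and \<nu> = assms(16,17)
  obtain N where psd: "psd_operator ?H ?T N \<alpha>"
    using selfadjoint_inverse_psd[OF sa pd ci \<alpha>] unfolding elliptic_inverse_def by blast
  have hankel: "hankel \<theta> \<delta>" using assms(11,12,13) by unfold_locales
  interpret T: scheme \<theta> \<delta> ?H ?T N \<alpha> using hankel psd by (rule scheme.intro)
  have \<phi>_D: "\<phi> j \<in> ?D" and \<phi>_L: "?L (\<phi> j) = lam j *\<^sub>R \<phi> j"
    and on: "inner (\<phi> i) (\<phi> j) = (if i = j then 1 else 0)"
    and dense: "closure (span (range \<phi>)) = ?H" for i j
    using es by (auto simp: eigensystem_def)
  have \<phi>_H: "\<phi> j \<in> ?H" for j
    using sa \<phi>_D[of j] closure_subset unfolding selfadjoint_on_def by blast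
  have lam: "0 < lam j" for j
  proof -
    have "\<phi> j \<noteq> 0" using on[of j j] by auto
    then have "0 < inner (?L (\<phi> j)) (\<phi> j)" using pd \<phi>_D unfolding positive_definite_on_def by blast
    then show ?thesis using on[of j j] by (simp add: \<phi>_L)
  qed
  have eig: "?T (\<phi> j) = inverse (lam j) *\<^sub>R \<phi> j" for j
  proof -
    have "?T (lam j *\<^sub>R \<phi> j) = \<phi> j"
      using ci \<phi>_D[of j] unfolding \<phi>_L[symmetric] elliptic_inverse_def has_compact_inverse_def bij_betw_def
      by (intro inv_into_f_f) auto
    then have "lam j *\<^sub>R ?T (\<phi> j) = \<phi> j" by (simp add: T.S_scale \<phi>_H)
    then have "inverse (lam j) *\<^sub>R (lam j *\<^sub>R ?T (\<phi> j)) = inverse (lam j) *\<^sub>R \<phi> j" by simp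
    then show ?thesis using lam[of j] by simp
  qed
  \<comment> \<open>The absolute values here and below supply the signs in advance; they change
    nothing for \<open>r\<close> and \<open>L\<close> as soon as admissible data exist.\<close>
  define r' where "r' = \<bar>r\<bar>"
  define M where "M = r' / T.c0"
  define m where "m = N powr \<nu> * r'"
  define \<Lambda> where "\<Lambda> = \<bar>admissible_setting.\<Lambda> \<Omega> L\<bar>"
  have M: "0 \<le> M" using T.c0 by (simp add: M_def r'_def)
  have b: "0 \<le> T.cB * \<Lambda>" using T.constants_nonneg by (simp add: \<Lambda>_def)
  have "\<alpha> * (1 - \<nu>) \<le> \<alpha>" using \<alpha> \<nu> by (intro mult_left_le) auto
  then have \<beta>: "0 \<le> \<alpha> * (1 - \<nu>)" "\<alpha> * (1 - \<nu>) < 1" using \<alpha> \<nu> by (simp, linarith)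
  obtain c where c: "gronwall_constant \<alpha> 0 T0 (T.cB * \<Lambda>) c"
    using singular_gronwall[OF \<alpha> _ _ assms(3) b, of 0] by auto
  obtain c' where c': "gronwall_constant \<alpha> (\<alpha> * (1 - \<nu>)) T0 (T.cB * \<Lambda>) c'"
    using singular_gronwall[OF \<alpha> \<beta> assms(3) b] by blast
  \<comment> \<open>\<open>E.error_const\<close> written outside its locale: the displayed arguments
    are all that it depends on, which shows independence of \<open>h\<close>, of the approximation
    and of the solutions.\<close>
  define EC where "EC = \<bar>error_setting.error_const \<theta> \<alpha> T0 \<Lambda> r' \<nu> c c' m M\<bar>"
  \<comment> \<open>The factor from \<open>log_factor_bound\<close>, which converts the logarithm of
    \<open>C h^\<gamma>\<close> into \<open>|ln h|\<close>; no conversion occurs for positive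
    \<nu>.\<close>
  define lc where "lc = (if \<nu> = 0 then (1 + \<bar>ln C\<bar>) / \<bar>ln h\<^sub>0\<bar> + \<gamma> else 1)"
  show ?thesis
  proof (intro exI[of _ "EC * C * lc"] allI impI ballI)
    fix f V T\<^sub>h u\<^sub>0 h u u\<^sub>h t
    assume adm: "admissible_nonlinearity \<Omega> T0 L f"
      and app: "approximation_family ?H ?T \<gamma> C V T\<^sub>h"
      and u0: "u\<^sub>0 \<in> frac_domain ?H lam \<phi> \<nu>"
      and r: "norm (frac_power lam \<phi> \<nu> u\<^sub>0) + f0_norm \<Omega> T0 f \<le> r"
      and h: "0 < h" "h < 1" and h0: "\<nu> = 0 \<longrightarrow> h \<le> h\<^sub>0"
      and u: "is_solution ?H ?T \<alpha> \<theta> \<delta> (superpose \<Omega> f) T0 u\<^sub>0 u"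
      and uh: "is_solution ?H (T\<^sub>h h) \<alpha> \<theta> \<delta> (superpose \<Omega> f) T0 (orth_proj (V h) u\<^sub>0) u\<^sub>h"
      and t: "t \<in> {0<..T0}"
    interpret F: admissible_setting \<Omega> T0 L f
      using assms(2,3) adm by unfold_locales
    have u0_H: "u\<^sub>0 \<in> ?H" using u0 by (simp add: frac_domain_def)
    have "0 \<le> f0_norm \<Omega> T0 f" using F.superpose_zero[of 0] F.T0 order_trans[OF norm_ge_zero] by force
    then have r1: "norm (frac_power lam \<phi> \<nu> u\<^sub>0) \<le> r'" and r2: "f0_norm \<Omega> T0 f \<le> r'"
      using r norm_ge_zero[of "frac_power lam \<phi> \<nu> u\<^sub>0"] unfolding r'_def by linarith+
    have \<Lambda>_eq: "\<Lambda> = F.\<Lambda>" using F.L by (simp add: \<Lambda>_def F.\<Lambda>_def)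
    have lip: "lipschitz_nonlinearity ?H T0 \<Lambda> r' (superpose \<Omega> f)"
      unfolding \<Lambda>_eq by (rule F.superpose_lipschitz_nonlinearity[OF r2])
    define \<epsilon> where "\<epsilon> = C * h powr \<gamma>"
    have \<epsilon>: "0 < \<epsilon>" using assms(15) h by (simp add: \<epsilon>_def)
    have hI: "h \<in> {0<..<1}" using h by simp
    note app' = app[unfolded approximation_family_def, rule_format, OF hI]
    have pair: "psd_operator_pair ?H (T\<^sub>h h) ?T (N + \<epsilon>) N \<alpha> \<epsilon>"
      using app' \<epsilon> unfolding \<epsilon>_def by (intro T.psd_perturbation) auto
    then have psdh: "psd_operator ?H (T\<^sub>h h) (N + \<epsilon>) \<alpha>" by (simp add: psd_operator_pair_def)
    have "T\<^sub>h h (orth_proj (V h) u\<^sub>0) = T\<^sub>h h u\<^sub>0" using app' u0_H by blast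
    then have uh': "is_solution ?H (T\<^sub>h h) \<alpha> \<theta> \<delta> (superpose \<Omega> f) T0 u\<^sub>0 u\<^sub>h"
      by (rule is_solution_initial_cong[OF uh])
    have \<Lambda>0: "0 \<le> \<Lambda>" and r'0: "0 \<le> r'" by (simp_all add: \<Lambda>_def r'_def)
    have sol1: "solution \<theta> \<delta> ?H (T\<^sub>h h) (N + \<epsilon>) \<alpha> T0 \<Lambda> r' (superpose \<Omega> f) u\<^sub>0 u\<^sub>h"
      using hankel psdh assms(3) \<Lambda>0 r'0 lip u0_H uh'
      by (intro solution.intro scheme.intro solution_axioms.intro) auto
    have sol2: "solution \<theta> \<delta> ?H ?T N \<alpha> T0 \<Lambda> r' (superpose \<Omega> f) u\<^sub>0 u"
      using hankel psd assms(3) \<Lambda>0 r'0 lip u0_H u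
      by (intro solution.intro scheme.intro solution_axioms.intro) auto
    interpret E: error_setting \<theta> \<delta> ?H "T\<^sub>h h" ?T "N + \<epsilon>" N \<alpha> \<epsilon> T0 \<Lambda> r' "superpose \<Omega> f" u\<^sub>0 u\<^sub>h u
      using hankel psdh psd pair sol1 sol2
      by (intro error_setting.intro scheme_pair.intro scheme.intro) auto
    have m: "norm u\<^sub>0 \<le> m"
      using T.frac_domain_norm[OF lam \<phi>_H eig on dense \<nu> u0] mult_left_mono[OF r1, of "N powr \<nu>"]
      by (simp add: m_def)
    have reg: "norm (T.R z (u\<^sub>0, 0)) \<le> M * cmod z powr (\<alpha> * (1 - \<nu>))" if "z \<in> slit" for z
    proof -
      have "norm (T.R z (u\<^sub>0, 0)) \<le> norm (frac_power lam \<phi> \<nu> u\<^sub>0) / T.c0 * cmod z powr (\<alpha> * (1 - \<nu>))"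
        by (rule T.R_frac_domain[OF lam \<phi>_H eig on dense \<nu> u0 T.slit_nonzero[OF that]])
      also have "\<dots> \<le> M * cmod z powr (\<alpha> * (1 - \<nu>))"
        unfolding M_def using r1 T.c0 by (intro mult_right_mono divide_right_mono) auto
      finally show ?thesis .
    qed
    define lf where "lf = (if \<nu> = 0 then 1 + \<bar>ln \<epsilon>\<bar> else 1)"
    have lf: "lf \<le> lc * ell h \<nu>"
      using log_factor_bound[OF h(1) _ assms(19,15,14)] h0 by (simp add: lf_def lc_def ell_def \<epsilon>_def)
    have lf0: "0 \<le> lf" by (simp add: lf_def)
    have "norm (u\<^sub>h t - u t) \<le> E.error_const \<nu> c c' m M * (\<epsilon> * lf) * t powr (- (\<alpha> * (1 - \<nu>)))"
      unfolding lf_def by (rule E.error_rate[OF \<nu> \<epsilon> c c' m M reg t])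
    also have "\<dots> \<le> EC * (\<epsilon> * (lc * ell h \<nu>)) * t powr (- (\<alpha> * (1 - \<nu>)))"
    proof (intro mult_right_mono mult_mono mult_left_mono lf)
      show "E.error_const \<nu> c c' m M \<le> EC" "0 \<le> EC" by (simp_all add: EC_def)
    qed (use \<epsilon> lf0 in auto)
    also have "\<dots> = EC * C * lc * h powr \<gamma> * ell h \<nu> * t powr (- \<alpha> * (1 - \<nu>))"
      by (simp add: \<epsilon>_def)
    finally show "norm (u\<^sub>h t - u t) \<le> EC * C * lc * h powr \<gamma> * ell h \<nu> * t powr (- \<alpha> * (1 - \<nu>))" .
  qed
qed

end
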